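(* Let $M>0$ and $\tau\in(0,1/2)$. There exist constants $C,C_1>0$ depending only on $M$ and $\tau$ such that the following holds for all positive integers $n,p,k$, all $\alpha_0,\kappa>0$ and every $\epsilon\in[0,\tau/3)$. Let $\hat\Gamma$ be any maximizer of $\mathcal{D}_{\mathcal{U}_k}(\Gamma,\{X_i\}_{i=1}^n)$ over $\Gamma\in\mathcal{F}_k$. Then for any $\delta\in(0,1/2)$ satisfying $C_1\frac{k+\log p+\log(1/\delta)}{n}<1$, $$\|\hat\Gamma-\Gamma\|_{\rm op}^2\le C\kappa\left(\left(\frac{k+\log p}{n}\vee\epsilon^2\right)+\frac{\log(1/\delta)}{n}\right)$$ with $\mathbb{P}_{(\epsilon,\Gamma,Q)}$-probability at least $1-2\delta$, uniformly over all probability distributions $Q$ on $\mathbb{R}^p$ and all $\Gamma\in\mathcal{F}_k(M)$, where $P_\Gamma=EC(0,\Gamma,\eta)$ is a non-degenerate elliptical distribution in canonical representation satisfying the marginal condition with parameters $(\tau,\alpha_0,\kappa)$.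
   Context: Elliptical distributions: $X\sim EC(0,\Sigma,\xi)$ on $\mathbb{R}^p$ means $X=\xi AU$ in distribution, where $A\in\mathbb{R}^{p\times r}$ is deterministic, $\Sigma=AA^T$, $U$ is uniform on the unit sphere of $\mathbb{R}^r$, and $\xi\ge0$ is a real random variable independent of $U$. If $s_{\min}(\Sigma)>0$ (non-degenerate), the law of $u^TX/\sqrt{u^T\Sigma u}$ does not depend on $u\in S^{p-1}=\{u\in\mathbb{R}^p:\|u\|=1\}$. $EC(0,\Gamma,\eta)$ is the canonical representation of $EC(0,\Sigma,\xi)$ if $\Gamma=a^{-2}\Sigma$, $\eta=a\xi$ for some $a>0$, and $P_\Gamma\left(\frac{|u^TX|^2}{u^T\Gamma u}\le1\right)=\frac12$, where $P_\Gamma=EC(0,\Gamma,\eta)$; $\Gamma$ is the scatter matrix. $P_\Gamma$ always denotes a canonical representation, so $s_{\min}(\Gamma)>0$. Marginal condition with parameters $(\tau,\alpha_0,\kappa)$, $\tau\in(0,1/2)$, $\alpha_0,\kappa>0$: with $G(t)=P_\Gamma\left(\frac{|u^TX|^2}{u^T\Gamma u}\le t\right)$ (independent of $u$), $G$ is continuous at $t=1$, $\inf_{|t|\ge\alpha_0}|G(1)-G(1+t)|\ge\tau$, and $\inf_{0<|t|<\alpha_0}\frac{|G(1)-G(1+t)|}{|t|}\ge\kappa^{-1/2}$. Contamination model: $\mathbb{P}_{(\epsilon,\Gamma,Q)}=(1-\epsilon)P_\Gamma+\epsilon Q$ with $Q$ an arbitrary probability distribution; $X_1,\dots,X_n$ are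 i.i.d. from it, and the same symbol denotes their joint law. Classes: $\mathcal{F}_k=\{\Gamma=(\gamma_{ij})\in\mathbb{R}^{p\times p},\Gamma\succeq0:\gamma_{ij}=0\text{ if }|i-j|>k\}$; $\mathcal{F}_k(M)=\{\Gamma\in\mathcal{F}_k:s_{\max}(\Gamma)\le M\}$; $s_{\max},s_{\min}$ are largest and smallest singular values. Directions: $\mathcal{V}_{[l_1,l_2]}=\{u\in S^{p-1}:u_i=0\text{ if }i\notin[l_1,l_2]\}$; $\mathcal{U}_k=\bigcup_{l=1}^{p+1-2k}\mathcal{V}_{[l,l+2k-1]}$ if $2k\le p$, and $\mathcal{U}_k=S^{p-1}$ if $2k>p$. Empirical matrix depth relative to $\mathcal{U}$: $$\mathcal{D}_{\mathcal{U}}(\Gamma,\{X_i\}_{i=1}^n)=\min_{u\in\mathcal{U}}\min\left\{\frac1n\sum_{i=1}^n\mathbb{I}\{|u^TX_i|^2\le u^T\Gamma u\},\ \frac1n\sum_{i=1}^n\mathbb{I}\{|u^TX_i|^2\ge u^T\Gamma u\}\right\};$$ it takes finitely many values, so maximizers exist. $\|\cdot\|_{\rm op}$ is the operator norm; $a\vee b=\max(a,b)$. *)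

theory Defs
  imports "HOL-Probability.Probability" "Jordan_Normal_Form.Char_Poly"
begin

unbundle no inner_syntax and no vec_syntax

text \<open>
  The dimension \<open>p\<close> is quantified inside the theorem, so points of \<open>\<real>\<^sup>p\<close> are vectors in
  \<open>carrier_vec p\<close> and matrices are elements of \<open>carrier_mat p q\<close>. Indices start at \<open>0\<close>.
\<close>

section \<open>Euclidean space and matrices\<close>

definition vec_norm2 :: "real vec \<Rightarrow> real" where
  "vec_norm2 v = sqrt (v \<bullet> v)"

definition unit_sphere :: "nat \<Rightarrow> real vec set" where
  "unit_sphere p = {u \<in> carrier_vec p. vec_norm2 u = 1}"

definition quad_form :: "real mat \<Rightarrow> real vec \<Rightarrow> real" where
  "quad_form A u = u \<bullet> (A *\<^sub>v u)"

definition op_norm :: "real mat \<Rightarrow> real" where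
  "op_norm A = (SUP u \<in> unit_sphere (dim_col A). vec_norm2 (A *\<^sub>v u))"

text \<open>Used for square matrices only, where the eigenvalues of \<open>A\<^sup>T A\<close> give all singular values.\<close>

definition singular_values :: "real mat \<Rightarrow> real set" where
  "singular_values A = sqrt ` {l. eigenvalue (transpose_mat A * A) l}"

definition s_max :: "real mat \<Rightarrow> real" where
  "s_max A = Max (singular_values A)"

definition s_min :: "real mat \<Rightarrow> real" where
  "s_min A = Min (singular_values A)"

definition psd :: "nat \<Rightarrow> real mat \<Rightarrow> bool" where
  "psd p A \<longleftrightarrow> A \<in> carrier_mat p p \<and> transpose_mat A = A \<and> (\<forall>v \<in> carrier_vec p. 0 \<le> quad_form A v)"

definition banded :: "nat \<Rightarrow> nat \<Rightarrow> real mat set" where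
  "banded p k = {A. psd p A \<and>
     (\<forall>i<p. \<forall>j<p. \<bar>int i - int j\<bar> > int k \<longrightarrow> A $$ (i, j) = 0)}"

definition banded_bounded :: "nat \<Rightarrow> nat \<Rightarrow> real \<Rightarrow> real mat set" where
  "banded_bounded p k M = {A \<in> banded p k. s_max A \<le> M}"

section \<open>Probability on \<open>carrier_vec p\<close>\<close>

text \<open>The Borel sets of \<open>\<real>\<^sup>p\<close>, transported along \<open>v \<mapsto> (v\<^sub>0, \<dots>, v\<^sub>p\<^sub>-\<^sub>1)\<close>.\<close>

definition borel_vec :: "nat \<Rightarrow> real vec measure" where
  "borel_vec p = vimage_algebra (carrier_vec p) (\<lambda>v. \<lambda>i\<in>{..<p}. v $ i) (PiM {..<p} (\<lambda>_. borel))"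

definition lborel_vec :: "nat \<Rightarrow> real vec measure" where
  "lborel_vec p = distr (PiM {..<p} (\<lambda>_. lborel)) (borel_vec p) (Matrix.vec p)"

text \<open>
  Normalised surface measure on the unit sphere, as the cone measure: the law of \<open>v / \<parallel>v\<parallel>\<close> for
  \<open>v\<close> uniform on the unit ball. The value at the null point \<open>v = 0\<close> is irrelevant.
\<close>

definition uniform_sphere :: "nat \<Rightarrow> real vec measure" where
  "uniform_sphere r =
     distr (uniform_measure (lborel_vec r) {v \<in> carrier_vec r. vec_norm2 v \<le> 1}) (borel_vec r)
       (\<lambda>v. (1 / vec_norm2 v) \<cdot>\<^sub>v v)"

text \<open>
  \<open>elliptical p \<Sigma> \<xi> P\<close>: the measure \<open>P\<close> is \<open>EC(0,\<Sigma>,\<xi>)\<close>, where the law \<open>\<xi>\<close> stands for the radial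
  variable; independence of \<open>\<xi>\<close> and \<open>U\<close> is the product measure.
\<close>

definition elliptical :: "nat \<Rightarrow> real mat \<Rightarrow> real measure \<Rightarrow> real vec measure \<Rightarrow> bool" where
  "elliptical p \<Sigma> \<xi> P \<longleftrightarrow>
     prob_space \<xi> \<and> sets \<xi> = sets borel \<and> (AE s in \<xi>. 0 \<le> s) \<and>
     (\<exists>r\<ge>1. \<exists>A \<in> carrier_mat p r. \<Sigma> = A * transpose_mat A \<and>
        P = distr (\<xi> \<Otimes>\<^sub>M uniform_sphere r) (borel_vec p) (\<lambda>(s, v). s \<cdot>\<^sub>v (A *\<^sub>v v)))"

definition marginal_cdf :: "real mat \<Rightarrow> real vec measure \<Rightarrow> real vec \<Rightarrow> real \<Rightarrow> real" where
  "marginal_cdf \<Gamma> P u t = measure P {x \<in> space P. \<bar>u \<bullet> x\<bar>\<^sup>2 / quad_form \<Gamma> u \<le> t}"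

text \<open>
  A representation \<open>EC(0,\<Gamma>,\<eta>)\<close> is the canonical one of its law if the median condition holds; the
  scaling \<open>\<Gamma> = a\<^sup>-\<^sup>2 \<Sigma>\<close>, \<open>\<eta> = a \<xi>\<close> relating it to other representations of that law can be taken with
  \<open>a = 1\<close>. The marginal law does not depend on the direction \<open>u\<close>; here and in the marginal
  condition it is taken along every \<open>u\<close> of the unit sphere.
\<close>

definition canonical_elliptical :: "nat \<Rightarrow> real mat \<Rightarrow> real measure \<Rightarrow> real vec measure \<Rightarrow> bool" where
  "canonical_elliptical p \<Gamma> \<eta> P \<longleftrightarrow>
     elliptical p \<Gamma> \<eta> P \<and> 0 < s_min \<Gamma> \<and> (\<forall>u \<in> unit_sphere p. marginal_cdf \<Gamma> P u 1 = 1 / 2)"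

definition marginal_condition ::
    "nat \<Rightarrow> real \<Rightarrow> real \<Rightarrow> real \<Rightarrow> real mat \<Rightarrow> real vec measure \<Rightarrow> bool" where
  "marginal_condition p \<tau> \<alpha>\<^sub>0 \<kappa> \<Gamma> P \<longleftrightarrow>
     (\<forall>u \<in> unit_sphere p. let G = marginal_cdf \<Gamma> P u in
        isCont G 1 \<and>
        (INF t \<in> {t. \<alpha>\<^sub>0 \<le> \<bar>t\<bar>}. \<bar>G 1 - G (1 + t)\<bar>) \<ge> \<tau> \<and>
        (INF t \<in> {t. 0 < \<bar>t\<bar> \<and> \<bar>t\<bar> < \<alpha>\<^sub>0}. \<bar>G 1 - G (1 + t)\<bar> / \<bar>t\<bar>) \<ge> \<kappa> powr (- 1 / 2))"

definition contaminated :: "real \<Rightarrow> 'a measure \<Rightarrow> 'a measure \<Rightarrow> 'a measure" where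
  "contaminated \<epsilon> P Q = measure_of (space P) (sets P)
     (\<lambda>A. ennreal (1 - \<epsilon>) * emeasure P A + ennreal \<epsilon> * emeasure Q A)"

definition sample_law :: "nat \<Rightarrow> 'a measure \<Rightarrow> (nat \<Rightarrow> 'a) measure" where
  "sample_law n N = PiM {..<n} (\<lambda>_. N)"

section \<open>Matrix depth\<close>

text \<open>\<open>block_directions p l m\<close> are the unit vectors supported on the \<open>m\<close> coordinates \<open>l, \<dots>, l + m - 1\<close>.\<close>

definition block_directions :: "nat \<Rightarrow> nat \<Rightarrow> nat \<Rightarrow> real vec set" where
  "block_directions p l m = {u \<in> unit_sphere p. \<forall>i<p. i \<notin> {l..<l + m} \<longrightarrow> u $ i = 0}"

definition directions :: "nat \<Rightarrow> nat \<Rightarrow> real vec set" where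
  "directions p k =
     (if 2 * k \<le> p then (\<Union>l \<in> {0..p - 2 * k}. block_directions p l (2 * k)) else unit_sphere p)"

definition matrix_depth :: "real vec set \<Rightarrow> nat \<Rightarrow> (nat \<Rightarrow> real vec) \<Rightarrow> real mat \<Rightarrow> real" where
  "matrix_depth U n X \<Gamma> = Min ((\<lambda>u.
     min (1 / real n * (\<Sum>i<n. of_bool (\<bar>u \<bullet> X i\<bar>\<^sup>2 \<le> quad_form \<Gamma> u)))
         (1 / real n * (\<Sum>i<n. of_bool (\<bar>u \<bullet> X i\<bar>\<^sup>2 \<ge> quad_form \<Gamma> u)))) ` U)"

text \<open>An arbitrary choice of a depth maximiser for every sample; no measurability is required.\<close>

definition depth_estimator ::
    "nat \<Rightarrow> nat \<Rightarrow> nat \<Rightarrow> ((nat \<Rightarrow> real vec) \<Rightarrow> real mat) \<Rightarrow> bool" where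
  "depth_estimator n p k \<Gamma>hat \<longleftrightarrow>
     (\<forall>X \<in> space (sample_law n (borel_vec p)).
        is_arg_max (matrix_depth (directions p k) n X) (\<lambda>\<Gamma>. \<Gamma> \<in> banded p k) (\<Gamma>hat X))"

text \<open>
  Inner probability: since the estimator need not be measurable, the event is only required
  to contain a measurable event of the given probability (for measurable events this is
  \<open>measure N {x \<in> space N. \<phi> x} \<ge> q\<close>).
\<close>

definition holds_with_prob_at_least :: "'a measure \<Rightarrow> real \<Rightarrow> ('a \<Rightarrow> bool) \<Rightarrow> bool" where
  "holds_with_prob_at_least N q \<phi> \<longleftrightarrow> (\<exists>E \<in> sets N. measure N E \<ge> q \<and> (\<forall>x \<in> E. \<phi> x))"

end

theory Submission
  imports Defs "Jordan_Normal_Form.Spectral_Radius"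
begin

text \<open>
  The estimate is a comparison of two depths on a single event. Suppose that for every block direction
  \<open>u\<close> and every level \<open>T\<close> the empirical frequencies of the slabs \<open>{x. (u \<bullet> x)\<^sup>2 \<le> T}\<close> and
  \<open>{x. T \<le> (u \<bullet> x)\<^sup>2}\<close> are within \<open>\<Delta>\<close> of their probabilities under the contaminated law. The true
  scatter matrix puts probability at least \<open>1/2\<close> on both slabs at its own level under \<open>P\<close>, so its depth is
  at least \<open>(1 - \<epsilon>)/2 - \<Delta>\<close>, and a maximiser has at least this depth. Read backwards, both slabs at the
  level of the maximiser have \<open>P\<close>-probability at least \<open>1/2 - e\<close> with
  \<open>e = (2\<Delta> + \<epsilon>)/(1 - \<epsilon>)\<close>. The marginal condition says that the median moves by at most
  \<open>e \<surd>\<kappa>\<close> under such a perturbation, and this bounds the difference \<open>E\<close> of the two matrices in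
  the block directions by \<open>M e \<surd>\<kappa>\<close>.

  The passage from block directions to all directions is a summation trick: for a matrix of bandwidth
  \<open>k\<close>, \<open>k\<close> times the quadratic form at \<open>w\<close> is the sum of its values at the restrictions of \<open>w\<close> to the
  windows of length \<open>2k\<close>, minus the same sum for length \<open>k\<close>, because the entry \<open>(i, j)\<close> is counted
  \<open>(2k - |i - j|) - (k - |i - j|) = k\<close> times (\<open>banded_quad_form_le\<close>). Polarisation then bounds
  the operator norm by three times the bound on the blocks.

  The probabilistic part must give \<open>\<Delta>\<^sup>2\<close> of order \<open>(k + ln p + ln (1/\<delta>))/n\<close>, with no factor
  \<open>ln n\<close>. A slab is a combination of two affine halfspaces, so it is enough to control the halfspaces
  whose normal lies in one block of \<open>2k\<close> coordinates; there are at most \<open>p\<close> blocks, and a union bound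
  over them costs the term \<open>ln p\<close>. The halfspaces of one block have Vapnik-Chervonenkis dimension at
  most \<open>2k + 1\<close>. A union bound over the traces of such a class on the sample would lose the
  logarithm. Instead a second sample is introduced, the randomness is moved into independent swaps
  of paired points (\<open>ghost_sample\<close>, \<open>swap_symmetrisation\<close>), and the resulting signed sums are controlled by
  chaining (\<open>chaining_signed_sum\<close>). The chaining needs packing numbers in the Hamming distance that depend on
  \<open>m/r\<close> only and not on the number \<open>m\<close> of points; Dudley's subsampling argument provides them
  (\<open>packing_bound\<close>). The outcome is \<open>vc_uniform_deviation\<close>.
\<close>

section \<open>Shattering\<close>

definition shatters :: "'a set set \<Rightarrow> 'a set \<Rightarrow> bool" where
  "shatters F S \<longleftrightarrow> (\<forall>T\<subseteq>S. \<exists>A\<in>F. A \<inter> S = T)"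

definition vc_at_most :: "nat \<Rightarrow> 'a set set \<Rightarrow> bool" where
  "vc_at_most D F \<longleftrightarrow> (\<forall>S. finite S \<longrightarrow> shatters F S \<longrightarrow> card S \<le> D)"

lemma shatters_mono: "shatters F S \<Longrightarrow> F \<subseteq> G \<Longrightarrow> shatters G S"
  unfolding shatters_def by (meson subsetD)

lemma vc_at_most_mono: "vc_at_most D G \<Longrightarrow> F \<subseteq> G \<Longrightarrow> vc_at_most D F"
  unfolding vc_at_most_def by (intro allI impI) (drule spec, drule mp, assumption, erule mp, erule shatters_mono, assumption)

lemma shatters_trace:
  assumes "shatters ((\<lambda>A. A \<inter> X) ` F) S"
  shows "shatters F S"
proof -
  have "S \<subseteq> X"
    using assms unfolding shatters_def by blast
  show ?thesis
    unfolding shatters_def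
  proof (intro allI impI)
    fix T assume "T \<subseteq> S"
    then obtain A where "A \<in> F" "A \<inter> X \<inter> S = T"
      using assms unfolding shatters_def by blast
    with \<open>S \<subseteq> X\<close> show "\<exists>A\<in>F. A \<inter> S = T" by blast
  qed
qed

lemma vc_at_most_trace:
  "vc_at_most D F \<Longrightarrow> vc_at_most D ((\<lambda>A. A \<inter> X) ` F)"
  unfolding vc_at_most_def by (intro allI impI) (drule shatters_trace, simp)

text \<open>
  Pajor's form of the Sauer-Shelah lemma. Removing a point \<open>x\<close> splits \<open>F\<close> into the sets without \<open>x\<close> and
  the sets with \<open>x\<close>, the latter stripped of \<open>x\<close>; what the union of the two parts shatters is shattered by
  \<open>F\<close>, and what their intersection shatters is shattered by \<open>F\<close> even after \<open>x\<close> is added.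
\<close>

lemma card_le_card_shattered:
  assumes "finite X" "F \<subseteq> Pow X"
  shows "card F \<le> card {S. S \<subseteq> X \<and> shatters F S}"
  using assms
proof (induction X arbitrary: F rule: finite_induct)
  case empty
  show ?case
  proof (cases "F = {}")
    case False
    with empty have "F = {{}}" by (metis Pow_empty subset_singletonD)
    then have "{S. S \<subseteq> {} \<and> shatters F S} = {{}}" by (auto simp: shatters_def)
    then show ?thesis using \<open>F = {{}}\<close> by simp
  qed simp
next
  case (insert x X)
  define G0 where "G0 = {A\<in>F. x \<notin> A}"
  define G1 where "G1 = (\<lambda>A. A - {x}) ` {A\<in>F. x \<in> A}"
  have finF: "finite F"
    using insert.prems insert.hyps finite_subset by (metis finite_Pow_iff finite_insert)
  have inj: "inj_on (\<lambda>A. A - {x}) {A\<in>F. x \<in> A}"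
    by (auto simp: inj_on_def)
  have G: "G0 \<subseteq> Pow X" "G1 \<subseteq> Pow X" "finite G0" "finite G1"
    using insert.prems finF unfolding G0_def G1_def by (blast, blast, simp, simp)
  have "card F = card ({A\<in>F. x \<notin> A} \<union> {A\<in>F. x \<in> A})"
    by (rule arg_cong[where f=card]) auto
  also have "\<dots> = card G0 + card {A\<in>F. x \<in> A}"
    unfolding G0_def using finF by (subst card_Un_disjoint) auto
  also have "card {A\<in>F. x \<in> A} = card G1"
    unfolding G1_def using inj by (simp add: card_image)
  also have "card G0 + card G1 = card (G0 \<union> G1) + card (G0 \<inter> G1)"
    using G(3,4) by (rule card_Un_Int)
  finally have cF: "card F = card (G0 \<union> G1) + card (G0 \<inter> G1)" .
  let ?S0 = "{S. S \<subseteq> X \<and> shatters (G0 \<union> G1) S}"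
  let ?S1 = "{S. S \<subseteq> X \<and> shatters (G0 \<inter> G1) S}"
  have f: "finite ?S0" "finite ?S1"
    using insert.hyps by auto
  have "shatters F S" if S: "S \<subseteq> X" "shatters (G0 \<union> G1) S" for S
    unfolding shatters_def
  proof (intro allI impI)
    fix T assume "T \<subseteq> S"
    then obtain A where A: "A \<in> G0 \<union> G1" "A \<inter> S = T"
      using S unfolding shatters_def by blast
    moreover have "x \<notin> S" using S insert.hyps by auto
    ultimately show "\<exists>A\<in>F. A \<inter> S = T"
      unfolding G0_def G1_def by blast
  qed
  moreover have "shatters F (insert x S)" if S: "S \<subseteq> X" "shatters (G0 \<inter> G1) S" for S
    unfolding shatters_def
  proof (intro allI impI)
    fix T assume "T \<subseteq> insert x S"
    then have "T - {x} \<subseteq> S" by auto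
    then obtain A where A: "A \<in> G0" "A \<in> G1" "A \<inter> S = T - {x}"
      using S unfolding shatters_def by blast
    have "x \<notin> S" using S insert.hyps by auto
    have AF: "A \<in> F" "x \<notin> A" "insert x A \<in> F"
      using A(1,2) unfolding G0_def G1_def by (auto simp: insert_absorb)
    show "\<exists>A\<in>F. A \<inter> insert x S = T"
    proof (cases "x \<in> T")
      case True
      then have "insert x A \<inter> insert x S = T" using A \<open>T \<subseteq> insert x S\<close> by blast
      then show ?thesis using AF by blast
    next
      case False
      then have "A \<inter> insert x S = T" using A AF \<open>T \<subseteq> insert x S\<close> by blast
      then show ?thesis using AF by blast
    qed
  qed
  ultimately have sub: "?S0 \<union> insert x ` ?S1 \<subseteq> {S. S \<subseteq> insert x X \<and> shatters F S}"
    by blast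
  have dis: "?S0 \<inter> insert x ` ?S1 = {}"
    using insert.hyps by blast
  have injx: "inj_on (insert x) ?S1"
  proof (rule inj_onI)
    fix A B assume "A \<in> ?S1" "B \<in> ?S1" "insert x A = insert x B"
    moreover from this have "x \<notin> A" "x \<notin> B" using insert.hyps by blast+
    ultimately show "A = B" by (simp add: insert_ident)
  qed
  have "card F \<le> card ?S0 + card ?S1"
    unfolding cF using insert.IH[of "G0 \<union> G1"] insert.IH[of "G0 \<inter> G1"] G by (intro add_mono) auto
  also have "\<dots> = card (?S0 \<union> insert x ` ?S1)"
    using f dis injx by (subst card_Un_disjoint) (auto simp: card_image)
  also have "\<dots> \<le> card {S. S \<subseteq> insert x X \<and> shatters F S}"
    using insert.hyps by (intro card_mono[OF _ sub]) auto
  finally show ?case .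
qed

text \<open>
  The weight \<open>x\<close> is left free: the usual bound \<open>(e m/D)\<^sup>D\<close> is the choice \<open>x = D/m\<close>, but the packing
  bound below wants \<open>x\<close> tied to the separation, which spares it the solution of a transcendental
  inequality.
\<close>

lemma sauer_shelah_exp:
  fixes x :: real
  assumes X: "finite X" "F \<subseteq> Pow X" and vc: "vc_at_most D F" and x: "0 < x" "x \<le> 1"
  shows "x ^ D * real (card F) \<le> exp (x * real (card X))"
proof -
  let ?Sh = "{S. S \<subseteq> X \<and> shatters F S}"
  have sub: "?Sh \<subseteq> Pow X" by auto
  have "x ^ D * real (card F) \<le> x ^ D * real (card ?Sh)"
    using card_le_card_shattered[OF X] x by (intro mult_left_mono) auto
  also have "\<dots> = (\<Sum>S\<in>?Sh. x ^ D)"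
    by simp
  also have "\<dots> \<le> (\<Sum>S\<in>?Sh. x ^ card S)"
  proof (intro sum_mono power_decreasing)
    fix S assume "S \<in> ?Sh"
    then show "card S \<le> D"
      using vc X finite_subset unfolding vc_at_most_def by blast
  qed (use x in auto)
  also have "\<dots> \<le> (\<Sum>S\<in>Pow X. x ^ card S)"
    using X x by (intro sum_mono2) auto
  also have "\<dots> = (\<Sum>S\<in>Pow X. (\<Prod>i\<in>S. x) * (\<Prod>i\<in>X-S. 1))"
    by simp
  also have "\<dots> = (\<Prod>i\<in>X. x + 1)"
    using prod_add[OF X(1), of "\<lambda>_. x" "\<lambda>_. 1"] by simp
  also have "\<dots> \<le> exp x ^ card X"
    using x exp_ge_add_one_self[of x] by (simp add: power_mono add.commute)
  finally show ?thesis
    by (simp add: exp_of_nat2_mult mult.commute)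
qed

section \<open>Packing numbers\<close>

definition separated :: "real \<Rightarrow> 'a set set \<Rightarrow> bool" where
  "separated r F \<longleftrightarrow> (\<forall>A\<in>F. \<forall>B\<in>F. A \<noteq> B \<longrightarrow> r < real (card (sym_diff A B)))"

lemma separated_net_exists:
  assumes "finite F" "0 \<le> r"
  shows "\<exists>T\<subseteq>F. separated r T \<and> (\<forall>A\<in>F. \<exists>B\<in>T. real (card (sym_diff A B)) \<le> r)"
proof -
  let ?C = "{T. T \<subseteq> F \<and> separated r T}"
  have "finite ?C" using assms by auto
  moreover have "{} \<in> ?C" by (auto simp: separated_def)
  ultimately have "Max (card ` ?C) \<in> card ` ?C"
    by (intro Max_in) auto
  then obtain T where T: "T \<in> ?C" "card T = Max (card ` ?C)"
    by (metis (no_types, lifting) imageE)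
  have Tmax: "card T' \<le> card T" if "T' \<in> ?C" for T'
    unfolding T(2) using that \<open>finite ?C\<close> by (intro Max_ge) auto
  have "\<exists>B\<in>T. real (card (sym_diff A B)) \<le> r" if A: "A \<in> F" for A
  proof (rule ccontr)
    assume c: "\<not> ?thesis"
    have "A \<notin> T" using c assms(2) by auto
    have "separated r (insert A T)"
      unfolding separated_def
    proof (intro ballI impI)
      fix B C assume BC: "B \<in> insert A T" "C \<in> insert A T" "B \<noteq> C"
      have sym: "card (sym_diff B A) = card (sym_diff A B)"
        by (simp add: Un_commute)
      have far: "r < real (card (sym_diff A B))" if "B \<in> T" for B
        using c that by (meson not_le)
      consider "B = A" "C \<in> T" | "C = A" "B \<in> T" | "B \<in> T" "C \<in> T"
        using BC by auto
      then show "r < real (card (sym_diff B C))"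
      proof cases
        case 1
        then show ?thesis using far[of C] by simp
      next
        case 2
        then show ?thesis using far[of B] sym by simp
      next
        case 3
        then show ?thesis using T(1) BC(3) unfolding separated_def by auto
      qed
    qed
    then have "card (insert A T) \<le> card T"
 using T(1) A by (intro Tmax) auto
    moreover have "finite T" using T assms finite_subset by auto
    ultimately show False using \<open>A \<notin> T\<close> by simp
  qed
  then show ?thesis using T by auto
qed

text \<open>
  Dudley's argument. If \<open>s\<close> points are drawn at random with \<open>s\<close> just above \<open>2 (m/r) ln N\<close>, where
  \<open>m\<close> is the number of points and \<open>N\<close> the number of sets, then with positive probability every two of the
  sets already differ on the points drawn. So \<open>N\<close> is a number of traces on \<open>s\<close> points, which the
  Sauer-Shelah bound with weight \<open>r/(4m)\<close> estimates by \<open>(4m/r)\<^sup>D\<close> times about \<open>\<surd>N\<close>. Dividing by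
  \<open>\<surd>N\<close> and squaring gives the claim.
\<close>

lemma packing_bound:
  fixes r :: real
  assumes X: "finite X" "F \<subseteq> Pow X" and vc: "vc_at_most D F"
    and sep: "separated r F" and r: "0 < r" "r \<le> real (card X)"
  shows "real (card F) \<le> exp (1 / 2) * (4 * real (card X) / r) ^ (2 * D)"
proof -
  define m where "m = real (card X)"
  define N where "N = real (card F)"
  have m: "0 < m" "r \<le> m" using r by (auto simp: m_def)
  have finF: "finite F" using X finite_subset by auto
  have ge1: "1 \<le> (4 * m / r) ^ (2 * D)"
    using m r by (intro one_le_power) (simp add: field_simps)
  show ?thesis
  proof (cases "N \<le> 1")
    case True
    have "1 * 1 \<le> exp (1 / 2 :: real) * (4 * m / r) ^ (2 * D)"
      using ge1 by (intro mult_mono) auto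
    then show ?thesis using True by (simp add: N_def m_def)
  next
    case False
    then have N: "N > 1" by simp
    define s where "s = nat \<lceil>2 * (m / r) * ln N\<rceil>"
    have s0: "0 \<le> 2 * (m / r) * ln N" using N m r by simp
    have s1: "2 * (m / r) * ln N \<le> real s" unfolding s_def by linarith
    have s2: "real s \<le> 2 * (m / r) * ln N + 1" unfolding s_def using s0 by linarith
    let ?P = "{(A, B). A \<in> F \<and> B \<in> F \<and> A \<noteq> B}"
    let ?bad = "\<lambda>(A, B). PiE {..<s} (\<lambda>_. X - sym_diff A B)"
    have P: "?P = F \<times> F - (\<lambda>A. (A, A)) ` F" by auto
    have finP: "finite ?P" unfolding P using finF by auto
    have "card ?P = card F * card F - card F"
      unfolding P using finF by (subst card_Diff_subset) (auto simp: card_cartesian_product card_image inj_on_def)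
    then have cP: "real (card ?P) < N * N"
    proof -
      have "card F * card F - card F < card F * card F"
        using N unfolding N_def by (intro diff_less) (auto intro: Nat.gr0I)
      then have "real (card F * card F - card F) < real (card F * card F)" by linarith
      then show ?thesis unfolding N_def \<open>card ?P = _\<close> by simp
    qed
    have cbad: "real (card (?bad p)) \<le> m ^ s / (N * N)" if p: "p \<in> ?P" for p
    proof -
      obtain A B where AB: "p = (A, B)" "A \<in> F" "B \<in> F" "A \<noteq> B" using p by auto
      have sub: "sym_diff A B \<subseteq> X" using AB X by auto
      have "card (?bad p) = card (X - sym_diff A B) ^ s"
        using AB by (simp add: card_PiE)
      also have "card (X - sym_diff A B) = card X - card (sym_diff A B)"
        using sub X by (intro card_Diff_subset) (auto dest: finite_subset)
      finally have c: "card (?bad p) = (card X - card (sym_diff A B)) ^ s" .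
      have le: "card (sym_diff A B) \<le> card X" using sub X by (intro card_mono)
      have "real (card X - card (sym_diff A B)) \<le> m - r"
      proof -
        have "r < real (card (sym_diff A B))"
          using sep AB(2-4) unfolding separated_def by blast
        then show ?thesis using le by (simp add: m_def of_nat_diff)
      qed
      also have "\<dots> = m * (1 - r / m)" using m by (simp add: field_simps)
      also have "\<dots> \<le> m * exp (- (r / m))"
        using m exp_ge_add_one_self[of "- (r / m)"] by (intro mult_left_mono) auto
      finally have "real (card (?bad p)) \<le> (m * exp (- (r / m))) ^ s"
        unfolding c by (simp add: power_mono)
      also have "\<dots> = m ^ s * exp (- (r / m * real s))"
        by (simp add: power_mult_distrib exp_of_nat2_mult[symmetric])
      also have "\<dots> \<le> m ^ s * exp (- (2 * ln N))"
      proof -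
        have "2 * ln N = r / m * (2 * (m / r) * ln N)" using m r by (simp add: field_simps)
        also have "\<dots> \<le> r / m * real s" using s1 m r by (intro mult_left_mono) auto
        finally show ?thesis using m by (intro mult_left_mono) auto
      qed
      also have "exp (- (2 * ln N)) = 1 / (N * N)"
        unfolding exp_minus mult_2 exp_add using N by (simp add: inverse_eq_divide)
      finally show ?thesis by simp
    qed
    \<comment> \<open>The draws are the functions into \<open>X\<close>; a draw is bad for a pair of sets if it misses their
      symmetric difference. Fewer than \<open>N\<^sup>2\<close> pairs, each spoiling a fraction of at most \<open>1/N\<^sup>2\<close> of the draws.\<close>
    have "\<exists>f \<in> PiE {..<s} (\<lambda>_. X). \<forall>p\<in>?P. f \<notin> ?bad p"
    proof (rule ccontr)
      assume c: "\<not> ?thesis"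
      have "PiE {..<s} (\<lambda>_. X) \<subseteq> (\<Union>p\<in>?P. ?bad p)"
      proof
        fix f assume "f \<in> PiE {..<s} (\<lambda>_. X)"
        with c obtain p where "p \<in> ?P" "f \<in> ?bad p" by meson
        then show "f \<in> (\<Union>p\<in>?P. ?bad p)" by (rule UN_I)
      qed
      moreover have "finite (\<Union>p\<in>?P. ?bad p)"
        using finP X by (intro finite_UN_I) (auto intro!: finite_PiE)
      ultimately have "card (PiE {..<s} (\<lambda>_. X)) \<le> card (\<Union>p\<in>?P. ?bad p)"
        by (intro card_mono)
      also have "\<dots> \<le> (\<Sum>p\<in>?P. card (?bad p))" using finP by (rule card_UN_le)
      finally have "real (card (PiE {..<s} (\<lambda>_. X))) \<le> (\<Sum>p\<in>?P. real (card (?bad p)))"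
        unfolding of_nat_sum[symmetric] of_nat_le_iff .
      also have "\<dots> \<le> (\<Sum>p\<in>?P. m ^ s / (N * N))" using cbad by (rule sum_mono)
      also have "\<dots> = real (card ?P) * (m ^ s / (N * N))" by simp
      also have "\<dots> < N * N * (m ^ s / (N * N))" using cP m N by (intro mult_strict_right_mono) auto
      also have "\<dots> = m ^ s" using N by simp
      finally show False by (simp add: card_PiE m_def)
    qed
    then obtain f where f: "f \<in> PiE {..<s} (\<lambda>_. X)" "\<And>p. p \<in> ?P \<Longrightarrow> f \<notin> ?bad p" by meson
    define S where "S = f ` {..<s}"
    have SX: "S \<subseteq> X" using f by (auto simp: S_def)
    have "card S \<le> s" unfolding S_def using card_image_le[of "{..<s}" f] by simp
    have inj: "inj_on (\<lambda>A. A \<inter> S) F"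
    proof (rule inj_onI, rule ccontr)
      fix A B assume AB: "A \<in> F" "B \<in> F" "A \<inter> S = B \<inter> S" "A \<noteq> B"
      then have "(A, B) \<in> ?P" by auto
      then have "f \<notin> PiE {..<s} (\<lambda>_. X - sym_diff A B)" using f(2) by fastforce
      then obtain i where "i < s" "f i \<in> sym_diff A B"
        using f(1) by (auto simp: PiE_iff)
      then show False using AB by (auto simp: S_def)
    qed
    have x: "0 < r / (4 * m)" "r / (4 * m) \<le> 1" using m r by (auto simp: field_simps)
    have "(r / (4 * m)) ^ D * N = (r / (4 * m)) ^ D * real (card ((\<lambda>A. A \<inter> S) ` F))"
      using inj by (simp add: card_image N_def)
    also have "\<dots> \<le> exp (r / (4 * m) * real (card S))"
    proof (rule sauer_shelah_exp[OF _ _ vc_at_most_trace[OF vc] x])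
      show "finite S" by (simp add: S_def)
      show "(\<lambda>A. A \<inter> S) ` F \<subseteq> Pow S" by blast
    qed
    also have "\<dots> \<le> exp (ln N / 2 + 1 / 4)"
    proof -
      have "r / (4 * m) * real (card S) \<le> r / (4 * m) * (2 * (m / r) * ln N + 1)"
      proof (rule mult_left_mono)
        have "real (card S) \<le> real s" using \<open>card S \<le> s\<close> by simp
        then show "real (card S) \<le> 2 * (m / r) * ln N + 1" using s2 by (rule order_trans)
        show "0 \<le> r / (4 * m)" using x(1) by (rule less_imp_le)
      qed
      also have "\<dots> = (r / (4 * m) * (2 * (m / r))) * ln N + r / (4 * m)"
        by (simp only: distrib_left mult.assoc mult_1_right)
      also have "r / (4 * m) * (2 * (m / r)) = 1 / 2" using m(1) r(1) by simp
      also have "1 / 2 * ln N + r / (4 * m) \<le> ln N / 2 + 1 / 4" using m by (simp add: divide_le_eq)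
      finally show ?thesis by (simp only: exp_le_cancel_iff)
    qed
    finally have le: "(r / (4 * m)) ^ D * N \<le> exp (ln N / 2 + 1 / 4)" .
    have "((r / (4 * m)) ^ D * N)\<^sup>2 \<le> (exp (ln N / 2 + 1 / 4))\<^sup>2"
      using le x N by (intro power_mono) auto
    also have "\<dots> = exp (ln N + 1 / 2)"
      unfolding exp_double[symmetric] by simp
    also have "\<dots> = N * exp (1 / 2)" using N by (simp add: exp_add)
    finally have sq: "((r / (4 * m)) ^ D * N)\<^sup>2 \<le> N * exp (1 / 2)" .
    define z where "z = (r / (4 * m)) ^ (2 * D)"
    have z: "z > 0" "z = ((r / (4 * m)) ^ D)\<^sup>2"
      using x by (simp_all only: z_def power_even_eq zero_less_power)
    have "N * (z * N) \<le> N * exp (1 / 2)"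
      using sq z(2) by (simp add: power2_eq_square mult_ac)
    then have "z * N \<le> exp (1 / 2)"
      using N by simp
    then have "N * z \<le> exp (1 / 2)" by (simp only: mult.commute)
    then have "N \<le> exp (1 / 2) / z" using z(1) by (simp only: pos_le_divide_eq)
    then have "N \<le> exp (1 / 2) * (1 / z)" by simp
    also have "1 / z = (4 * m / r) ^ (2 * D)"
    proof -
      have "4 * m / r = 1 / (r / (4 * m))" by simp
      then show ?thesis by (simp only: z_def power_one_over)
    qed
    finally show ?thesis by (simp add: N_def m_def)
  qed
qed

section \<open>Signed sums and chaining\<close>

text \<open>
  The moment generating function of a random sign; it is Hoeffding's lemma for the fair coin on
  \<open>{-1, 1}\<close>.
\<close>

lemma cosh_le_exp_half_square: "exp x + exp (- x) \<le> 2 * exp (x\<^sup>2 / 2)" for x :: real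
proof -
  have *: "exp x + exp (- x) \<le> 2 * exp (x\<^sup>2 / 2)" if "x \<ge> 0" for x :: real
  proof -
    have pos: "0 < 1 + 1 / 2 * (exp (2 * x) - 1)" by (simp add: field_simps add_pos_pos)
    have le: "exp (- (2 * x) * (1 / 2) + ln (1 + 1 / 2 * (exp (2 * x) - 1))) \<le> exp ((2 * x)\<^sup>2 / 8)"
      using Hoeffdings_lemma_aux[of "2 * x" "1 / 2"] that by simp
    have eq1: "exp (- (2 * x) * (1 / 2) + ln (1 + 1 / 2 * (exp (2 * x) - 1)))
        = exp (- x) * (1 + 1 / 2 * (exp (2 * x) - 1))"
      unfolding exp_add using pos by simp
    have eq2: "(2 * x)\<^sup>2 / 8 = x\<^sup>2 / 2" by (simp add: power2_eq_square)
    have "exp (- x) * (1 + 1 / 2 * (exp (2 * x) - 1)) \<le> exp (x\<^sup>2 / 2)"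
      using le unfolding eq1 eq2 .
    moreover have "exp (- x) * exp (2 * x) = exp x"
      by (simp add: exp_add[symmetric])
    ultimately show ?thesis by (simp add: algebra_simps)
  qed
  show ?thesis
    using *[of x] *[of "- x"] by (cases "x \<ge> 0") auto
qed

text \<open>
  A Rademacher sum: \<open>S\<close> is the set of indices with sign \<open>+1\<close>, so that averaging over the signs is counting
  the subsets of \<open>I\<close>.
\<close>

definition signed_sum :: "'i set \<Rightarrow> 'i set \<Rightarrow> ('i \<Rightarrow> real) \<Rightarrow> real" where
  "signed_sum I S a = (\<Sum>i\<in>I. (if i \<in> S then a i else - a i))"

lemma signed_sum_diff:
  "signed_sum I S (\<lambda>i. a i - b i) = signed_sum I S a - signed_sum I S b"
  unfolding signed_sum_def sum_subtractf[symmetric] by (rule sum.cong) auto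

lemma sum_exp_signed_sum_le:
  assumes "finite I"
  shows "(\<Sum>S\<in>Pow I. exp (t * signed_sum I S a)) \<le> 2 ^ card I * exp (t\<^sup>2 * (\<Sum>i\<in>I. (a i)\<^sup>2) / 2)"
proof -
  have "exp (t * signed_sum I S a) = (\<Prod>i\<in>S. exp (t * a i)) * (\<Prod>i\<in>I - S. exp (- (t * a i)))"
    if S: "S \<in> Pow I" for S
  proof -
    have "signed_sum I S a = (\<Sum>i\<in>S. a i) + (\<Sum>i\<in>I - S. - a i)"
    proof -
      have "signed_sum I S a = (\<Sum>i\<in>S. (if i \<in> S then a i else - a i)) + (\<Sum>i\<in>I - S. (if i \<in> S then a i else - a i))"
        unfolding signed_sum_def using S assms by (subst sum.subset_diff[of S I]) auto
      then show ?thesis by simp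
    qed
    then have "t * signed_sum I S a = (\<Sum>i\<in>S. t * a i) + (\<Sum>i\<in>I - S. - (t * a i))"
      by (simp add: right_diff_distrib sum_distrib_left sum_negf)
    then show ?thesis
      using S assms by (simp add: exp_add exp_sum finite_subset)
  qed
  then have "(\<Sum>S\<in>Pow I. exp (t * signed_sum I S a))
      = (\<Sum>S\<in>Pow I. (\<Prod>i\<in>S. exp (t * a i)) * (\<Prod>i\<in>I - S. exp (- (t * a i))))"
    by (rule sum.cong[OF refl])
  also have "\<dots> = (\<Prod>i\<in>I. exp (t * a i) + exp (- (t * a i)))"
    by (rule prod_add[symmetric, OF assms])
  also have "\<dots> \<le> (\<Prod>i\<in>I. 2 * exp ((t * a i)\<^sup>2 / 2))"
    by (intro prod_mono conjI cosh_le_exp_half_square) (auto intro: add_nonneg_nonneg)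
  also have "\<dots> = 2 ^ card I * exp (\<Sum>i\<in>I. (t * a i)\<^sup>2 / 2)"
    using assms by (simp add: prod.distrib exp_sum)
  also have "(\<Sum>i\<in>I. (t * a i)\<^sup>2 / 2) = t\<^sup>2 * (\<Sum>i\<in>I. (a i)\<^sup>2) / 2"
    by (simp add: power_mult_distrib sum_distrib_left sum_divide_distrib)
  finally show ?thesis .
qed

lemma card_signed_sum_gt_le:
  assumes I: "finite I" and V: "(\<Sum>i\<in>I. (a i)\<^sup>2) \<le> V" "0 < V" and l: "0 \<le> l"
  shows "real (card {S\<in>Pow I. l < signed_sum I S a}) \<le> 2 ^ card I * exp (- (l\<^sup>2 / (2 * V)))"
proof -
  define t where "t = l / V"
  have t: "0 \<le> t" using V l by (simp add: t_def)
  let ?B = "{S\<in>Pow I. l < signed_sum I S a}"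
  have "real (card ?B) * exp (t * l) = (\<Sum>S\<in>?B. exp (t * l))" by simp
  also have "\<dots> \<le> (\<Sum>S\<in>?B. exp (t * signed_sum I S a))"
    using t by (intro sum_mono) (auto intro!: mult_left_mono)
  also have "\<dots> \<le> (\<Sum>S\<in>Pow I. exp (t * signed_sum I S a))"
    using I by (intro sum_mono2) auto
  also have "\<dots> \<le> 2 ^ card I * exp (t\<^sup>2 * (\<Sum>i\<in>I. (a i)\<^sup>2) / 2)"
    by (rule sum_exp_signed_sum_le[OF I])
  also have "\<dots> \<le> 2 ^ card I * exp (t\<^sup>2 * V / 2)"
    using V by (intro mult_left_mono) (auto intro!: mult_left_mono divide_right_mono)
  finally have "real (card ?B) \<le> 2 ^ card I * exp (t\<^sup>2 * V / 2) / exp (t * l)"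
    by (simp add: pos_le_divide_eq)
  also have "\<dots> = 2 ^ card I * exp (t\<^sup>2 * V / 2 - t * l)"
    by (simp add: exp_diff)
  also have "t\<^sup>2 * V / 2 - t * l = - (l\<^sup>2 / (2 * V))"
    using V by (simp add: t_def power2_eq_square field_simps)
  finally show ?thesis .
qed

lemma card_abs_signed_sum_gt_le:
  assumes I: "finite I" and V: "(\<Sum>i\<in>I. (a i)\<^sup>2) \<le> V" "0 < V" and l: "0 \<le> l"
  shows "real (card {S\<in>Pow I. l < \<bar>signed_sum I S a\<bar>}) \<le> 2 ^ card I * (2 * exp (- (l\<^sup>2 / (2 * V))))"
proof -
  let ?A = "{S\<in>Pow I. l < signed_sum I S a}"
  let ?B = "{S\<in>Pow I. l < signed_sum I S (\<lambda>i. - a i)}"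
  have "signed_sum I S (\<lambda>i. - a i) = - signed_sum I S a" for S
    unfolding signed_sum_def sum_negf[symmetric] by (rule sum.cong) auto
  then have "{S\<in>Pow I. l < \<bar>signed_sum I S a\<bar>} \<subseteq> ?A \<union> ?B" by auto
  then have "card {S\<in>Pow I. l < \<bar>signed_sum I S a\<bar>} \<le> card (?A \<union> ?B)"
    using I by (intro card_mono) auto
  also have "\<dots> \<le> card ?A + card ?B" by (rule card_Un_le)
  finally have "real (card {S\<in>Pow I. l < \<bar>signed_sum I S a\<bar>}) \<le> real (card ?A) + real (card ?B)"
    by linarith
  also have "\<dots> \<le> 2 ^ card I * exp (- (l\<^sup>2 / (2 * V))) + 2 ^ card I * exp (- (l\<^sup>2 / (2 * V)))"
    using assms by (intro add_mono card_signed_sum_gt_le) auto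
  finally show ?thesis by simp
qed

text \<open>
  The points \<open>i\<close> and \<open>n + i\<close> form a pair; swapping the two changes the sign of this difference.
\<close>

definition pair_difference :: "nat \<Rightarrow> nat set \<Rightarrow> nat \<Rightarrow> real" where
  "pair_difference n A i = indicator A i - indicator A (n + i)"

lemma sum_square_pair_difference_le:
  assumes "A \<subseteq> {..<2 * n}" "B \<subseteq> {..<2 * n}"
  shows "(\<Sum>i<n. (pair_difference n A i - pair_difference n B i)\<^sup>2) \<le> 2 * real (card (sym_diff A B))"
proof -
  let ?D = "sym_diff A B"
  have D: "?D \<subseteq> {..<2 * n}" using assms by auto
  then have finD: "finite ?D" using finite_subset by blast
  have "(\<Sum>i<n. (pair_difference n A i - pair_difference n B i)\<^sup>2)
      \<le> (\<Sum>i<n. 2 * (indicator ?D i + indicator ?D (n + i)))"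
    by (intro sum_mono) (auto simp: pair_difference_def indicator_def power2_eq_square)
  also have "\<dots> = 2 * ((\<Sum>i<n. indicator ?D i) + (\<Sum>i<n. indicator ?D (n + i)))"
    by (simp add: sum.distrib sum_distrib_left)
  also have "(\<Sum>i<n. indicator ?D (n + i) :: real) = (\<Sum>i\<in>{n..<2 * n}. indicator ?D i)"
    using sum.shift_bounds_nat_ivl[of "\<lambda>i. indicator ?D i :: real" 0 n n]
    by (simp add: add.commute lessThan_atLeast0 mult_2)
  also have "(\<Sum>i<n. indicator ?D i :: real) + (\<Sum>i\<in>{n..<2 * n}. indicator ?D i)
      = (\<Sum>i<2 * n. indicator ?D i)"
    using sum.atLeastLessThan_concat[of 0 n "2 * n" "\<lambda>i. indicator ?D i :: real"]
    by (simp add: lessThan_atLeast0)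
  also have "\<dots> = real (card ({..<2 * n} \<inter> ?D))"
    by (simp add: indicator_def of_bool_def sum.If_cases) (auto intro!: arg_cong[where f=card])
  also have "{..<2 * n} \<inter> ?D = ?D" using D by (rule Int_absorb1)
  finally show ?thesis .
qed

lemma sum_chain_weights: "(\<Sum>i\<le>j. (real i + 1) / 2 ^ i) \<le> 4"
proof -
  have "(\<Sum>i\<le>j. (real i + 1) / 2 ^ i) = 4 - (real j + 3) / 2 ^ j"
    by (induction j) (simp_all add: field_simps)
  then show ?thesis by simp
qed

lemma sum_half_powers: "(\<Sum>i\<le>j. (1 / 2 :: real) ^ i) \<le> 2"
proof -
  have "(\<Sum>i\<le>j. (1 / 2 :: real) ^ i) = 2 - (1 / 2) ^ j"
    by (induction j) simp_all
  then show ?thesis by simp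
qed

lemma exp_three_halves_ge: "4 \<le> exp (3 / 2 :: real)"
proof -
  have "2 \<le> 1 + (3 / 4) + (3 / 4)\<^sup>2 / (2::real)" by (simp add: power2_eq_square)
  also have "\<dots> \<le> exp (3 / 4)" by (rule exp_lower_Taylor_quadratic) simp
  finally have "2\<^sup>2 \<le> exp (3 / 4 :: real) ^ 2" by (rule power_mono) simp
  then show ?thesis unfolding exp_double[symmetric] by simp
qed

text \<open>
  The entropy of the scale \<open>2n / 4^j\<close> grows linearly in \<open>j\<close>, which the geometric decay of the link
  lengths in the chaining easily absorbs.
\<close>

lemma net_card_le:
  assumes n: "1 \<le> n" and D: "1 \<le> D" and T: "T \<subseteq> Pow {..<2 * n}" "vc_at_most D T"
    and sep: "separated (2 * real n / 4 ^ j) T"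
  shows "real (card T) \<le> exp ((real j + 1) * (4 * real D))"
proof -
  have r: "0 < 2 * real n / 4 ^ j" "2 * real n / 4 ^ j \<le> real (card {..<2 * n})"
    using n by (simp_all add: divide_le_eq)
  have "real (card T) \<le> exp (1 / 2) * (4 * real (card {..<2 * n}) / (2 * real n / 4 ^ j)) ^ (2 * D)"
    by (rule packing_bound[OF _ T sep r]) simp
  also have "4 * real (card {..<2 * n}) / (2 * real n / 4 ^ j) = 4 ^ (j + 1)"
    using n by simp
  also have "(4 ^ (j + 1) :: real) ^ (2 * D) = 4 ^ ((j + 1) * (2 * D))"
    by (rule power_mult[symmetric])
  also have "(4 :: real) ^ ((j + 1) * (2 * D)) \<le> exp (3 / 2) ^ ((j + 1) * (2 * D))"
    by (rule power_mono[OF exp_three_halves_ge]) simp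
  also have "\<dots> = exp ((real j + 1) * (3 * real D))"
    by (simp add: exp_of_nat_mult[symmetric] algebra_simps)
  also have "exp (1 / 2) * exp ((real j + 1) * (3 * real D)) = exp (1 / 2 + (real j + 1) * (3 * real D))"
    by (rule exp_add[symmetric])
  also have "\<dots> \<le> exp ((real j + 1) * (4 * real D))"
  proof -
    have "1 * 1 \<le> (real j + 1) * real D" using D by (intro mult_mono) auto
    then have "1 / 2 + (real j + 1) * (3 * real D) \<le> (real j + 1) * (4 * real D)"
      by (simp add: algebra_simps)
    then show ?thesis by simp
  qed
  finally show ?thesis by simp
qed

text \<open>
  Chaining. Each set of \<open>F\<close> is reached from the empty set through nets of radius \<open>m / 4^j\<close>, \<open>m = 2n\<close>.
  A link at level \<open>j\<close> has variance proxy at most \<open>8m / 4^j\<close>, so allowing it the deviation \<open>lam j\<close> makes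
  it fail for a fraction of at most \<open>2 exp (- (j + 1) K)\<close> of the signs, \<open>K = 4D + L\<close>. At most
  \<open>exp (4 (j + 1) D)\<close> links exist at this level, which leaves \<open>2 exp (- (j + 1) L)\<close>; this is summable in
  \<open>j\<close>, as are the deviations \<open>lam j\<close>.
\<close>

lemma chaining_signed_sum:
  assumes n: "1 \<le> n" and D: "1 \<le> D" and F: "F \<subseteq> Pow {..<2 * n}" "vc_at_most D F" and L: "ln 2 \<le> L"
  shows "real (card {S \<in> Pow {..<n}. \<exists>A\<in>F. 16 * sqrt (2 * real n * (4 * real D + L))
            < \<bar>signed_sum {..<n} S (pair_difference n A)\<bar>}) \<le> 2 ^ n * (4 * exp (- L))"
proof -
  define Z where "Z S A = signed_sum {..<n} S (pair_difference n A)" for S A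
  define m where "m = 2 * real n"
  define K where "K = 4 * real D + L"
  define lam where "lam j = 4 * sqrt (m * K) * ((real j + 1) / 2 ^ j)" for j :: nat
  have L0: "0 < L" using L ln_gt_zero[of "2::real"] by linarith
  have m: "0 < m" using n by (simp add: m_def)
  have K: "0 < K" using L0 by (simp add: K_def add_nonneg_pos)
  have finF: "finite F" using F(1) finite_subset by fastforce
  have "\<forall>j. \<exists>T\<subseteq>F. separated (m / 4 ^ j) T \<and> (\<forall>A\<in>F. \<exists>B\<in>T. real (card (sym_diff A B)) \<le> m / 4 ^ j)"
    using m by (intro allI separated_net_exists[OF finF]) simp
  then obtain T where T: "\<And>j. T j \<subseteq> F" "\<And>j. separated (m / 4 ^ j) (T j)"
      and net: "\<And>j A. A \<in> F \<Longrightarrow> \<exists>B\<in>T j. real (card (sym_diff A B)) \<le> m / 4 ^ j"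
    by metis
  \<comment> \<open>The parent of a net point lies in the next coarser net, or is empty at level \<open>0\<close>. The same
    estimate \<open>4 m / 4^j\<close> covers level \<open>0\<close>, where a set has at most \<open>m\<close> points.\<close>
  have "\<exists>par. \<forall>A\<in>T j. par A \<subseteq> {..<2 * n} \<and> real (card (sym_diff A (par A))) \<le> 4 * (m / 4 ^ j)
        \<and> (case j of 0 \<Rightarrow> par A = {} | Suc i \<Rightarrow> par A \<in> T i)" for j
  proof (cases j)
    case 0
    have "\<forall>A\<in>T j. {} \<subseteq> {..<2 * n} \<and> real (card (sym_diff A {})) \<le> 4 * (m / 4 ^ j)"
    proof
      fix A assume "A \<in> T j"
      then have "A \<subseteq> {..<2 * n}" using T(1) F by blast
      then have "card A \<le> 2 * n" using card_mono[of "{..<2 * n}" A] by simp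
      then show "{} \<subseteq> {..<2 * n} \<and> real (card (sym_diff A {})) \<le> 4 * (m / 4 ^ j)"
        using 0 by (simp add: m_def)
    qed
    then show ?thesis using 0 by (intro exI[of _ "\<lambda>_. {}"]) simp
  next
    case (Suc i)
    have "\<forall>A\<in>T j. \<exists>B. B \<subseteq> {..<2 * n} \<and> real (card (sym_diff A B)) \<le> 4 * (m / 4 ^ j) \<and> B \<in> T i"
    proof
      fix A assume "A \<in> T j"
      then have "A \<in> F" using T(1) by blast
      from net[OF this, of i] obtain B where "B \<in> T i" "real (card (sym_diff A B)) \<le> m / 4 ^ i" by auto
      moreover have "B \<subseteq> {..<2 * n}" using \<open>B \<in> T i\<close> T(1) F by blast
      ultimately show "\<exists>B. B \<subseteq> {..<2 * n} \<and> real (card (sym_diff A B)) \<le> 4 * (m / 4 ^ j) \<and> B \<in> T i"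
        using Suc by auto
    qed
    from bchoice[OF this] show ?thesis using Suc by simp
  qed
  then obtain par where par: "\<And>j A. A \<in> T j \<Longrightarrow> par j A \<subseteq> {..<2 * n}"
      "\<And>j A. A \<in> T j \<Longrightarrow> real (card (sym_diff A (par j A))) \<le> 4 * (m / 4 ^ j)"
      "\<And>j A. A \<in> T j \<Longrightarrow> (case j of 0 \<Rightarrow> par j A = {} | Suc i \<Rightarrow> par j A \<in> T i)"
    by metis
  define bad where "bad j = (\<Union>A\<in>T j. {S\<in>Pow {..<n}. lam j < \<bar>Z S A - Z S (par j A)\<bar>})" for j
  have finT: "finite (T j)" for j using T(1) finF finite_subset by blast
  have cardbad: "real (card (bad j)) \<le> 2 ^ n * (2 * exp (- L) * (1 / 2) ^ j)" for j
  proof -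
    have link: "real (card {S\<in>Pow {..<n}. lam j < \<bar>Z S A - Z S (par j A)\<bar>})
        \<le> 2 ^ n * (2 * exp (- ((real j + 1) * K)))" if A: "A \<in> T j" for A
    proof -
      let ?V = "8 * (m / 4 ^ j)"
      have sub: "A \<subseteq> {..<2 * n}" "par j A \<subseteq> {..<2 * n}" using A T(1)[of j] F par(1) by auto
      have V1: "(\<Sum>i<n. (pair_difference n A i - pair_difference n (par j A) i)\<^sup>2) \<le> ?V"
        using sum_square_pair_difference_le[OF sub] par(2)[OF A] by linarith
      have V2: "0 < ?V" using m by simp
      have l0: "0 \<le> lam j" using m K by (simp add: lam_def)
      have "(lam j)\<^sup>2 / (2 * ?V) = (real j + 1)\<^sup>2 * K"
      proof -
        have p4: "(2 ^ j)\<^sup>2 = (4 ^ j :: real)"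
          unfolding power2_eq_square power_mult_distrib[symmetric] by simp
        have "(lam j)\<^sup>2 = 16 * (m * K) * ((real j + 1)\<^sup>2 / 4 ^ j)"
          unfolding lam_def power_mult_distrib power_divide p4 using m K by simp
        then show ?thesis using m by simp
      qed
      moreover have "(real j + 1) * K \<le> (real j + 1)\<^sup>2 * K"
        using K by (intro mult_right_mono) (auto simp: power2_eq_square)
      ultimately have ex: "(real j + 1) * K \<le> (lam j)\<^sup>2 / (2 * ?V)" by simp
      have "real (card {S\<in>Pow {..<n}. lam j < \<bar>Z S A - Z S (par j A)\<bar>})
          \<le> 2 ^ card {..<n} * (2 * exp (- ((lam j)\<^sup>2 / (2 * ?V))))"
        unfolding Z_def signed_sum_diff[symmetric]
        by (rule card_abs_signed_sum_gt_le[OF _ V1 V2 l0]) simp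
      also have "\<dots> \<le> 2 ^ n * (2 * exp (- ((real j + 1) * K)))"
        using ex by simp
      finally show ?thesis .
    qed
    have "card (bad j) \<le> (\<Sum>A\<in>T j. card {S\<in>Pow {..<n}. lam j < \<bar>Z S A - Z S (par j A)\<bar>})"
      unfolding bad_def by (rule card_UN_le[OF finT])
    then have "real (card (bad j)) \<le> (\<Sum>A\<in>T j. real (card {S\<in>Pow {..<n}. lam j < \<bar>Z S A - Z S (par j A)\<bar>}))"
      unfolding of_nat_sum[symmetric] of_nat_le_iff .
    also have "\<dots> \<le> (\<Sum>A\<in>T j. 2 ^ n * (2 * exp (- ((real j + 1) * K))))"
      by (rule sum_mono) (rule link)
    also have "\<dots> = real (card (T j)) * (2 ^ n * (2 * exp (- ((real j + 1) * K))))"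
      by simp
    also have "\<dots> \<le> exp ((real j + 1) * (4 * real D)) * (2 ^ n * (2 * exp (- ((real j + 1) * K))))"
      using n D T(1)[of j] F T(2)[of j] vc_at_most_mono[OF F(2) T(1)]
      by (intro mult_right_mono net_card_le) (auto simp: m_def)
    also have "\<dots> = 2 ^ n * (2 * exp ((real j + 1) * (4 * real D) + - ((real j + 1) * K)))"
      unfolding exp_add by simp
    also have "(real j + 1) * (4 * real D) + - ((real j + 1) * K) = - L + real j * (- L)"
      by (simp add: K_def algebra_simps)
    also have "exp (- L + real j * (- L)) = exp (- L) * exp (- L) ^ j"
      unfolding exp_add exp_of_nat_mult ..
    also have "exp (- L) ^ j \<le> (1 / 2) ^ j"
    proof (rule power_mono)
      have "exp (- L) \<le> exp (- ln 2)" using L by simp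
      then show "exp (- L) \<le> 1 / 2" by (simp add: exp_minus)
    qed simp
    finally show ?thesis by (simp add: mult.assoc)
  qed
  have chain: "\<bar>Z S A\<bar> \<le> (\<Sum>i\<le>j. lam i)"
    if S: "S \<in> Pow {..<n}" "\<And>i. i \<le> j \<Longrightarrow> S \<notin> bad i" and A: "A \<in> T j" for S A j
    using S A
  proof (induction j arbitrary: A)
    case 0
    have "par 0 A = {}" using par(3)[OF 0(3)] by simp
    moreover have "Z S {} = 0" by (simp add: Z_def signed_sum_def pair_difference_def cong: if_cong)
    moreover have "\<bar>Z S A - Z S (par 0 A)\<bar> \<le> lam 0"
      using 0(1) 0(2)[of 0] 0(3) unfolding bad_def by (auto simp: not_less)
    ultimately show ?case by simp
  next
    case (Suc j)
    have "par (Suc j) A \<in> T j" using par(3)[OF Suc.prems(3)] by simp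
    then have "\<bar>Z S (par (Suc j) A)\<bar> \<le> (\<Sum>i\<le>j. lam i)"
      using Suc.IH Suc.prems by simp
    moreover have "\<bar>Z S A - Z S (par (Suc j) A)\<bar> \<le> lam (Suc j)"
      using Suc.prems(1) Suc.prems(2)[of "Suc j"] Suc.prems(3) unfolding bad_def by (auto simp: not_less)
    ultimately show ?case by simp
  qed
  have total: "(\<Sum>i\<le>j. lam i) \<le> 16 * sqrt (m * K)" for j
  proof -
    have "(\<Sum>i\<le>j. lam i) = 4 * sqrt (m * K) * (\<Sum>i\<le>j. (real i + 1) / 2 ^ i)"
      unfolding lam_def by (rule sum_distrib_left[symmetric])
    also have "\<dots> \<le> 4 * sqrt (m * K) * 4"
      using m K by (intro mult_left_mono sum_chain_weights) auto
    finally show ?thesis by simp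
  qed
  \<comment> \<open>At level \<open>J\<close> the radius is below \<open>1\<close>, so that the net consists of all of \<open>F\<close>.\<close>
  define J where "J = 2 * n"
  have rJ: "m / 4 ^ J < 1"
  proof -
    have "real J < 2 ^ J" by (rule of_nat_less_two_power)
    also have "\<dots> \<le> (4 ^ J :: real)" by (rule power_mono) auto
    finally show ?thesis by (simp add: m_def J_def)
  qed
  have "{S \<in> Pow {..<n}. \<exists>A\<in>F. 16 * sqrt (m * K) < \<bar>Z S A\<bar>} \<subseteq> (\<Union>j\<le>J. bad j)"
  proof
    fix S assume "S \<in> {S \<in> Pow {..<n}. \<exists>A\<in>F. 16 * sqrt (m * K) < \<bar>Z S A\<bar>}"
    then obtain A where S: "S \<in> Pow {..<n}" "A \<in> F" "16 * sqrt (m * K) < \<bar>Z S A\<bar>" by auto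
    obtain B where B: "B \<in> T J" "real (card (sym_diff A B)) \<le> m / 4 ^ J" using net[OF S(2)] by auto
    have "finite (sym_diff A B)"
      using S(2) B(1) T(1)[of J] F finite_subset[of "sym_diff A B" "{..<2 * n}"] by auto
    moreover have "card (sym_diff A B) = 0" using B(2) rJ by linarith
    ultimately have "sym_diff A B = {}" by simp
    then have "A = B" by auto
    then have "A \<in> T J" using B by simp
    then have "\<not> (\<forall>i\<le>J. S \<notin> bad i)"
      using chain[OF S(1), of J A] total[of J] S(3) by force
    then show "S \<in> (\<Union>j\<le>J. bad j)" by auto
  qed
  moreover have "finite (\<Union>j\<le>J. bad j)"
    using finT by (auto simp: bad_def)
  ultimately have "card {S \<in> Pow {..<n}. \<exists>A\<in>F. 16 * sqrt (m * K) < \<bar>Z S A\<bar>} \<le> card (\<Union>j\<le>J. bad j)"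
    by (rule card_mono[rotated])
  also have "\<dots> \<le> (\<Sum>j\<le>J. card (bad j))" by (rule card_UN_le) simp
  finally have "real (card {S \<in> Pow {..<n}. \<exists>A\<in>F. 16 * sqrt (m * K) < \<bar>Z S A\<bar>}) \<le> (\<Sum>j\<le>J. real (card (bad j)))"
    unfolding of_nat_sum[symmetric] of_nat_le_iff .
  also have "\<dots> \<le> (\<Sum>j\<le>J. 2 ^ n * (2 * exp (- L) * (1 / 2) ^ j))"
    by (rule sum_mono) (rule cardbad)
  also have "\<dots> = 2 ^ n * (2 * exp (- L)) * (\<Sum>j\<le>J. (1 / 2) ^ j)"
    by (simp add: sum_distrib_left mult.assoc)
  also have "\<dots> \<le> 2 ^ n * (2 * exp (- L)) * 2"
    by (intro mult_left_mono sum_half_powers) auto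
  finally show ?thesis by (simp add: Z_def m_def K_def)
qed

section \<open>Symmetrisation\<close>

lemma indep_vars_PiM_coordinates:
  assumes N: "prob_space N" and I: "I \<noteq> {}"
  shows "prob_space.indep_vars (PiM I (\<lambda>_. N)) (\<lambda>_. N) (\<lambda>i X. X i) I"
proof -
  interpret P: prob_space "PiM I (\<lambda>_. N)" by (rule prob_space_PiM[OF N])
  have "distr (PiM I (\<lambda>_. N)) (PiM I (\<lambda>_. N)) (\<lambda>X. \<lambda>i\<in>I. X i) = distr (PiM I (\<lambda>_. N)) (PiM I (\<lambda>_. N)) (\<lambda>X. X)"
    by (rule distr_cong) (auto simp: space_PiM PiE_iff extensional_def fun_eq_iff restrict_def)
  also have "\<dots> = PiM I (\<lambda>_. N)" by (rule distr_id)
  also have "\<dots> = PiM I (\<lambda>i. distr (PiM I (\<lambda>_. N)) N (\<lambda>X. X i))"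
    by (rule PiM_cong) (auto simp: distr_PiM_component[OF N])
  finally show ?thesis
    using I by (subst P.indep_vars_iff_distr_eq_PiM') auto
qed

text \<open>
  Only the constant \<open>1/2\<close> matters: the second sample has to be near its mean with a probability bounded
  away from \<open>0\<close>.
\<close>

lemma prob_frequency_deviation_le_half:
  fixes s :: real
  assumes N: "prob_space N" and h: "h \<in> sets N" and I: "finite I" "I \<noteq> {}"
    and s: "0 \<le> s" "real (card I) \<le> s\<^sup>2"
  shows "measure (PiM I (\<lambda>_. N)) {X \<in> space (PiM I (\<lambda>_. N)).
           s \<le> \<bar>(\<Sum>i\<in>I. indicator h (X i)) - real (card I) * measure N h\<bar>} \<le> 1 / 2"
proof -
  let ?P = "PiM I (\<lambda>_. N)"
  interpret P: prob_space ?P by (rule prob_space_PiM[OF N])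
  interpret N: prob_space N by fact
  obtain i0 where i0: "i0 \<in> I" using I by auto
  let ?X = "\<lambda>i X. indicator h (X i) :: real"
  have ind: "P.indep_vars (\<lambda>_. borel) ?X I"
    using P.indep_vars_compose2[OF indep_vars_PiM_coordinates[OF N I(2)], of "\<lambda>_ x. indicator h x" "\<lambda>_. borel"] h
    by simp
  have d: "distr ?P borel (?X i) = distr N borel (indicator h)" if "i \<in> I" for i
  proof -
    have "distr N borel (indicator h :: _ \<Rightarrow> real) = distr (distr ?P N (\<lambda>X. X i)) borel (indicator h)"
      using distr_PiM_component[of I "\<lambda>_. N" i] that N by simp
    also have "\<dots> = distr ?P borel (indicator h \<circ> (\<lambda>X. X i))"
      using h that by (intro distr_distr) auto
    finally show ?thesis by (simp add: comp_def)
  qed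
  interpret H: Hoeffding_ineq_iid ?P I ?X "?X i0" 0 1 "P.expectation (?X i0)"
  proof unfold_locales
    show "distr ?P borel (?X i) = distr ?P borel (?X i0)" if "i \<in> I" for i
      using d that i0 by simp
    show "?X i0 \<in> borel_measurable ?P"
      using ind i0 unfolding P.indep_vars_def by blast
  qed (use I ind in \<open>auto simp: indicator_def\<close>)
  have "P.expectation (?X i0) = N.expectation (indicator h)"
  proof -
    have "N.expectation (indicator h :: _ \<Rightarrow> real) = integral\<^sup>L (distr ?P N (\<lambda>X. X i0)) (indicator h)"
      using distr_PiM_component[of I "\<lambda>_. N" i0] i0 N by simp
    also have "\<dots> = P.expectation (?X i0)"
      using h i0 by (intro integral_distr) auto
    finally show ?thesis ..
  qed
  also have "\<dots> = measure N h"
    using h by (simp add: sets.sets_into_space Int_absorb2)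
  finally have mu: "P.expectation (?X i0) = measure N h" .
  have "P.prob {X \<in> space ?P. s \<le> \<bar>(\<Sum>i\<in>I. ?X i X) - real (card I) * measure N h\<bar>}
      \<le> 2 * exp (- 2 * s\<^sup>2 / (real (card I) * (1 - 0)\<^sup>2))"
    using H.Hoeffding_ineq_abs_ge[OF s(1) _ I(2)] unfolding mu by simp
  also have "\<dots> \<le> 2 * exp (- 2)"
  proof -
    have "0 < card I" using I by (simp add: card_gt_0_iff)
    then have "1 \<le> s\<^sup>2 / real (card I)" using s by (simp add: le_divide_eq)
    then show ?thesis by simp
  qed
  also have "\<dots> \<le> 1 / 2"
  proof -
    have "2 \<le> exp (1 :: real)" using exp_ge_add_one_self[of 1] by simp
    then have "2\<^sup>2 \<le> exp (1 :: real) ^ 2" by (rule power_mono) simp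
    then have "4 \<le> exp (2 :: real)" unfolding exp_double[symmetric] by simp
    then show ?thesis by (simp add: exp_minus field_simps)
  qed
  finally show ?thesis by simp
qed

definition bad_sample :: "nat \<Rightarrow> 'a measure \<Rightarrow> 'a set set \<Rightarrow> real \<Rightarrow> (nat \<Rightarrow> 'a) set" where
  "bad_sample n N H s = {X \<in> space (PiM {..<n} (\<lambda>_. N)). \<exists>h\<in>H.
     s < \<bar>(\<Sum>i<n. indicator h (X i)) - real n * measure N h\<bar>}"

definition bad_double_sample :: "nat \<Rightarrow> 'a measure \<Rightarrow> 'a set set \<Rightarrow> real \<Rightarrow> (nat \<Rightarrow> 'a) set" where
  "bad_double_sample n N H s = {X \<in> space (PiM {..<2 * n} (\<lambda>_. N)). \<exists>h\<in>H.
     s < \<bar>\<Sum>i<n. indicator h (X i) - indicator h (X (n + i))\<bar>}"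

lemma sets_bad_sample:
  assumes "countable H" "H \<subseteq> sets N"
  shows "bad_sample n N H s \<in> sets (PiM {..<n} (\<lambda>_. N))"
proof -
  have "(\<lambda>X. (\<Sum>i<n. indicator h (X i) :: real)) \<in> borel_measurable (PiM {..<n} (\<lambda>_. N))" if "h \<in> H" for h
  proof (rule borel_measurable_sum)
    fix i assume "i \<in> {..<n}"
    then show "(\<lambda>X. indicator h (X i) :: real) \<in> borel_measurable (PiM {..<n} (\<lambda>_. N))"
      using assms that by (intro measurable_compose[OF measurable_component_singleton borel_measurable_indicator]) auto
  qed
  then have "{X \<in> space (PiM {..<n} (\<lambda>_. N)). s < \<bar>(\<Sum>i<n. indicator h (X i)) - real n * measure N h\<bar>}
      \<in> sets (PiM {..<n} (\<lambda>_. N))" if "h \<in> H" for h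
    using that by (intro borel_measurable_less) (auto intro!: borel_measurable_abs borel_measurable_diff)
  then show ?thesis
    unfolding bad_sample_def using assms(1) by (intro sets.sets_Collect_countable_Ex') auto
qed

lemma sets_bad_double_sample:
  assumes "countable H" "H \<subseteq> sets N"
  shows "bad_double_sample n N H s \<in> sets (PiM {..<2 * n} (\<lambda>_. N))"
proof -
  have ind: "(\<lambda>X. indicator h (X i) :: real) \<in> borel_measurable (PiM {..<2 * n} (\<lambda>_. N))"
    if "h \<in> H" "i < 2 * n" for h i
    using assms that by (intro measurable_compose[OF measurable_component_singleton borel_measurable_indicator]) auto
  have "{X \<in> space (PiM {..<2 * n} (\<lambda>_. N)). s < \<bar>\<Sum>i<n. indicator h (X i) - indicator h (X (n + i))\<bar>}
      \<in> sets (PiM {..<2 * n} (\<lambda>_. N))" if "h \<in> H" for h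
    using that by (intro borel_measurable_less) (auto intro!: borel_measurable_abs borel_measurable_sum borel_measurable_diff ind)
  then show ?thesis
    unfolding bad_double_sample_def using assms(1) by (intro sets.sets_Collect_countable_Ex') auto
qed

text \<open>
  If some frequency in the first sample is off by more than \<open>2s\<close>, then with probability at least \<open>1/2\<close> an
  independent second sample is off by less than \<open>s\<close> for that same set, and the two samples differ by more
  than \<open>s\<close>. The unknown probability of the set has disappeared from the comparison.
\<close>

lemma ghost_sample:
  assumes N: "prob_space N" and H: "countable H" "H \<subseteq> sets N" and n: "1 \<le> n"
    and s: "0 \<le> s" "real n \<le> s\<^sup>2"
  shows "measure (PiM {..<n} (\<lambda>_. N)) (bad_sample n N H (2 * s))
    \<le> 2 * measure (PiM {..<2 * n} (\<lambda>_. N)) (bad_double_sample n N H s)"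
proof -
  let ?P = "PiM {..<n} (\<lambda>_. N)" and ?Q = "PiM {n..<2 * n} (\<lambda>_. N)" and ?R = "PiM {..<2 * n} (\<lambda>_. N)"
  interpret P: prob_space ?P by (rule prob_space_PiM[OF N])
  interpret Q: prob_space ?Q by (rule prob_space_PiM[OF N])
  interpret R: prob_space ?R by (rule prob_space_PiM[OF N])
  interpret N: prob_space N by fact
  interpret F: product_sigma_finite "\<lambda>_ :: nat. N" by unfold_locales
  let ?B = "bad_sample n N H (2 * s)" and ?G = "bad_double_sample n N H s"
  have mB: "?B \<in> sets ?P" and mG: "?G \<in> sets ?R"
    using H by (simp_all add: sets_bad_sample sets_bad_double_sample)
  have un: "{..<n} \<union> {n..<2 * n} = {..<2 * n}" by auto
  let ?m = "merge {..<n} {n..<2 * n}"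
  have mm: "?m \<in> measurable (?P \<Otimes>\<^sub>M ?Q) ?R"
    using measurable_merge[of "{..<n}" "{n..<2 * n}" "\<lambda>_. N"] unfolding un .
  have dR: "distr (?P \<Otimes>\<^sub>M ?Q) ?R ?m = ?R"
  proof -
    have "{..<n} \<inter> {n..<2 * n} = {}" by auto
    from F.distr_merge[OF this] show ?thesis unfolding un by simp
  qed
  let ?E = "?m -` ?G \<inter> space (?P \<Otimes>\<^sub>M ?Q)"
  have mE: "?E \<in> sets (?P \<Otimes>\<^sub>M ?Q)" using mm mG by (rule measurable_sets)
  \<comment> \<open>The exceptional set \<open>h\<close> depends on \<open>X\<close>; it is fixed before the second sample is drawn.\<close>
  have slice: "ennreal (1 / 2) * indicator ?B X \<le> emeasure ?Q (Pair X -` ?E)" if X: "X \<in> space ?P" for X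
  proof (cases "X \<in> ?B")
    case False
    then show ?thesis by simp
  next
    case True
    then obtain h where h: "h \<in> H" "2 * s < \<bar>(\<Sum>i<n. indicator h (X i)) - real n * measure N h\<bar>"
      unfolding bad_sample_def by auto
    let ?A = "{Y \<in> space ?Q. s \<le> \<bar>(\<Sum>i\<in>{n..<2 * n}. indicator h (Y i)) - real (card {n..<2 * n}) * measure N h\<bar>}"
    have A: "measure ?Q ?A \<le> 1 / 2"
      using h(1) H n s by (intro prob_frequency_deviation_le_half[OF N]) auto
    have indm: "(\<lambda>Y. indicator h (Y i) :: real) \<in> borel_measurable ?Q" if "i \<in> {n..<2 * n}" for i
      using H h(1) that by (intro measurable_compose[OF measurable_component_singleton borel_measurable_indicator]) auto
    have mA: "?A \<in> sets ?Q"
      by (intro borel_measurable_le) (auto intro!: borel_measurable_abs borel_measurable_sum borel_measurable_diff indm)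
    have "space ?Q - ?A \<subseteq> Pair X -` ?E"
    proof
      fix Y assume Y: "Y \<in> space ?Q - ?A"
      have Ysum: "(\<Sum>i\<in>{n..<2 * n}. indicator h (Y i) :: real) = (\<Sum>i<n. indicator h (Y (n + i)))"
        using sum.shift_bounds_nat_ivl[of "\<lambda>i. indicator h (Y i) :: real" 0 n n]
        by (simp add: add.commute lessThan_atLeast0 mult_2)
      have "s < \<bar>(\<Sum>i<n. indicator h (X i)) - (\<Sum>i<n. indicator h (Y (n + i)) :: real)\<bar>"
      proof -
        have "\<not> s \<le> \<bar>(\<Sum>i<n. indicator h (Y (n + i))) - real n * measure N h\<bar>"
          using Y unfolding Ysum[symmetric] by simp
        then show ?thesis using h(2) by linarith
      qed
      also have "(\<Sum>i<n. indicator h (X i)) - (\<Sum>i<n. indicator h (Y (n + i)) :: real)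
          = (\<Sum>i<n. indicator h (?m (X, Y) i) - indicator h (?m (X, Y) (n + i)))"
        by (simp add: sum_subtractf merge_def)
      finally have "s < \<bar>\<Sum>i<n. indicator h (?m (X, Y) i) - indicator h (?m (X, Y) (n + i)) :: real\<bar>" .
      moreover have sp: "(X, Y) \<in> space (?P \<Otimes>\<^sub>M ?Q)" using X Y by (simp add: space_pair_measure)
      moreover have "?m (X, Y) \<in> space ?R" using mm sp by (rule measurable_space)
      ultimately show "Y \<in> Pair X -` ?E"
        unfolding bad_double_sample_def using h(1) by auto
    qed
    then have "emeasure ?Q (space ?Q - ?A) \<le> emeasure ?Q (Pair X -` ?E)"
      by (rule emeasure_mono) (rule sets_Pair1[OF mE])
    moreover have "ennreal (1 / 2) \<le> emeasure ?Q (space ?Q - ?A)"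
    proof -
      have "1 / 2 \<le> measure ?Q (space ?Q - ?A)"
        unfolding Q.prob_compl[OF mA] using A by linarith
      then show ?thesis unfolding Q.emeasure_eq_measure by (rule ennreal_leI)
    qed
    ultimately have "ennreal (1 / 2) \<le> emeasure ?Q (Pair X -` ?E)"
      by (rule order_trans[rotated])
    then show ?thesis using True by simp
  qed
  have "ennreal (1 / 2) * emeasure ?P ?B = (\<integral>\<^sup>+X. ennreal (1 / 2) * indicator ?B X \<partial>?P)"
    using mB by (simp add: nn_integral_cmult)
  also have "\<dots> \<le> (\<integral>\<^sup>+X. emeasure ?Q (Pair X -` ?E) \<partial>?P)"
    by (rule nn_integral_mono) (rule slice)
  also have "\<dots> = emeasure (?P \<Otimes>\<^sub>M ?Q) ?E"
    by (rule Q.emeasure_pair_measure_alt[OF mE, symmetric])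
  also have "\<dots> = emeasure (distr (?P \<Otimes>\<^sub>M ?Q) ?R ?m) ?G"
    by (rule emeasure_distr[OF mm mG, symmetric])
  also have "\<dots> = emeasure ?R ?G" unfolding dR ..
  finally have "ennreal (1 / 2 * measure ?P ?B) \<le> ennreal (measure ?R ?G)"
    unfolding P.emeasure_eq_measure R.emeasure_eq_measure
    by (subst ennreal_mult) (simp, rule measure_nonneg, assumption)
  then have "1 / 2 * measure ?P ?B \<le> measure ?R ?G"
    by (subst (asm) ennreal_le_iff) simp_all
  then show ?thesis by simp
qed

definition swap_pairs :: "nat \<Rightarrow> nat set \<Rightarrow> nat \<Rightarrow> nat" where
  "swap_pairs n S i = (if i < n then (if i \<in> S then n + i else i) else (if i - n \<in> S then i - n else i))"

lemma swap_pairs_perm: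
  shows "swap_pairs n S \<in> {..<2 * n} \<rightarrow> {..<2 * n}" "inj_on (swap_pairs n S) {..<2 * n}"
  by (auto simp: swap_pairs_def inj_on_def split: if_splits)

text \<open>
  The law of the double sample is invariant under swapping any of the pairs. Its bad event therefore
  has the probability of its average over all swaps, and conditionally on the sample this average is a
  proportion of signs.
\<close>

lemma swap_symmetrisation:
  assumes N: "prob_space N" and H: "countable H" "H \<subseteq> sets N"
    and bnd: "\<And>X. X \<in> space (PiM {..<2 * n} (\<lambda>_. N)) \<Longrightarrow>
      real (card {S \<in> Pow {..<n}. \<exists>h\<in>H. s < \<bar>signed_sum {..<n} S (\<lambda>i. indicator h (X i) - indicator h (X (n + i)))\<bar>})
        \<le> 2 ^ n * c"
  shows "measure (PiM {..<2 * n} (\<lambda>_. N)) (bad_double_sample n N H s) \<le> c"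
proof -
  let ?R = "PiM {..<2 * n} (\<lambda>_. N)" and ?G = "bad_double_sample n N H s"
  interpret R: prob_space ?R by (rule prob_space_PiM[OF N])
  define T where "T S X = (\<lambda>i\<in>{..<2 * n}. X (swap_pairs n S i))" for S and X :: "nat \<Rightarrow> 'a"
  have mG: "?G \<in> sets ?R" using H by (rule sets_bad_double_sample)
  have dT: "distr ?R ?R (T S) = ?R" for S
    unfolding T_def using swap_pairs_perm[of n S]
    by (intro distr_PiM_reindex[where M="\<lambda>_. N"] N)
  have mT: "T S \<in> measurable ?R ?R" for S
    unfolding T_def using swap_pairs_perm(1)[of n S]
    by (intro measurable_restrict measurable_component_singleton) auto
  let ?V = "\<lambda>S. T S -` ?G \<inter> space ?R"
  have mV: "?V S \<in> sets ?R" for S using mT mG by (rule measurable_sets)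
  have pV: "measure ?R (?V S) = measure ?R ?G" for S
    using measure_distr[OF mT mG, of S] unfolding dT by simp
  have count: "real (card {S \<in> Pow {..<n}. X \<in> ?V S}) \<le> 2 ^ n * c" if X: "X \<in> space ?R" for X
  proof -
    have "{S \<in> Pow {..<n}. X \<in> ?V S} \<subseteq> {S \<in> Pow {..<n}. \<exists>h\<in>H. s < \<bar>signed_sum {..<n} S (\<lambda>i. indicator h (X i) - indicator h (X (n + i)))\<bar>}"
    proof
      fix S assume "S \<in> {S \<in> Pow {..<n}. X \<in> ?V S}"
      then obtain h where h: "S \<in> Pow {..<n}" "h \<in> H"
        "s < \<bar>\<Sum>i<n. indicator h (T S X i) - indicator h (T S X (n + i))\<bar>"
        unfolding bad_double_sample_def by auto
      have "(\<Sum>i<n. indicator h (T S X i) - indicator h (T S X (n + i)))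
          = - signed_sum {..<n} S (\<lambda>i. indicator h (X i) - indicator h (X (n + i)))"
        unfolding signed_sum_def sum_negf[symmetric]
        by (rule sum.cong) (auto simp: T_def swap_pairs_def)
      then show "S \<in> {S \<in> Pow {..<n}. \<exists>h\<in>H. s < \<bar>signed_sum {..<n} S (\<lambda>i. indicator h (X i) - indicator h (X (n + i)))\<bar>}"
        using h by auto
    qed
    then have "card {S \<in> Pow {..<n}. X \<in> ?V S} \<le> card {S \<in> Pow {..<n}. \<exists>h\<in>H. s < \<bar>signed_sum {..<n} S (\<lambda>i. indicator h (X i) - indicator h (X (n + i)))\<bar>}"
      by (intro card_mono) auto
    then show ?thesis using bnd[OF X] by linarith
  qed
  have "2 ^ n * measure ?R ?G = (\<Sum>S\<in>Pow {..<n}. measure ?R (?V S))"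
    by (simp add: pV card_Pow)
  also have "\<dots> = (\<Sum>S\<in>Pow {..<n}. \<integral>X. indicator (?V S) X \<partial>?R)"
    using mV by (simp add: Int_absorb2 sets.sets_into_space)
  also have "\<dots> = (\<integral>X. (\<Sum>S\<in>Pow {..<n}. indicator (?V S) X) \<partial>?R)"
    using mV by (intro Bochner_Integration.integral_sum[symmetric]) (simp add: R.emeasure_eq_measure)
  also have "\<dots> \<le> (\<integral>X. 2 ^ n * c \<partial>?R)"
  proof (rule integral_mono)
    show "integrable ?R (\<lambda>X. \<Sum>S\<in>Pow {..<n}. indicator (?V S) X :: real)"
      using mV by (intro Bochner_Integration.integrable_sum) (simp add: R.emeasure_eq_measure)
    fix X assume "X \<in> space ?R"
    have "(\<Sum>S\<in>Pow {..<n}. indicator (?V S) X :: real) = real (card {S \<in> Pow {..<n}. X \<in> ?V S})"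
      by (simp add: indicator_def of_bool_def sum.If_cases Collect_conj_eq Pow_def)
    also have "\<dots> \<le> 2 ^ n * c" using \<open>X \<in> space ?R\<close> by (rule count)
    finally show "(\<Sum>S\<in>Pow {..<n}. indicator (?V S) X) \<le> 2 ^ n * c" .
  qed simp
  also have "\<dots> = 2 ^ n * c" by (simp add: R.prob_space)
  finally show ?thesis by simp
qed

text \<open>
  Uniform law of large numbers for a Vapnik-Chervonenkis class, with deviation of order
  \<open>\<surd>((D + L)/n)\<close> for the frequencies.
\<close>

theorem vc_uniform_deviation:
  assumes N: "prob_space N" and H: "countable H" "H \<subseteq> sets N" and n: "1 \<le> n" and D: "1 \<le> D"
    and L: "ln 2 \<le> L"
    and vc: "\<And>m x. (\<And>i. i < m \<Longrightarrow> x i \<in> space N) \<Longrightarrow> vc_at_most D ((\<lambda>h. {i\<in>{..<m::nat}. x i \<in> h}) ` H)"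
  shows "measure (PiM {..<n} (\<lambda>_. N)) (bad_sample n N H (32 * sqrt (2 * real n * (4 * real D + L)))) \<le> 8 * exp (- L)"
proof -
  define s where "s = 16 * sqrt (2 * real n * (4 * real D + L))"
  have L0: "0 < L" using L ln_gt_zero[of "2::real"] by linarith
  have s0: "0 \<le> s" using L0 by (simp add: s_def)
  have "s\<^sup>2 = 256 * (2 * real n * (4 * real D + L))"
    using L0 by (simp add: s_def power_mult_distrib)
  moreover have "real n * 1 \<le> real n * (512 * (4 * real D + L))"
    using D L0 by (intro mult_left_mono) auto
  ultimately have s1: "real n \<le> s\<^sup>2" by (simp add: algebra_simps)
  have "measure (PiM {..<2 * n} (\<lambda>_. N)) (bad_double_sample n N H s) \<le> 4 * exp (- L)"
  proof (rule swap_symmetrisation[OF N H])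
    fix X assume "X \<in> space (PiM {..<2 * n} (\<lambda>_. N))"
    then have X: "\<And>i. i < 2 * n \<Longrightarrow> X i \<in> space N" by (auto simp: space_PiM)
    define F where "F = (\<lambda>h. {i\<in>{..<2 * n}. X i \<in> h}) ` H"
    have F: "F \<subseteq> Pow {..<2 * n}" "vc_at_most D F" unfolding F_def using vc[OF X] by auto
    have pd0: "pair_difference n {i\<in>{..<2 * n}. X i \<in> h} i = indicator h (X i) - indicator h (X (n + i))"
      if "i \<in> {..<n}" for i h
      using that by (simp add: pair_difference_def indicator_def)
    have pd: "signed_sum {..<n} S (pair_difference n {i\<in>{..<2 * n}. X i \<in> h})
        = signed_sum {..<n} S (\<lambda>i. indicator h (X i) - indicator h (X (n + i)))" for S h
      unfolding signed_sum_def by (rule sum.cong[OF refl]) (simp only: pd0)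
    show "real (card {S \<in> Pow {..<n}. \<exists>h\<in>H. s < \<bar>signed_sum {..<n} S (\<lambda>i. indicator h (X i) - indicator h (X (n + i)))\<bar>})
        \<le> 2 ^ n * (4 * exp (- L))"
    proof -
      have "(\<exists>h\<in>H. s < \<bar>signed_sum {..<n} S (\<lambda>i. indicator h (X i) - indicator h (X (n + i)))\<bar>)
          \<longleftrightarrow> (\<exists>A\<in>F. s < \<bar>signed_sum {..<n} S (pair_difference n A)\<bar>)" for S
        unfolding F_def by (simp only: Set.bex_simps(7) pd)
      then show ?thesis using chaining_signed_sum[OF n D F L] by (simp add: s_def)
    qed
  qed
  moreover have "measure (PiM {..<n} (\<lambda>_. N)) (bad_sample n N H (2 * s))
      \<le> 2 * measure (PiM {..<2 * n} (\<lambda>_. N)) (bad_double_sample n N H s)"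
    using N H n s0 s1 by (rule ghost_sample)
  ultimately show ?thesis by (simp add: s_def)
qed

section \<open>Affine halfspaces\<close>

text \<open>
  A homogeneous linear system with more unknowns \<open>c i\<close> than equations \<open>j\<close>; the induction eliminates one
  unknown with one equation.
\<close>

lemma exists_linear_dependence:
  fixes f :: "'i \<Rightarrow> 'j \<Rightarrow> real"
  assumes "finite J" "finite I" "card J < card I"
  shows "\<exists>c. (\<exists>i\<in>I. c i \<noteq> 0) \<and> (\<forall>j\<in>J. (\<Sum>i\<in>I. c i * f i j) = 0)"
  using assms
proof (induction J arbitrary: I f rule: finite_induct)
  case empty
  then obtain i where "i \<in> I" by fastforce
  then show ?case by (intro exI[of _ "\<lambda>_. 1"]) auto
next
  case (insert j0 J)
  show ?case
  proof (cases "\<forall>i\<in>I. f i j0 = 0")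
    case True
    have "card J < card I" using insert by simp
    from insert.IH[OF insert.prems(1) this, of f] obtain c
      where "\<exists>i\<in>I. c i \<noteq> 0" "\<forall>j\<in>J. (\<Sum>i\<in>I. c i * f i j) = 0" by auto
    then show ?thesis using True by (intro exI[of _ c]) simp
  next
    case False
    then obtain i0 where i0: "i0 \<in> I" "f i0 j0 \<noteq> 0" by auto
    have I': "finite (I - {i0})" "card J < card (I - {i0})"
      using insert i0 by auto
    define a where "a i = f i j0 / f i0 j0" for i
    from insert.IH[OF I', of "\<lambda>i j. f i j - a i * f i0 j"] obtain c
      where c: "\<exists>i\<in>I - {i0}. c i \<noteq> 0" "\<And>j. j \<in> J \<Longrightarrow> (\<Sum>i\<in>I - {i0}. c i * (f i j - a i * f i0 j)) = 0" by auto
    define c' where "c' i = (if i = i0 then - (\<Sum>i\<in>I - {i0}. c i * a i) else c i)" for i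
    have split: "(\<Sum>i\<in>I. c' i * f i j) = (\<Sum>i\<in>I - {i0}. c i * (f i j - a i * f i0 j))" for j
    proof -
      have "(\<Sum>i\<in>I. c' i * f i j) = c' i0 * f i0 j + (\<Sum>i\<in>I - {i0}. c' i * f i j)"
        using i0 insert.prems by (simp add: sum.remove)
      also have "(\<Sum>i\<in>I - {i0}. c' i * f i j) = (\<Sum>i\<in>I - {i0}. c i * f i j)"
        by (rule sum.cong) (auto simp: c'_def)
      also have "c' i0 * f i0 j = - (\<Sum>i\<in>I - {i0}. c i * a i * f i0 j)"
        by (simp add: c'_def sum_distrib_right)
      finally show ?thesis by (simp add: right_diff_distrib sum_subtractf mult.assoc)
    qed
    have "(\<Sum>i\<in>I. c' i * f i j) = 0" if "j \<in> insert j0 J" for j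
    proof (cases "j = j0")
      case True
      then show ?thesis unfolding split using i0 by (simp add: a_def)
    next
      case False
      then show ?thesis unfolding split using that c(2) by simp
    qed
    moreover have "\<exists>i\<in>I. c' i \<noteq> 0" using c(1) by (auto simp: c'_def)
    ultimately show ?thesis by blast
  qed
qed

text \<open>
  Suppose more points than features were shattered. The feature vectors at these points satisfy a
  nontrivial linear relation, and after a change of sign one of its coefficients is negative. A set that
  picks out exactly the points with nonnegative coefficient belongs to a functional whose values make
  every term of the relation nonnegative and one positive, which is impossible as the sum is \<open>0\<close>.
\<close>

lemma vc_at_most_linear_functionals:
  fixes f :: "'a \<Rightarrow> 'j \<Rightarrow> real" and x :: "'i \<Rightarrow> 'a"
  assumes J: "finite J"
    and lin: "\<And>A. A \<in> F \<Longrightarrow> A \<subseteq> I \<and> (\<exists>w. \<forall>i\<in>I. i \<in> A \<longleftrightarrow> 0 \<le> (\<Sum>j\<in>J. w j * f (x i) j))"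
  shows "vc_at_most (card J) F"
  unfolding vc_at_most_def
proof (intro allI impI, rule ccontr)
  fix S assume S: "finite S" "shatters F S" "\<not> card S \<le> card J"
  obtain A0 where "A0 \<in> F" "A0 \<inter> S = S" using S(2) unfolding shatters_def by (meson order_refl)
  then have SI: "S \<subseteq> I" using lin[of A0] by auto
  have "card J < card S" using S(3) by simp
  from exists_linear_dependence[OF J S(1) this, of "\<lambda>i. f (x i)"] obtain c0
    where c0: "\<exists>i\<in>S. c0 i \<noteq> 0" "\<forall>j\<in>J. (\<Sum>i\<in>S. c0 i * f (x i) j) = 0" by auto
  obtain c where c: "\<exists>i\<in>S. c i < 0" "\<And>j. j \<in> J \<Longrightarrow> (\<Sum>i\<in>S. c i * f (x i) j) = 0"
  proof (cases "\<exists>i\<in>S. c0 i < 0")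
    case True
    then show ?thesis using that[of c0] c0 by auto
  next
    case False
    have "\<exists>i\<in>S. - c0 i < 0" using False c0(1) by (metis neg_less_0_iff_less linorder_neqE_linordered_idom)
    moreover have "(\<Sum>i\<in>S. - c0 i * f (x i) j) = 0" if "j \<in> J" for j
      using c0(2) that by (simp add: sum_negf)
    ultimately show ?thesis by (intro that[of "\<lambda>i. - c0 i"]) auto
  qed
  obtain A where A: "A \<in> F" "A \<inter> S = {i\<in>S. 0 \<le> c i}"
  proof -
    have "{i\<in>S. 0 \<le> c i} \<subseteq> S" by auto
    then show ?thesis using S(2) that unfolding shatters_def by meson
  qed
  obtain w where w: "\<And>i. i \<in> I \<Longrightarrow> i \<in> A \<longleftrightarrow> 0 \<le> (\<Sum>j\<in>J. w j * f (x i) j)"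
    using lin[OF A(1)] by auto
  define g where "g i = (\<Sum>j\<in>J. w j * f (x i) j)" for i
  have sgn: "0 \<le> c i \<longleftrightarrow> 0 \<le> g i" if "i \<in> S" for i
    using w[of i] A(2) that SI unfolding g_def by auto
  have "(\<Sum>i\<in>S. c i * g i) = (\<Sum>i\<in>S. \<Sum>j\<in>J. w j * (c i * f (x i) j))"
    unfolding g_def by (simp add: sum_distrib_left mult_ac)
  also have "\<dots> = (\<Sum>j\<in>J. \<Sum>i\<in>S. w j * (c i * f (x i) j))" by (rule sum.swap)
  also have "\<dots> = (\<Sum>j\<in>J. w j * (\<Sum>i\<in>S. c i * f (x i) j))" by (simp add: sum_distrib_left)
  also have "\<dots> = 0" using c(2) by simp
  finally have zero: "(\<Sum>i\<in>S. c i * g i) = 0" .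
  obtain i1 where i1: "i1 \<in> S" "c i1 < 0" using c(1) by auto
  have "0 < (\<Sum>i\<in>S. c i * g i)"
  proof (rule sum_pos2[OF S(1) i1(1)])
    have "g i1 < 0" using sgn[OF i1(1)] i1(2) by linarith
    then show "0 < c i1 * g i1" using i1(2) by (simp add: mult_neg_neg)
    fix i assume "i \<in> S"
    then show "0 \<le> c i * g i" using sgn[of i] by (cases "0 \<le> c i") (auto intro: mult_nonpos_nonpos)
  qed
  then show False using zero by simp
qed

definition halfspace :: "nat \<Rightarrow> real vec \<Rightarrow> real \<Rightarrow> real vec set" where
  "halfspace p u s = {x \<in> carrier_vec p. u \<bullet> x \<le> s}"

definition block_vecs :: "nat \<Rightarrow> nat \<Rightarrow> nat \<Rightarrow> real vec set" where
  "block_vecs p l m = {u \<in> carrier_vec p. \<forall>i<p. i \<notin> {l..<l + m} \<longrightarrow> u $ i = 0}"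

definition rational_block_vec :: "nat \<Rightarrow> nat \<Rightarrow> nat \<Rightarrow> rat list \<Rightarrow> real vec" where
  "rational_block_vec p l m q = vec p (\<lambda>i. if i \<in> {l..<l + m} then of_rat (q ! i) else 0)"

text \<open>
  A countable subclass keeps the exceptional events measurable; \<open>halfspace_rational_approximation\<close> shows
  that it is rich enough.
\<close>

definition rational_halfspaces :: "nat \<Rightarrow> nat \<Rightarrow> nat \<Rightarrow> real vec set set" where
  "rational_halfspaces p l m = range (\<lambda>(q, r). halfspace p (rational_block_vec p l m q) (of_rat r))"

lemma space_borel_vec [simp]: "space (borel_vec p) = carrier_vec p"
  unfolding borel_vec_def by simp

lemma borel_measurable_coordinate:
  assumes "i < p"
  shows "(\<lambda>v. v $ i) \<in> borel_measurable (borel_vec p)"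
proof -
  have f: "(\<lambda>v. \<lambda>i\<in>{..<p}. v $ i) \<in> measurable (borel_vec p) (PiM {..<p} (\<lambda>_. borel))"
    unfolding borel_vec_def by (rule measurable_vimage_algebra1) (simp add: space_PiM)
  show ?thesis
    using measurable_compose[OF f measurable_component_singleton[of i "{..<p}"]] assms by simp
qed

lemma borel_measurable_scalar_prod:
  "(\<lambda>x. u \<bullet> x) \<in> borel_measurable (borel_vec p)"
proof -
  have "(\<lambda>x. \<Sum>i<p. u $ i * x $ i) \<in> borel_measurable (borel_vec p)"
    using borel_measurable_coordinate by (intro borel_measurable_sum borel_measurable_times) auto
  moreover have "u \<bullet> x = (\<Sum>i<p. u $ i * x $ i)" if "x \<in> space (borel_vec p)" for x
    using that by (auto simp: scalar_prod_def lessThan_atLeast0)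
  ultimately show ?thesis by (subst measurable_cong) auto
qed

lemma sets_halfspace: "halfspace p u s \<in> sets (borel_vec p)"
proof -
  have "{x \<in> space (borel_vec p). u \<bullet> x \<le> s} \<in> sets (borel_vec p)"
    by (intro borel_measurable_le borel_measurable_scalar_prod) simp
  then show ?thesis by (simp add: halfspace_def)
qed

lemma rational_halfspaces_countable_measurable:
  "countable (rational_halfspaces p l m)" "rational_halfspaces p l m \<subseteq> sets (borel_vec p)"
  unfolding rational_halfspaces_def by (auto intro: sets_halfspace)

lemma block_scalar_prod:
  assumes "u \<in> block_vecs p l m" "x \<in> carrier_vec p"
  shows "u \<bullet> x = (\<Sum>i\<in>{l..<l + m} \<inter> {..<p}. u $ i * x $ i)"
proof -
  have "u \<bullet> x = (\<Sum>i<p. u $ i * x $ i)"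
    using assms by (auto simp: scalar_prod_def lessThan_atLeast0)
  also have "\<dots> = (\<Sum>i\<in>{l..<l + m} \<inter> {..<p}. u $ i * x $ i)"
    using assms by (intro sum.mono_neutral_right) (auto simp: block_vecs_def)
  finally show ?thesis .
qed

lemma rational_block_vec_in: "rational_block_vec p l m q \<in> block_vecs p l m"
  by (auto simp: rational_block_vec_def block_vecs_def)

text \<open>
  The features are the at most \<open>m\<close> coordinates in the block and the constant \<open>1\<close>, which is indexed by
  \<open>p\<close> as this is no coordinate.
\<close>

lemma vc_rational_halfspaces:
  assumes x: "\<And>i. i < n \<Longrightarrow> x i \<in> carrier_vec p"
  shows "vc_at_most (m + 1) ((\<lambda>h. {i\<in>{..<n::nat}. x i \<in> h}) ` rational_halfspaces p l m)"
proof -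
  let ?B = "{l..<l + m} \<inter> {..<p}"
  let ?f = "\<lambda>(y :: real vec) j. if j = p then 1 else y $ j"
  have "vc_at_most (card (insert p ?B)) ((\<lambda>h. {i\<in>{..<n::nat}. x i \<in> h}) ` rational_halfspaces p l m)"
  proof (rule vc_at_most_linear_functionals[where f="?f" and x=x and I="{..<n}"])
    fix A assume "A \<in> (\<lambda>h. {i\<in>{..<n::nat}. x i \<in> h}) ` rational_halfspaces p l m"
    then obtain q r where A: "A = {i\<in>{..<n}. x i \<in> halfspace p (rational_block_vec p l m q) (of_rat r)}"
      unfolding rational_halfspaces_def by auto
    let ?u = "rational_block_vec p l m q"
    let ?w = "\<lambda>j. if j = p then of_rat r else - (?u $ j)"
    have "i \<in> A \<longleftrightarrow> 0 \<le> (\<Sum>j\<in>insert p ?B. ?w j * ?f (x i) j)" if "i \<in> {..<n}" for i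
    proof -
      have xi: "x i \<in> carrier_vec p" using x that by simp
      have "(\<Sum>j\<in>insert p ?B. ?w j * ?f (x i) j) = of_rat r + (\<Sum>j\<in>?B. ?w j * ?f (x i) j)"
        by (subst sum.insert) auto
      also have "(\<Sum>j\<in>?B. ?w j * ?f (x i) j) = (\<Sum>j\<in>?B. - (?u $ j * x i $ j))"
        by (rule sum.cong) auto
      also have "\<dots> = - (?u \<bullet> x i)"
        unfolding block_scalar_prod[OF rational_block_vec_in xi] by (rule sum_negf)
      finally show ?thesis using that xi unfolding A halfspace_def by simp
    qed
    then show "A \<subseteq> {..<n} \<and> (\<exists>w. \<forall>i\<in>{..<n}. i \<in> A \<longleftrightarrow> 0 \<le> (\<Sum>j\<in>insert p ?B. w j * ?f (x i) j))"
      using A by (intro conjI exI[of _ ?w]) auto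
  qed simp
  moreover have "card (insert p ?B) \<le> m + 1"
  proof -
    have "card ?B \<le> card {l..<l + m}" by (rule card_mono) auto
    then show ?thesis by (simp add: card_insert_if)
  qed
  ultimately show ?thesis unfolding vc_at_most_def using order_trans by meson
qed

text \<open>
  The offsets approach \<open>s\<close> from above at speed \<open>1/j\<close> and the normals approach \<open>u\<close> at speed
  \<open>1/j\<^sup>2\<close>. The slack in the offset eventually dominates the error in the normal at every fixed \<open>x\<close>, so
  that the boundary points, which belong to the halfspace, also belong to its approximations.
\<close>

lemma halfspace_rational_approximation:
  assumes u: "u \<in> block_vecs p l m"
  shows "\<exists>h. (\<forall>j. h j \<in> rational_halfspaces p l m)
    \<and> (\<forall>x\<in>carrier_vec p. (\<lambda>j. indicator (h j) x :: real) \<longlonglongrightarrow> indicator (halfspace p u s) x)"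
proof -
  let ?e = "\<lambda>j::nat. 1 / (real j + 1)"
  have "\<exists>q. \<bar>of_rat q - u $ i\<bar> < (?e j)\<^sup>2" for i j
  proof -
    have "u $ i - (?e j)\<^sup>2 < u $ i + (?e j)\<^sup>2" by simp
    from of_rat_dense[OF this] obtain q where "u $ i - (?e j)\<^sup>2 < of_rat q" "of_rat q < u $ i + (?e j)\<^sup>2" by auto
    then show ?thesis by (intro exI[of _ q]) auto
  qed
  then obtain q where q: "\<And>i j. \<bar>of_rat (q i j) - u $ i\<bar> < (?e j)\<^sup>2" by metis
  have "\<exists>r. s + ?e j < of_rat r \<and> of_rat r < s + 2 * ?e j" for j
    by (rule of_rat_dense) (simp add: divide_strict_right_mono)
  then obtain r where r: "\<And>j. s + ?e j < of_rat (r j)" "\<And>j. of_rat (r j) < s + 2 * ?e j" by metis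
  define v where "v j = rational_block_vec p l m (map (\<lambda>i. q i j) [0..<p])" for j
  define h where "h j = halfspace p (v j) (of_rat (r j))" for j
  have hr: "h j \<in> rational_halfspaces p l m" for j
    unfolding h_def v_def rational_halfspaces_def by (rule range_eqI[where x="(map (\<lambda>i. q i j) [0..<p], r j)"]) simp
  have e0: "(\<lambda>j. ?e j) \<longlonglongrightarrow> 0"
    using LIMSEQ_inverse_real_of_nat by (simp add: inverse_eq_divide add.commute)
  have "(\<lambda>j. indicator (h j) x :: real) \<longlonglongrightarrow> indicator (halfspace p u s) x" if x: "x \<in> carrier_vec p" for x
  proof -
    define c where "c = (\<Sum>i<p. \<bar>x $ i\<bar>)"
    have c0: "0 \<le> c" by (simp add: c_def sum_nonneg)
    have close: "\<bar>v j \<bullet> x - u \<bullet> x\<bar> \<le> (?e j)\<^sup>2 * c" for j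
    proof -
      have "v j \<bullet> x - u \<bullet> x = (\<Sum>i<p. (v j $ i - u $ i) * x $ i)"
        using x u by (auto simp: scalar_prod_def lessThan_atLeast0 sum_subtractf[symmetric] algebra_simps block_vecs_def)
      also have "\<bar>\<dots>\<bar> \<le> (\<Sum>i<p. \<bar>(v j $ i - u $ i) * x $ i\<bar>)" by (rule sum_abs)
      also have "\<dots> \<le> (\<Sum>i<p. (?e j)\<^sup>2 * \<bar>x $ i\<bar>)"
      proof (rule sum_mono)
        fix i assume i: "i \<in> {..<p}"
        have "\<bar>v j $ i - u $ i\<bar> \<le> (?e j)\<^sup>2"
        proof (cases "i \<in> {l..<l + m}")
          case True
          then show ?thesis using q[of i j] i by (simp add: v_def rational_block_vec_def)
        next
          case False
          then have "u $ i = 0" "v j $ i = 0"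
            using u i by (auto simp: v_def rational_block_vec_def block_vecs_def)
          then show ?thesis by simp
        qed
        then show "\<bar>(v j $ i - u $ i) * x $ i\<bar> \<le> (?e j)\<^sup>2 * \<bar>x $ i\<bar>"
          unfolding abs_mult by (rule mult_right_mono) simp
      qed
      finally show ?thesis unfolding c_def by (simp add: sum_distrib_left)
    qed
    have "\<forall>\<^sub>F j in sequentially. indicator (h j) x = (indicator (halfspace p u s) x :: real)"
    proof (cases "u \<bullet> x \<le> s")
      case True
      have "\<forall>\<^sub>F j in sequentially. ?e j * c < 1"
        using tendsto_mult_left_zero[OF e0, of c] by (rule order_tendstoD) simp
      then show ?thesis
      proof eventually_elim
        case (elim j)
        have "(?e j)\<^sup>2 * c = ?e j * (?e j * c)" by (simp add: power2_eq_square)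
        also have "\<dots> \<le> ?e j * 1" using elim by (intro mult_left_mono) auto
        finally have "v j \<bullet> x \<le> of_rat (r j)" using close[of j] True r(1)[of j] by linarith
        then show ?case using x True by (simp add: h_def halfspace_def)
      qed
    next
      case False
      have "(\<lambda>j. ?e j * (?e j * c) + 2 * ?e j) \<longlonglongrightarrow> 0 * (0 * c) + 2 * 0"
        by (intro tendsto_intros e0)
      then have "\<forall>\<^sub>F j in sequentially. ?e j * (?e j * c) + 2 * ?e j < u \<bullet> x - s"
        by (rule order_tendstoD) (use False in simp)
      then show ?thesis
      proof eventually_elim
        case (elim j)
        have "(?e j)\<^sup>2 * c = ?e j * (?e j * c)" by (simp add: power2_eq_square)
        then have "of_rat (r j) < v j \<bullet> x" using close[of j] r(2)[of j] elim by linarith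
        then show ?case using x False by (simp add: h_def halfspace_def)
      qed
    qed
    then show ?thesis by (rule tendsto_eventually)
  qed
  then show ?thesis using hr by auto
qed

text \<open>
  Pointwise convergence of the indicators carries the deviation bound from rational to arbitrary
  halfspaces, on the empirical side trivially and on the side of \<open>N\<close> by dominated convergence.
\<close>

lemma block_halfspace_deviation:
  assumes N: "prob_space N" "sets N = sets (borel_vec p)"
    and X: "X \<in> space (PiM {..<n} (\<lambda>_. N))" "X \<notin> bad_sample n N (rational_halfspaces p l m) S"
    and u: "u \<in> block_vecs p l m"
  shows "\<bar>(\<Sum>i<n. indicator (halfspace p u s) (X i)) - real n * measure N (halfspace p u s)\<bar> \<le> S"
proof -
  interpret N: prob_space N by fact
  have sp: "space N = carrier_vec p" using sets_eq_imp_space_eq[OF N(2)] by simp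
  obtain h where h: "\<And>j. h j \<in> rational_halfspaces p l m"
      and lim: "\<And>x. x \<in> carrier_vec p \<Longrightarrow> (\<lambda>j. indicator (h j) x :: real) \<longlonglongrightarrow> indicator (halfspace p u s) x"
    using halfspace_rational_approximation[OF u, of s] by auto
  have hm: "h j \<in> sets N" for j
    using h rational_halfspaces_countable_measurable(2) N(2) by blast
  have um: "halfspace p u s \<in> sets N" using sets_halfspace N(2) by simp
  have "(\<lambda>j. N.expectation (indicator (h j))) \<longlonglongrightarrow> N.expectation (indicator (halfspace p u s) :: _ \<Rightarrow> real)"
  proof (rule integral_dominated_convergence[where w="\<lambda>_. 1"])
    show "AE x in N. (\<lambda>j. indicator (h j) x :: real) \<longlonglongrightarrow> indicator (halfspace p u s) x"
      using lim sp by (intro AE_I2) simp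
  qed (use hm um in \<open>auto simp: indicator_def\<close>)
  then have lm: "(\<lambda>j. measure N (h j)) \<longlonglongrightarrow> measure N (halfspace p u s)"
    using hm um by (simp add: Int_absorb2 sets.sets_into_space)
  have "X i \<in> carrier_vec p" if "i < n" for i using X(1) sp that by (auto simp: space_PiM)
  then have ls: "(\<lambda>j. \<Sum>i<n. indicator (h j) (X i) :: real) \<longlonglongrightarrow> (\<Sum>i<n. indicator (halfspace p u s) (X i))"
    by (intro tendsto_sum lim) simp
  have conv: "(\<lambda>j. \<bar>(\<Sum>i<n. indicator (h j) (X i)) - real n * measure N (h j)\<bar>)
      \<longlonglongrightarrow> \<bar>(\<Sum>i<n. indicator (halfspace p u s) (X i)) - real n * measure N (halfspace p u s)\<bar>"
    by (intro tendsto_intros lm ls)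
  have bound: "\<bar>(\<Sum>i<n. indicator (h j) (X i)) - real n * measure N (h j)\<bar> \<le> S" for j
  proof (rule ccontr)
    assume "\<not> ?thesis"
    then have "X \<in> bad_sample n N (rational_halfspaces p l m) S"
      unfolding bad_sample_def using X(1) h[of j] by (auto simp: not_le)
    then show False using X(2) by simp
  qed
  show ?thesis
  proof (rule LIMSEQ_le_const2[OF conv], rule exI[of _ 0], intro allI impI)
    fix j show "\<bar>(\<Sum>i<n. indicator (h j) (X i)) - real n * measure N (h j)\<bar> \<le> S" by (rule bound)
  qed
qed

section \<open>Quadratic forms and the operator norm\<close>

text \<open>
  The source of the two Cauchy-Schwarz inequalities below.
\<close>

lemma nonneg_quadratic_discriminant:
  fixes a b c :: real
  assumes "\<And>t. 0 \<le> a + 2 * t * b + t\<^sup>2 * c" and "0 \<le> c"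
  shows "b\<^sup>2 \<le> a * c"
proof (cases "c = 0")
  case True
  have "b = 0"
  proof (rule ccontr)
    assume "b \<noteq> 0"
    then have "a + 2 * (- (a + 1) / (2 * b)) * b = - 1" by (simp add: field_simps)
    then show False using assms(1)[of "- (a + 1) / (2 * b)"] True by simp
  qed
  then show ?thesis using True by simp
next
  case False
  have c: "0 < c" using assms(2) False by simp
  have "0 \<le> a + 2 * (- b / c) * b + (- b / c)\<^sup>2 * c" by (rule assms(1))
  also have "\<dots> = (a * c - b\<^sup>2) / c" using c by (simp add: field_simps power2_eq_square)
  finally show ?thesis using c by (simp add: zero_le_divide_iff)
qed

lemma scalar_prod_self_nonneg: "0 \<le> (v :: real vec) \<bullet> v"
  unfolding scalar_prod_def by (rule sum_nonneg) simp

lemma vec_norm2_square: "(vec_norm2 v)\<^sup>2 = v \<bullet> v"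
  unfolding vec_norm2_def by (simp add: scalar_prod_self_nonneg)

lemma unit_sphere_iff: "u \<in> unit_sphere p \<longleftrightarrow> u \<in> carrier_vec p \<and> u \<bullet> u = 1"
  unfolding unit_sphere_def vec_norm2_def by simp

lemma unit_sphere_nonempty: "1 \<le> p \<Longrightarrow> unit_sphere p \<noteq> {}"
proof -
  assume "1 \<le> p"
  then have "unit_vec p 0 \<in> unit_sphere p" by (simp add: unit_sphere_iff)
  then show ?thesis by blast
qed

lemma symmetric_form_commute:
  fixes E :: "real mat"
  assumes E: "E \<in> carrier_mat p p" "transpose_mat E = E" and u: "u \<in> carrier_vec p" "w \<in> carrier_vec p"
  shows "u \<bullet> (E *\<^sub>v w) = w \<bullet> (E *\<^sub>v u)"
proof -
  have "w \<bullet> (E *\<^sub>v u) = (transpose_mat E *\<^sub>v w) \<bullet> u"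
    using transpose_vec_mult_scalar[OF E(1) u(1) u(2)] by simp
  also have "\<dots> = u \<bullet> (E *\<^sub>v w)"
    unfolding E(2) using E u by (intro comm_scalar_prod[of _ p]) auto
  finally show ?thesis ..
qed

lemma scalar_prod_add_smult:
  fixes u w :: "real vec"
  assumes "u \<in> carrier_vec p" "w \<in> carrier_vec p"
  shows "(u + t \<cdot>\<^sub>v w) \<bullet> (u + t \<cdot>\<^sub>v w) = u \<bullet> u + 2 * t * (w \<bullet> u) + t\<^sup>2 * (w \<bullet> w)"
proof -
  have "u \<bullet> w = w \<bullet> u" using assms by (intro comm_scalar_prod[of _ p]) auto
  then show ?thesis
    using assms by (simp add: add_scalar_prod_distrib[of _ p] scalar_prod_add_distrib[of _ p] algebra_simps power2_eq_square)
qed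

lemma quad_form_add_smult:
  assumes E: "E \<in> carrier_mat p p" "transpose_mat E = E" and u: "u \<in> carrier_vec p" "w \<in> carrier_vec p"
  shows "quad_form E (u + t \<cdot>\<^sub>v w) = quad_form E u + 2 * t * (w \<bullet> (E *\<^sub>v u)) + t\<^sup>2 * quad_form E w"
proof -
  have m: "E *\<^sub>v (u + t \<cdot>\<^sub>v w) = E *\<^sub>v u + t \<cdot>\<^sub>v (E *\<^sub>v w)"
    using E u by (simp add: mult_add_distrib_mat_vec[of _ p p] mult_mat_vec[of _ p p])
  have c: "E *\<^sub>v u \<in> carrier_vec p" "E *\<^sub>v w \<in> carrier_vec p" using E u by auto
  show ?thesis
    unfolding quad_form_def m using u c symmetric_form_commute[OF E u]
    by (simp add: add_scalar_prod_distrib[of _ p] scalar_prod_add_distrib[of _ p] algebra_simps power2_eq_square)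
qed

lemma quad_form_smult:
  assumes "E \<in> carrier_mat p p" "u \<in> carrier_vec p"
  shows "quad_form E (t \<cdot>\<^sub>v u) = t\<^sup>2 * quad_form E u"
  using assms by (simp add: quad_form_def mult_mat_vec[of _ p p] power2_eq_square)

text \<open>
  Polarisation at \<open>u\<close> and \<open>E u / |E u|\<close>.
\<close>

lemma op_norm_le_of_quad_form:
  assumes E: "E \<in> carrier_mat p p" "transpose_mat E = E" and p: "1 \<le> p"
    and q: "\<And>w. w \<in> carrier_vec p \<Longrightarrow> \<bar>quad_form E w\<bar> \<le> s * (w \<bullet> w)"
  shows "op_norm E \<le> s" "0 \<le> op_norm E"
proof -
  have norm_le: "vec_norm2 (E *\<^sub>v u) \<le> s" if u: "u \<in> unit_sphere p" for u
  proof -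
    have u': "u \<in> carrier_vec p" "u \<bullet> u = 1" using u by (auto simp: unit_sphere_iff)
    define w where "w = E *\<^sub>v u"
    define r where "r = vec_norm2 w"
    have w: "w \<in> carrier_vec p" using E u' by (simp add: w_def)
    have r2: "w \<bullet> w = r\<^sup>2" by (simp add: r_def vec_norm2_square)
    have r0: "0 \<le> r" unfolding r_def vec_norm2_def by (simp add: scalar_prod_self_nonneg)
    have s0: "0 \<le> s" using q[OF u'(1)] u' by simp
    show ?thesis
    proof (cases "r = 0")
      case True
      then show ?thesis using s0 by (simp add: r_def w_def)
    next
      case False
      have "quad_form E (u + (1 / r) \<cdot>\<^sub>v w) - quad_form E (u + (- 1 / r) \<cdot>\<^sub>v w) = 4 * (1 / r) * r\<^sup>2"
        unfolding quad_form_add_smult[OF E u'(1) w] w_def[symmetric] r2 by (simp add: power2_eq_square)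
      moreover have "\<bar>quad_form E (u + t \<cdot>\<^sub>v w)\<bar> \<le> s * (1 + 2 * t * (w \<bullet> u) + t\<^sup>2 * r\<^sup>2)" for t
        using q[of "u + t \<cdot>\<^sub>v w"] u' w scalar_prod_add_smult[OF u'(1) w, of t] r2 by simp
      from this[of "1 / r"] this[of "- 1 / r"]
      have "\<bar>quad_form E (u + (1 / r) \<cdot>\<^sub>v w)\<bar> + \<bar>quad_form E (u + (- 1 / r) \<cdot>\<^sub>v w)\<bar> \<le> 4 * s"
        using False by (simp add: power_divide algebra_simps)
      ultimately have "4 * (1 / r) * r\<^sup>2 \<le> 4 * s" by linarith
      then show ?thesis using False by (simp add: power2_eq_square r_def w_def)
    qed
  qed
  then show "op_norm E \<le> s"
    unfolding op_norm_def using E unit_sphere_nonempty[OF p] by (intro cSUP_least) auto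
  obtain u where u: "u \<in> unit_sphere p" using unit_sphere_nonempty[OF p] by blast
  have "0 \<le> vec_norm2 (E *\<^sub>v u)" by (simp add: vec_norm2_def scalar_prod_self_nonneg)
  also have "\<dots> \<le> op_norm E"
    unfolding op_norm_def using E u norm_le by (intro cSUP_upper bdd_aboveI2[of _ _ s]) auto
  finally show "0 \<le> op_norm E" .
qed

lemma quad_form_eq_sum:
  assumes "E \<in> carrier_mat p p" "u \<in> carrier_vec p"
  shows "quad_form E u = (\<Sum>i<p. \<Sum>j<p. E $$ (i, j) * u $ i * u $ j)"
proof -
  have "quad_form E u = (\<Sum>i<p. u $ i * (\<Sum>j<p. E $$ (i, j) * u $ j))"
    unfolding quad_form_def scalar_prod_def mult_mat_vec_def using assms
    by (simp add: scalar_prod_def lessThan_atLeast0)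
  also have "\<dots> = (\<Sum>i<p. \<Sum>j<p. E $$ (i, j) * u $ i * u $ j)"
    by (simp add: sum_distrib_left algebra_simps)
  finally show ?thesis .
qed

lemma scalar_prod_self_eq_sum:
  "u \<in> carrier_vec p \<Longrightarrow> (u :: real vec) \<bullet> u = (\<Sum>i<p. (u $ i)\<^sup>2)"
  unfolding scalar_prod_def by (simp add: lessThan_atLeast0 power2_eq_square)

text \<open>
  The window of the \<open>m\<close> indices just below \<open>l\<close>. Letting it slide over the left end \<open>0\<close> as well as the right
  end makes the number of windows that contain a given pair independent of where the pair lies.
\<close>

definition window :: "nat \<Rightarrow> nat \<Rightarrow> nat set" where
  "window m l = {i. i < l \<and> l \<le> i + m}"

definition restrict_vec :: "nat set \<Rightarrow> real vec \<Rightarrow> real vec" where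
  "restrict_vec W w = vec (dim_vec w) (\<lambda>i. if i \<in> W then w $ i else 0)"

lemma sum_windows:
  assumes "i < p" "j < p"
  shows "(\<Sum>l\<le>p + m. of_bool (i \<in> window m l) * of_bool (j \<in> window m l)) = real (min i j + m - max i j)"
proof -
  have "(\<Sum>l\<le>p + m. of_bool (i \<in> window m l) * of_bool (j \<in> window m l)) = (\<Sum>l\<le>p + m. of_bool (l \<in> {max i j<..min i j + m}) :: real)"
    by (rule sum.cong) (auto simp: window_def)
  also have "\<dots> = real (card ({..p + m} \<inter> {max i j<..min i j + m}))"
    by (simp add: of_bool_def sum.If_cases) (rule arg_cong[where f=card], auto)
  also have "{..p + m} \<inter> {max i j<..min i j + m} = {max i j<..min i j + m}"
    using assms by auto
  finally show ?thesis by simp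
qed

lemma sum_quad_form_windows:
  assumes E: "E \<in> carrier_mat p p" and w: "w \<in> carrier_vec p"
  shows "(\<Sum>l\<le>p + m. quad_form E (restrict_vec (window m l) w))
    = (\<Sum>i<p. \<Sum>j<p. E $$ (i, j) * w $ i * w $ j * real (min i j + m - max i j))"
proof -
  have "(\<Sum>l\<le>p + m. quad_form E (restrict_vec (window m l) w))
      = (\<Sum>l\<le>p + m. \<Sum>i<p. \<Sum>j<p. E $$ (i, j) * w $ i * w $ j * (of_bool (i \<in> window m l) * of_bool (j \<in> window m l)))"
    using w by (intro sum.cong refl, subst quad_form_eq_sum[OF E]) (auto simp: restrict_vec_def intro!: sum.cong)
  also have "\<dots> = (\<Sum>i<p. \<Sum>j<p. \<Sum>l\<le>p + m. E $$ (i, j) * w $ i * w $ j * (of_bool (i \<in> window m l) * of_bool (j \<in> window m l)))"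
    by (rule trans[OF sum.swap], rule sum.cong[OF refl], rule sum.swap)
  also have "\<dots> = (\<Sum>i<p. \<Sum>j<p. E $$ (i, j) * w $ i * w $ j * real (min i j + m - max i j))"
    unfolding sum_distrib_left[symmetric] by (intro sum.cong refl, subst sum_windows) auto
  finally show ?thesis .
qed

lemma sum_scalar_prod_windows:
  assumes w: "w \<in> carrier_vec p"
  shows "(\<Sum>l\<le>p + m. restrict_vec (window m l) w \<bullet> restrict_vec (window m l) w) = real m * (w \<bullet> w)"
proof -
  have c: "restrict_vec W w \<in> carrier_vec p" for W using w by (auto simp: restrict_vec_def)
  have "(\<Sum>l\<le>p + m. restrict_vec (window m l) w \<bullet> restrict_vec (window m l) w)
      = (\<Sum>l\<le>p + m. \<Sum>i<p. (w $ i)\<^sup>2 * (of_bool (i \<in> window m l) * of_bool (i \<in> window m l)))"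
    unfolding scalar_prod_self_eq_sum[OF c] using w by (intro sum.cong refl) (auto simp: restrict_vec_def)
  also have "\<dots> = (\<Sum>i<p. \<Sum>l\<le>p + m. (w $ i)\<^sup>2 * (of_bool (i \<in> window m l) * of_bool (i \<in> window m l)))"
    by (rule sum.swap)
  also have "\<dots> = (\<Sum>i<p. (w $ i)\<^sup>2 * real m)"
    unfolding sum_distrib_left[symmetric] by (intro sum.cong refl, subst sum_windows) auto
  also have "\<dots> = real m * (w \<bullet> w)"
    unfolding scalar_prod_self_eq_sum[OF w] by (simp add: sum_distrib_left mult.commute)
  finally show ?thesis .
qed

text \<open>
  The sum over the windows of length \<open>m\<close> weights the entry \<open>(i, j)\<close> by \<open>m - |i - j|\<close>, cut off at \<open>0\<close>. On the
  band \<open>|i - j| \<le> k\<close> the weights for \<open>m = 2k\<close> and \<open>m = k\<close> differ by exactly \<open>k\<close>. The two sums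
  together carry \<open>2k + k\<close> times the squared length of \<open>w\<close>, which is where the factor \<open>3\<close> comes from.
\<close>

lemma banded_quad_form_le:
  assumes E: "E \<in> carrier_mat p p" and k: "1 \<le> k"
    and band: "\<And>i j. i < p \<Longrightarrow> j < p \<Longrightarrow> int k < \<bar>int i - int j\<bar> \<Longrightarrow> E $$ (i, j) = 0"
    and loc: "\<And>l w. l \<le> p - 2 * k \<Longrightarrow> w \<in> carrier_vec p \<Longrightarrow> (\<And>i. i < p \<Longrightarrow> i \<notin> {l..<l + 2 * k} \<Longrightarrow> w $ i = 0)
        \<Longrightarrow> \<bar>quad_form E w\<bar> \<le> s * (w \<bullet> w)"
    and w: "w \<in> carrier_vec p"
  shows "\<bar>quad_form E w\<bar> \<le> 3 * s * (w \<bullet> w)"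
proof -
  define Q where "Q m = (\<Sum>l\<le>p + m. quad_form E (restrict_vec (window m l) w))" for m
  have Q: "\<bar>Q m\<bar> \<le> real m * (s * (w \<bullet> w))" if m: "m \<le> 2 * k" for m
  proof -
    have "\<bar>Q m\<bar> \<le> (\<Sum>l\<le>p + m. \<bar>quad_form E (restrict_vec (window m l) w)\<bar>)"
      unfolding Q_def by (rule sum_abs)
    also have "\<dots> \<le> (\<Sum>l\<le>p + m. s * (restrict_vec (window m l) w \<bullet> restrict_vec (window m l) w))"
    proof (rule sum_mono)
      fix l
      show "\<bar>quad_form E (restrict_vec (window m l) w)\<bar> \<le> s * (restrict_vec (window m l) w \<bullet> restrict_vec (window m l) w)"
      \<comment> \<open>A window that protrudes over an end of \<open>{0..<p}\<close> is part of the block pushed back inside.\<close>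
      proof (rule loc[of "min (l - m) (p - 2 * k)"])
        fix i assume i: "i < p" "i \<notin> {min (l - m) (p - 2 * k)..<min (l - m) (p - 2 * k) + 2 * k}"
        have "i \<notin> window m l"
          using i m unfolding window_def by auto
        then show "restrict_vec (window m l) w $ i = 0" using i w by (simp add: restrict_vec_def)
      qed (use w in \<open>auto simp: restrict_vec_def\<close>)
    qed
    also have "\<dots> = s * (real m * (w \<bullet> w))"
      unfolding sum_distrib_left[symmetric] sum_scalar_prod_windows[OF w] ..
    finally show ?thesis by (simp add: algebra_simps)
  qed
  have "Q (2 * k) - Q k = (\<Sum>i<p. \<Sum>j<p. real k * (E $$ (i, j) * w $ i * w $ j))"
    unfolding Q_def sum_quad_form_windows[OF E w] sum_subtractf[symmetric]
  proof (intro sum.cong refl)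
    fix i j assume ij: "i \<in> {..<p}" "j \<in> {..<p}"
    show "E $$ (i, j) * w $ i * w $ j * real (min i j + 2 * k - max i j)
        - E $$ (i, j) * w $ i * w $ j * real (min i j + k - max i j) = real k * (E $$ (i, j) * w $ i * w $ j)"
    proof (cases "int k < \<bar>int i - int j\<bar>")
      case True
      then show ?thesis using band[of i j] ij by simp
    next
      case False
      then have le: "max i j \<le> min i j + k" by (auto simp: max_def min_def)
      then have "real (min i j + 2 * k - max i j) = real (min i j + k - max i j) + real k" by linarith
      then show ?thesis by (simp add: algebra_simps)
    qed
  qed
  also have "\<dots> = real k * quad_form E w"
    unfolding quad_form_eq_sum[OF E w] by (simp add: sum_distrib_left)
  finally have "real k * \<bar>quad_form E w\<bar> = \<bar>Q (2 * k) - Q k\<bar>"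
    by (simp add: abs_mult)
  also have "\<dots> \<le> real (2 * k) * (s * (w \<bullet> w)) + real k * (s * (w \<bullet> w))"
    using Q[of "2 * k"] Q[of k] by linarith
  also have "\<dots> = real k * (3 * s * (w \<bullet> w))" by (simp add: algebra_simps)
  finally show ?thesis using k by simp
qed

lemma quad_form_unit_bounded:
  assumes "E \<in> carrier_mat p p" "u \<in> unit_sphere p"
  shows "\<bar>quad_form E u\<bar> \<le> (\<Sum>i<p. \<Sum>j<p. \<bar>E $$ (i, j)\<bar>)"
proof -
  have u: "u \<in> carrier_vec p" "u \<bullet> u = 1" using assms by (auto simp: unit_sphere_iff)
  have le1: "\<bar>u $ i\<bar> \<le> 1" if "i < p" for i
  proof -
    have "(u $ i)\<^sup>2 \<le> (\<Sum>i<p. (u $ i)\<^sup>2)" using that by (intro member_le_sum) auto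
    then show ?thesis using u scalar_prod_self_eq_sum[OF u(1)] by (simp add: abs_square_le_1)
  qed
  have "\<bar>quad_form E u\<bar> \<le> (\<Sum>i<p. \<bar>\<Sum>j<p. E $$ (i, j) * u $ i * u $ j\<bar>)"
    unfolding quad_form_eq_sum[OF assms(1) u(1)] by (rule sum_abs)
  also have "\<dots> \<le> (\<Sum>i<p. \<Sum>j<p. \<bar>E $$ (i, j) * u $ i * u $ j\<bar>)"
    by (intro sum_mono sum_abs)
  also have "\<dots> \<le> (\<Sum>i<p. \<Sum>j<p. \<bar>E $$ (i, j)\<bar>)"
  proof (intro sum_mono)
    fix i j assume "i \<in> {..<p}" "j \<in> {..<p}"
    then have "\<bar>u $ i\<bar> * \<bar>u $ j\<bar> \<le> 1" using le1 by (intro mult_le_one) auto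
    then have "\<bar>E $$ (i, j)\<bar> * (\<bar>u $ i\<bar> * \<bar>u $ j\<bar>) \<le> \<bar>E $$ (i, j)\<bar> * 1" by (intro mult_left_mono) auto
    then show "\<bar>E $$ (i, j) * u $ i * u $ j\<bar> \<le> \<bar>E $$ (i, j)\<bar>" by (simp add: abs_mult mult.assoc)
  qed
  finally show ?thesis .
qed

text \<open>
  If the supremum \<open>mu\<close> were no eigenvalue, \<open>C = B - mu\<close> would have an inverse \<open>R\<close>. Cauchy-Schwarz for the
  semidefinite form \<open>- C\<close> at the vectors \<open>u\<close> and \<open>R u\<close> gives \<open>1 \<le> K (mu - quad_form B u)\<close> for all
  unit \<open>u\<close>, where \<open>K\<close> bounds the form of \<open>R\<close>; then \<open>mu - 1/K\<close> is a smaller upper bound. This way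
  no maximiser has to be produced by compactness.
\<close>

lemma Sup_quad_form_is_eigenvalue:
  assumes B: "B \<in> carrier_mat p p" "transpose_mat B = B" and p: "1 \<le> p"
  shows "eigenvalue B (SUP u\<in>unit_sphere p. quad_form B u)"
proof (rule ccontr)
  define mu where "mu = (SUP u\<in>unit_sphere p. quad_form B u)"
  assume "\<not> eigenvalue B (SUP u\<in>unit_sphere p. quad_form B u)"
  then have det: "det (char_matrix B mu) \<noteq> 0"
    unfolding mu_def using eigenvalue_det[OF B(1)] by simp
  let ?C = "char_matrix B mu"
  have C: "?C \<in> carrier_mat p p" using B by simp
  have Ct: "transpose_mat ?C = ?C"
  proof (rule eq_matI)
    fix i j assume ij: "i < dim_row ?C" "j < dim_col ?C"
    then have ij': "i < p" "j < p" using C by auto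
    have "B $$ (j, i) = transpose_mat B $$ (i, j)" using ij' B(1) by simp
    then have "B $$ (j, i) = B $$ (i, j)" unfolding B(2) .
    then show "transpose_mat ?C $$ (i, j) = ?C $$ (i, j)"
      using ij' B(1) unfolding char_matrix_def by auto
  qed (use C in auto)
  obtain R where R: "R \<in> carrier_mat p p" "?C * R = 1\<^sub>m p"
    using det_non_zero_imp_unit[OF C det, of "()"] unfolding Units_def ring_mat_def by auto
  have ub: "quad_form B u \<le> mu" if "u \<in> unit_sphere p" for u
    unfolding mu_def
  proof (rule cSUP_upper[OF that])
    show "bdd_above (quad_form B ` unit_sphere p)"
      using quad_form_unit_bounded[OF B(1)] by (intro bdd_aboveI2[of _ _ "\<Sum>i<p. \<Sum>j<p. \<bar>B $$ (i, j)\<bar>"]) (auto dest: abs_le_D1)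
  qed
  have qC: "quad_form ?C w = quad_form B w - mu * (w \<bullet> w)" if w: "w \<in> carrier_vec p" for w
  proof -
    have "((- mu) \<cdot>\<^sub>m 1\<^sub>m p) *\<^sub>v w = (- mu) \<cdot>\<^sub>v (1\<^sub>m p *\<^sub>v w)"
      using w by (intro eq_vecI) auto
    then have "?C *\<^sub>v w = B *\<^sub>v w + (- mu) \<cdot>\<^sub>v w"
      unfolding char_matrix_def using B w by (simp add: add_mult_distrib_mat_vec[of _ p p])
    then show ?thesis using B w by (simp add: quad_form_def scalar_prod_add_distrib[of _ p])
  qed
  have neg: "quad_form ?C w \<le> 0" if w: "w \<in> carrier_vec p" for w
  proof (cases "w \<bullet> w = 0")
    case True
    then have "(\<Sum>i<p. (w $ i)\<^sup>2) = 0" using scalar_prod_self_eq_sum[OF w] by simp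
    then have "w $ i = 0" if "i < p" for i using that by (simp add: sum_nonneg_eq_0_iff)
    then have "quad_form ?C w = 0" unfolding quad_form_eq_sum[OF C w] by simp
    then show ?thesis by simp
  next
    case False
    define r where "r = vec_norm2 w"
    have r: "r\<^sup>2 = w \<bullet> w" "r \<noteq> 0" using False vec_norm2_square[of w] by (auto simp: r_def)
    have "(1 / r) \<cdot>\<^sub>v w \<in> unit_sphere p"
      using w r(2) unfolding unit_sphere_iff by (simp add: r(1)[symmetric] power2_eq_square)
    from ub[OF this] have "(1 / r)\<^sup>2 * quad_form B w \<le> mu"
      unfolding quad_form_smult[OF B(1) w] .
    moreover have "0 < r\<^sup>2" using r(2) by simp
    ultimately have "quad_form B w \<le> mu * r\<^sup>2" by (simp add: power_divide divide_le_eq)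
    then show ?thesis using qC[OF w] r by simp
  qed
  define K where "K = (\<Sum>i<p. \<Sum>j<p. \<bar>R $$ (i, j)\<bar>)"
  have gap: "1 \<le> (mu - quad_form B u) * K" if u: "u \<in> unit_sphere p" for u
  proof -
    have u': "u \<in> carrier_vec p" "u \<bullet> u = 1" using u by (auto simp: unit_sphere_iff)
    define v where "v = R *\<^sub>v u"
    have v: "v \<in> carrier_vec p" using R u' by (simp add: v_def)
    have Cv: "?C *\<^sub>v v = u"
      using R C u' by (simp add: v_def assoc_mult_mat_vec[symmetric, of _ p p _ p])
    have "(- (u \<bullet> (?C *\<^sub>v v)))\<^sup>2 \<le> (- quad_form ?C v) * (- quad_form ?C u)"
    proof (rule nonneg_quadratic_discriminant)
      fix t
      have "quad_form ?C (v + t \<cdot>\<^sub>v u) \<le> 0" using u' v by (intro neg) simp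
      then show "0 \<le> - quad_form ?C v + 2 * t * - (u \<bullet> (?C *\<^sub>v v)) + t\<^sup>2 * - quad_form ?C u"
        unfolding quad_form_add_smult[OF C Ct v u'(1)] by simp
    next
      show "0 \<le> - quad_form ?C u" using neg[OF u'(1)] by simp
    qed
    then have one: "1 \<le> (- quad_form ?C v) * (- quad_form ?C u)" using Cv u' by simp
    have "quad_form ?C v = v \<bullet> u" unfolding quad_form_def Cv ..
    also have "\<dots> = u \<bullet> v" using u' v by (intro comm_scalar_prod[of _ p]) auto
    also have "\<dots> = quad_form R u" by (simp add: quad_form_def v_def)
    finally have "- quad_form ?C v \<le> K"
      using quad_form_unit_bounded[OF R(1) u] unfolding K_def by linarith
    then have "(- quad_form ?C v) * (- quad_form ?C u) \<le> K * (- quad_form ?C u)"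
      using neg[OF u'(1)] by (intro mult_right_mono) auto
    then show ?thesis using one qC[OF u'(1)] u' by (simp add: mult.commute)
  qed
  obtain u0 where u0: "u0 \<in> unit_sphere p" using unit_sphere_nonempty[OF p] by blast
  have K: "0 < K"
  proof -
    have "0 \<le> K" by (simp add: K_def sum_nonneg)
    moreover have "K \<noteq> 0" using gap[OF u0] by auto
    ultimately show ?thesis by simp
  qed
  have "mu \<le> mu - 1 / K"
    unfolding mu_def
  proof (rule cSUP_least[OF unit_sphere_nonempty[OF p]])
    fix u assume "u \<in> unit_sphere p"
    from gap[OF this] show "quad_form B u \<le> (SUP u\<in>unit_sphere p. quad_form B u) - 1 / K"
      using K unfolding mu_def[symmetric] by (simp add: field_simps)
  qed
  then show False using K by simp
qed

text \<open>
  The form is at most \<open>|G u|\<close>, whose square is a value of the form of the transpose of \<open>G\<close> times \<open>G\<close> and hence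
  at most its largest eigenvalue.
\<close>

lemma quad_form_le_s_max:
  assumes G: "G \<in> carrier_mat p p" and u: "u \<in> unit_sphere p" and p: "1 \<le> p"
  shows "quad_form G u \<le> s_max G"
proof -
  let ?B = "transpose_mat G * G"
  define mu where "mu = (SUP u\<in>unit_sphere p. quad_form ?B u)"
  have u': "u \<in> carrier_vec p" "u \<bullet> u = 1" using u by (auto simp: unit_sphere_iff)
  have B: "?B \<in> carrier_mat p p" using G by simp
  have Bt: "transpose_mat ?B = ?B" using G by (simp add: transpose_mult[of _ p p _ p])
  have Gu: "G *\<^sub>v u \<in> carrier_vec p" using G u' by simp
  have qB: "quad_form ?B u = (G *\<^sub>v u) \<bullet> (G *\<^sub>v u)"
  proof -
    have "quad_form ?B u = u \<bullet> (transpose_mat G *\<^sub>v (G *\<^sub>v u))"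
      unfolding quad_form_def using G u' by (simp add: assoc_mult_mat_vec[of _ p p _ p])
    also have "\<dots> = (transpose_mat G *\<^sub>v (G *\<^sub>v u)) \<bullet> u"
      using G u' Gu by (intro comm_scalar_prod[of _ p]) auto
    also have "\<dots> = (G *\<^sub>v u) \<bullet> (G *\<^sub>v u)" by (rule transpose_vec_mult_scalar[OF G u'(1) Gu])
    finally show ?thesis .
  qed
  have "(u \<bullet> (G *\<^sub>v u))\<^sup>2 \<le> ((G *\<^sub>v u) \<bullet> (G *\<^sub>v u)) * (u \<bullet> u)"
    by (rule nonneg_quadratic_discriminant)
       (metis scalar_prod_add_smult[OF Gu u'(1)] scalar_prod_self_nonneg, simp add: u')
  also have "\<dots> = quad_form ?B u" using qB u' by simp
  also have "\<dots> \<le> mu"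
    unfolding mu_def
  proof (rule cSUP_upper[OF u])
    show "bdd_above (quad_form ?B ` unit_sphere p)"
      using quad_form_unit_bounded[OF B] by (intro bdd_aboveI2[of _ _ "\<Sum>i<p. \<Sum>j<p. \<bar>?B $$ (i, j)\<bar>"]) (auto dest: abs_le_D1)
  qed
  finally have "quad_form G u \<le> sqrt mu" unfolding quad_form_def by (rule real_le_rsqrt)
  also have "\<dots> \<le> s_max G"
    unfolding s_max_def
  proof (rule Max_ge)
    show "finite (singular_values G)"
      unfolding singular_values_def using card_finite_spectrum(1)[OF B] by (simp add: spectrum_def)
    show "sqrt mu \<in> singular_values G"
      unfolding singular_values_def mu_def using Sup_quad_form_is_eigenvalue[OF B Bt p] by simp
  qed
  finally show ?thesis .
qed

section \<open>Elliptical laws and mixtures\<close>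

text \<open>
  An image measure either keeps the total mass or is the zero measure, the latter being the default value
  when the map is not measurable. Applied to the sphere and to the product with the radial law, this finds
  the total mass of an elliptical law without computing any integral: it is \<open>0\<close> or \<open>1\<close>, and the median condition excludes \<open>0\<close>.
\<close>

lemma emeasure_distr_total:
  assumes "f \<in> space M \<rightarrow> space N"
  shows "emeasure (distr M N f) (space N) = emeasure M (space M) \<or> (\<forall>A. emeasure (distr M N f) A = 0)"
proof -
  have "f -` space N \<inter> space M = space M" using assms by auto
  then show ?thesis
    unfolding distr_def emeasure_measure_of_conv
    by (auto intro: sigma_sets_top)
qed

lemma sets_lborel_vec [simp]: "sets (lborel_vec p) = sets (borel_vec p)"
  unfolding lborel_vec_def by simp

lemma space_lborel_vec [simp]: "space (lborel_vec p) = carrier_vec p"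
  unfolding lborel_vec_def by simp

lemma space_uniform_sphere: "space (uniform_sphere r) = carrier_vec r"
  unfolding uniform_sphere_def by simp

text \<open>
  The uniform measure on the ball has total mass \<open>a / a\<close> for \<open>a\<close> the volume of the ball, and this
  quotient is \<open>0\<close> or \<open>1\<close> for every extended nonnegative \<open>a\<close>.
\<close>

lemma emeasure_uniform_sphere_total:
  "emeasure (uniform_sphere r) (carrier_vec r) \<in> {0, 1}"
proof -
  let ?B = "{v \<in> carrier_vec r. vec_norm2 v \<le> 1}"
  have "(\<lambda>v. \<Sum>i<r. v $ i * v $ i) \<in> borel_measurable (borel_vec r)"
    by (intro borel_measurable_sum borel_measurable_times borel_measurable_coordinate) auto
  then have "{v \<in> space (borel_vec r). (\<Sum>i<r. v $ i * v $ i) \<le> 1} \<in> sets (borel_vec r)"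
    by (rule borel_measurable_le) simp
  also have "{v \<in> space (borel_vec r). (\<Sum>i<r. v $ i * v $ i) \<le> 1} = ?B"
    by (auto simp: vec_norm2_def scalar_prod_def lessThan_atLeast0)
  finally have B: "?B \<in> sets (lborel_vec r)" by simp
  let ?U = "uniform_measure (lborel_vec r) ?B"
  have sp: "space ?U = carrier_vec r" by simp
  have "emeasure ?U (carrier_vec r) = emeasure (lborel_vec r) (?B \<inter> carrier_vec r) / emeasure (lborel_vec r) ?B"
    using B by (intro emeasure_uniform_measure) (auto intro: sets.top[of "lborel_vec r", simplified])
  also have "?B \<inter> carrier_vec r = ?B" by auto
  also have "emeasure (lborel_vec r) ?B / emeasure (lborel_vec r) ?B \<in> {0, 1}"
  proof -
    have "a / a \<in> {0, 1}" for a :: ennreal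
      by (cases "a = 0"; cases "a = \<infinity>") (auto simp: ennreal_divide_self less_top[symmetric])
    then show ?thesis .
  qed
  finally have U: "emeasure ?U (space ?U) \<in> {0, 1}" using sp by simp
  have "emeasure (distr ?U (borel_vec r) (\<lambda>v. (1 / vec_norm2 v) \<cdot>\<^sub>v v)) (space (borel_vec r)) = emeasure ?U (space ?U)
      \<or> (\<forall>A. emeasure (distr ?U (borel_vec r) (\<lambda>v. (1 / vec_norm2 v) \<cdot>\<^sub>v v)) A = 0)"
    by (rule emeasure_distr_total) auto
  then show ?thesis
    using U unfolding uniform_sphere_def[symmetric] by auto
qed

lemma canonical_elliptical_prob_space:
  assumes P: "canonical_elliptical p G \<eta> P" and p: "1 \<le> p"
  shows "prob_space P" "sets P = sets (borel_vec p)"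
proof -
  obtain r A where \<eta>: "prob_space \<eta>" and A: "A \<in> carrier_mat p r"
    and Pd: "P = distr (\<eta> \<Otimes>\<^sub>M uniform_sphere r) (borel_vec p) (\<lambda>(s, v). s \<cdot>\<^sub>v (A *\<^sub>v v))"
    using P unfolding canonical_elliptical_def elliptical_def by auto
  show sP: "sets P = sets (borel_vec p)" unfolding Pd by simp
  have spP: "space P = carrier_vec p" unfolding Pd by simp
  interpret E: prob_space \<eta> by fact
  interpret U: finite_measure "uniform_sphere r"
    using emeasure_uniform_sphere_total[of r] by (intro finite_measureI) (auto simp: space_uniform_sphere)
  have "emeasure (\<eta> \<Otimes>\<^sub>M uniform_sphere r) (space (\<eta> \<Otimes>\<^sub>M uniform_sphere r))
      = emeasure \<eta> (space \<eta>) * emeasure (uniform_sphere r) (space (uniform_sphere r))"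
    unfolding space_pair_measure by (rule U.emeasure_pair_measure_Times) auto
  also have "\<dots> \<in> {0, 1}"
    using emeasure_uniform_sphere_total[of r] by (simp add: E.emeasure_space_1 space_uniform_sphere)
  finally have tot: "emeasure (\<eta> \<Otimes>\<^sub>M uniform_sphere r) (space (\<eta> \<Otimes>\<^sub>M uniform_sphere r)) \<in> {0, 1}" .
  have "emeasure P (space P) = emeasure (\<eta> \<Otimes>\<^sub>M uniform_sphere r) (space (\<eta> \<Otimes>\<^sub>M uniform_sphere r)) \<or> (\<forall>A. emeasure P A = 0)"
    unfolding Pd space_distr by (rule emeasure_distr_total) (use A in \<open>auto simp: mult_mat_vec_def\<close>)
  then have P01: "emeasure P (space P) \<in> {0, 1}" using tot by auto
  obtain u where "u \<in> unit_sphere p" using unit_sphere_nonempty[OF p] by blast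
  then have half: "marginal_cdf G P u 1 = 1 / 2" using P unfolding canonical_elliptical_def by blast
  have "emeasure P (space P) \<noteq> 0"
  proof
    assume "emeasure P (space P) = 0"
    then have "emeasure P {x \<in> space P. \<bar>u \<bullet> x\<bar>\<^sup>2 / quad_form G u \<le> 1} = 0"
      using emeasure_space[of P "{x \<in> space P. \<bar>u \<bullet> x\<bar>\<^sup>2 / quad_form G u \<le> 1}"] by simp
    then show False using half unfolding marginal_cdf_def measure_def by simp
  qed
  then show "prob_space P" using P01 by (intro prob_spaceI) auto
qed

lemma contaminated_mixture:
  assumes P: "prob_space P" and Q: "prob_space Q" "sets Q = sets P" and e: "0 \<le> \<epsilon>" "\<epsilon> \<le> 1"
  shows "prob_space (contaminated \<epsilon> P Q)" "sets (contaminated \<epsilon> P Q) = sets P"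
    "\<And>A. A \<in> sets P \<Longrightarrow> measure (contaminated \<epsilon> P Q) A = (1 - \<epsilon>) * measure P A + \<epsilon> * measure Q A"
proof -
  interpret P: prob_space P by fact
  interpret Q: prob_space Q by fact
  let ?N = "contaminated \<epsilon> P Q"
  show sN: "sets ?N = sets P" unfolding contaminated_def by simp
  have spN: "space ?N = space P" using sN by (rule sets_eq_imp_space_eq)
  have spQ: "space Q = space P" using Q(2) by (rule sets_eq_imp_space_eq)
  have em: "emeasure ?N A = ennreal (1 - \<epsilon>) * emeasure P A + ennreal \<epsilon> * emeasure Q A" if A: "A \<in> sets P" for A
    unfolding contaminated_def
  proof (rule emeasure_measure_of_sigma[OF sets.sigma_algebra_axioms _ _ A])
    show "positive (sets P) (\<lambda>A. ennreal (1 - \<epsilon>) * emeasure P A + ennreal \<epsilon> * emeasure Q A)"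
      by (simp add: positive_def)
    show "countably_additive (sets P) (\<lambda>A. ennreal (1 - \<epsilon>) * emeasure P A + ennreal \<epsilon> * emeasure Q A)"
    proof (rule countably_additiveI)
      fix F :: "nat \<Rightarrow> 'a set" assume F: "range F \<subseteq> sets P" "disjoint_family F"
      have "(\<Sum>i. ennreal (1 - \<epsilon>) * emeasure P (F i) + ennreal \<epsilon> * emeasure Q (F i))
          = (\<Sum>i. ennreal (1 - \<epsilon>) * emeasure P (F i)) + (\<Sum>i. ennreal \<epsilon> * emeasure Q (F i))"
        by (rule suminf_add[symmetric]) auto
      also have "\<dots> = ennreal (1 - \<epsilon>) * (\<Sum>i. emeasure P (F i)) + ennreal \<epsilon> * (\<Sum>i. emeasure Q (F i))"
        by (simp only: ennreal_suminf_cmult)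
      also have "(\<Sum>i. emeasure P (F i)) = emeasure P (\<Union>i. F i)" using F by (rule suminf_emeasure)
      also have "(\<Sum>i. emeasure Q (F i)) = emeasure Q (\<Union>i. F i)" using F Q(2) by (intro suminf_emeasure) auto
      finally show "(\<Sum>i. ennreal (1 - \<epsilon>) * emeasure P (F i) + ennreal \<epsilon> * emeasure Q (F i))
          = ennreal (1 - \<epsilon>) * emeasure P (\<Union>i. F i) + ennreal \<epsilon> * emeasure Q (\<Union>i. F i)" .
    qed
  qed
  have real_em: "emeasure ?N A = ennreal ((1 - \<epsilon>) * measure P A + \<epsilon> * measure Q A)" if A: "A \<in> sets P" for A
    unfolding em[OF A] P.emeasure_eq_measure Q.emeasure_eq_measure using e
    by (simp add: ennreal_mult[symmetric] ennreal_plus[symmetric] del: ennreal_plus)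
  show "measure ?N A = (1 - \<epsilon>) * measure P A + \<epsilon> * measure Q A" if A: "A \<in> sets P" for A
    unfolding measure_def[of ?N] real_em[OF A] using e by (intro enn2real_ennreal) simp
  show "prob_space ?N"
  proof (rule prob_spaceI)
    have "measure P (space P) = 1" "measure Q (space P) = 1"
      using P.prob_space Q.prob_space spQ by auto
    then show "emeasure ?N (space ?N) = 1"
      unfolding spN real_em[OF sets.top] by simp
  qed
qed

section \<open>Slabs\<close>

definition slab_le :: "nat \<Rightarrow> real vec \<Rightarrow> real \<Rightarrow> real vec set" where
  "slab_le p u T = {x \<in> carrier_vec p. \<bar>u \<bullet> x\<bar>\<^sup>2 \<le> T}"

definition slab_ge :: "nat \<Rightarrow> real vec \<Rightarrow> real \<Rightarrow> real vec set" where
  "slab_ge p u T = {x \<in> carrier_vec p. T \<le> \<bar>u \<bullet> x\<bar>\<^sup>2}"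

lemma sets_slab: "slab_le p u T \<in> sets (borel_vec p)" "slab_ge p u T \<in> sets (borel_vec p)"
proof -
  have "(\<lambda>x. \<bar>u \<bullet> x\<bar>\<^sup>2) \<in> borel_measurable (borel_vec p)"
    by (intro borel_measurable_power borel_measurable_abs borel_measurable_scalar_prod)
  note f = this
  have "{x \<in> space (borel_vec p). \<bar>u \<bullet> x\<bar>\<^sup>2 \<le> T} \<in> sets (borel_vec p)"
    by (rule borel_measurable_le[OF f]) simp
  moreover have "{x \<in> space (borel_vec p). T \<le> \<bar>u \<bullet> x\<bar>\<^sup>2} \<in> sets (borel_vec p)"
    by (rule borel_measurable_le[OF _ f]) simp
  ultimately show "slab_le p u T \<in> sets (borel_vec p)" "slab_ge p u T \<in> sets (borel_vec p)"
    unfolding slab_le_def slab_ge_def space_borel_vec .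
qed

lemma indicator_slab_le:
  assumes "0 \<le> T" "u \<in> carrier_vec p" "x \<in> carrier_vec p"
  shows "indicator (slab_le p u T) x = indicator (halfspace p u (sqrt T)) x + indicator (halfspace p (- u) (sqrt T)) x - (1 :: real)"
proof -
  have "\<bar>u \<bullet> x\<bar>\<^sup>2 \<le> T \<longleftrightarrow> \<bar>u \<bullet> x\<bar> \<le> sqrt T"
    using real_sqrt_le_iff[of "\<bar>u \<bullet> x\<bar>\<^sup>2" T] by simp
  then have iff: "\<bar>u \<bullet> x\<bar>\<^sup>2 \<le> T \<longleftrightarrow> u \<bullet> x \<le> sqrt T \<and> - (u \<bullet> x) \<le> sqrt T" by linarith
  have "0 \<le> sqrt T" using assms by simp
  then have or: "u \<bullet> x \<le> sqrt T \<or> - (u \<bullet> x) \<le> sqrt T" by linarith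
  have neg: "(- u) \<bullet> x = - (u \<bullet> x)" using assms by simp
  show ?thesis
    unfolding slab_le_def halfspace_def indicator_def mem_Collect_eq iff neg
    using or assms(3) by (cases "u \<bullet> x \<le> sqrt T"; cases "- (u \<bullet> x) \<le> sqrt T") simp_all
qed

lemma indicator_slab_ge:
  assumes "0 < T" "u \<in> carrier_vec p" "x \<in> carrier_vec p"
  shows "indicator (slab_ge p u T) x = indicator (halfspace p u (- sqrt T)) x + (indicator (halfspace p (- u) (- sqrt T)) x :: real)"
proof -
  have "T \<le> \<bar>u \<bullet> x\<bar>\<^sup>2 \<longleftrightarrow> sqrt T \<le> \<bar>u \<bullet> x\<bar>"
    using real_sqrt_le_iff[of T "\<bar>u \<bullet> x\<bar>\<^sup>2"] by simp
  then have iff: "T \<le> \<bar>u \<bullet> x\<bar>\<^sup>2 \<longleftrightarrow> u \<bullet> x \<le> - sqrt T \<or> - (u \<bullet> x) \<le> - sqrt T" by linarith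
  have "0 < sqrt T" using assms by simp
  then have or: "\<not> (u \<bullet> x \<le> - sqrt T \<and> - (u \<bullet> x) \<le> - sqrt T)" by linarith
  have neg: "(- u) \<bullet> x = - (u \<bullet> x)" using assms by simp
  show ?thesis
    unfolding slab_ge_def halfspace_def indicator_def mem_Collect_eq iff neg
    using or assms(3) by (cases "u \<bullet> x \<le> - sqrt T"; cases "- (u \<bullet> x) \<le> - sqrt T") simp_all
qed

text \<open>
  Linear relations between indicators pass to probabilities; this reduces slabs to halfspaces.
\<close>

lemma measure_combination:
  assumes N: "prob_space N" "sets N = sets (borel_vec p)"
    and m: "A \<in> sets (borel_vec p)" "B \<in> sets (borel_vec p)" "C \<in> sets (borel_vec p)"
    and eq: "\<And>x. x \<in> carrier_vec p \<Longrightarrow> indicator A x = indicator B x + indicator C x - (c :: real)"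
  shows "measure N A = measure N B + measure N C - c"
proof -
  interpret prob_space N by fact
  have sp: "space N = carrier_vec p" using sets_eq_imp_space_eq[OF N(2)] by simp
  have m': "A \<in> sets N" "B \<in> sets N" "C \<in> sets N" using m N(2) by auto
  have ind: "expectation (indicator D) = measure N D" if "D \<in> sets N" for D
    using that by (simp add: Int_absorb2 sets.sets_into_space)
  have int: "integrable N (indicator D :: _ \<Rightarrow> real)" if "D \<in> sets N" for D
    using that by (simp add: emeasure_eq_measure)
  have "measure N A = expectation (indicator A)" using ind m' by simp
  also have "\<dots> = expectation (\<lambda>x. indicator B x + indicator C x - c)"
    using eq sp by (intro Bochner_Integration.integral_cong) auto
  also have "\<dots> = expectation (indicator B) + expectation (indicator C) - c"
    using int m' by (simp add: prob_space)
  finally show ?thesis using ind m' by simp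
qed

text \<open>
  A slab costs two halfspaces, hence the factor \<open>2\<close>.
\<close>

lemma slab_deviation:
  assumes N: "prob_space N" "sets N = sets (borel_vec p)" and n: "1 \<le> n"
    and X: "X \<in> space (PiM {..<n} (\<lambda>_. N))" "X \<notin> bad_sample n N (rational_halfspaces p l m) S"
    and u: "u \<in> block_vecs p l m"
  shows "0 \<le> T \<Longrightarrow> \<bar>1 / real n * (\<Sum>i<n. of_bool (\<bar>u \<bullet> X i\<bar>\<^sup>2 \<le> T)) - measure N (slab_le p u T)\<bar> \<le> 2 * S / real n"
    and "0 < T \<Longrightarrow> \<bar>1 / real n * (\<Sum>i<n. of_bool (\<bar>u \<bullet> X i\<bar>\<^sup>2 \<ge> T)) - measure N (slab_ge p u T)\<bar> \<le> 2 * S / real n"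
proof -
  have uc: "u \<in> carrier_vec p" and mu: "- u \<in> block_vecs p l m" using u by (auto simp: block_vecs_def)
  have Xc: "X i \<in> carrier_vec p" if "i < n" for i
    using X(1) that sets_eq_imp_space_eq[OF N(2)] by (auto simp: space_PiM)
  have comb: "\<bar>1 / real n * a - b\<bar> \<le> 2 * S / real n"
    if "\<bar>a1 - real n * b1\<bar> \<le> S" "\<bar>a2 - real n * b2\<bar> \<le> S" "a = a1 + a2 - real n * c" "b = b1 + b2 - c" for a b a1 a2 b1 b2 c
  proof -
    have "1 / real n * a - b = ((a1 - real n * b1) + (a2 - real n * b2)) / real n"
      unfolding that(3,4) using n by (simp add: field_simps)
    also have "\<bar>\<dots>\<bar> = \<bar>(a1 - real n * b1) + (a2 - real n * b2)\<bar> / real n" by simp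
    also have "\<dots> \<le> 2 * S / real n" using that(1,2) by (intro divide_right_mono) auto
    finally show ?thesis .
  qed
  show "\<bar>1 / real n * (\<Sum>i<n. of_bool (\<bar>u \<bullet> X i\<bar>\<^sup>2 \<le> T)) - measure N (slab_le p u T)\<bar> \<le> 2 * S / real n" if T: "0 \<le> T"
  proof (rule comb[OF block_halfspace_deviation[OF N X u] block_halfspace_deviation[OF N X mu]])
    have "(\<Sum>i<n. of_bool (\<bar>u \<bullet> X i\<bar>\<^sup>2 \<le> T)) = (\<Sum>i<n. indicator (slab_le p u T) (X i) :: real)"
      by (rule sum.cong[OF refl]) (simp add: Xc slab_le_def indicator_def)
    also have "\<dots> = (\<Sum>i<n. indicator (halfspace p u (sqrt T)) (X i) + indicator (halfspace p (- u) (sqrt T)) (X i) - 1)"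
      by (rule sum.cong[OF refl], rule indicator_slab_le[OF T uc]) (simp add: Xc)
    finally show "(\<Sum>i<n. of_bool (\<bar>u \<bullet> X i\<bar>\<^sup>2 \<le> T)) = (\<Sum>i<n. indicator (halfspace p u (sqrt T)) (X i))
        + (\<Sum>i<n. indicator (halfspace p (- u) (sqrt T)) (X i)) - real n * 1"
      by (simp add: sum.distrib sum_subtractf)
    show "measure N (slab_le p u T) = measure N (halfspace p u (sqrt T)) + measure N (halfspace p (- u) (sqrt T)) - 1"
      using indicator_slab_le[OF T uc] by (intro measure_combination[OF N] sets_slab sets_halfspace)
  qed
  show "\<bar>1 / real n * (\<Sum>i<n. of_bool (\<bar>u \<bullet> X i\<bar>\<^sup>2 \<ge> T)) - measure N (slab_ge p u T)\<bar> \<le> 2 * S / real n" if T: "0 < T"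
  proof (rule comb[OF block_halfspace_deviation[OF N X u] block_halfspace_deviation[OF N X mu]])
    have "(\<Sum>i<n. of_bool (\<bar>u \<bullet> X i\<bar>\<^sup>2 \<ge> T)) = (\<Sum>i<n. indicator (slab_ge p u T) (X i) :: real)"
      by (rule sum.cong[OF refl]) (simp add: Xc slab_ge_def indicator_def)
    also have "\<dots> = (\<Sum>i<n. indicator (halfspace p u (- sqrt T)) (X i) + indicator (halfspace p (- u) (- sqrt T)) (X i))"
      by (rule sum.cong[OF refl], rule indicator_slab_ge[OF T uc]) (simp add: Xc)
    finally show "(\<Sum>i<n. of_bool (\<bar>u \<bullet> X i\<bar>\<^sup>2 \<ge> T)) = (\<Sum>i<n. indicator (halfspace p u (- sqrt T)) (X i))
        + (\<Sum>i<n. indicator (halfspace p (- u) (- sqrt T)) (X i)) - real n * 0"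
      by (simp add: sum.distrib)
    show "measure N (slab_ge p u T) = measure N (halfspace p u (- sqrt T)) + measure N (halfspace p (- u) (- sqrt T)) - 0"
      using indicator_slab_ge[OF T uc] by (intro measure_combination[OF N] sets_slab sets_halfspace) simp
  qed
qed

text \<open>
  For \<open>2k > p\<close> the truncated difference \<open>p - 2k\<close> is \<open>0\<close>, and the only block is everything.
\<close>

lemma directions_eq_blocks: "directions p k = (\<Union>l\<in>{0..p - 2 * k}. block_directions p l (2 * k))"
  unfolding directions_def by (auto simp: block_directions_def)

section \<open>Maximisers of the depth\<close>

text \<open>
  A change \<open>e < \<tau>\<close> of the distribution function is too small for \<open>\<bar>t\<bar> \<ge> \<alpha>\<close>, and for
  smaller \<open>t\<close> the function grows with slope at least \<open>1 / \<surd>\<kappa>\<close> away from its median.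
\<close>

lemma marginal_condition_gap:
  assumes mc: "marginal_condition p \<tau> \<alpha> \<kappa> G P" and u: "u \<in> unit_sphere p" and k: "0 < \<kappa>"
    and gap: "\<bar>marginal_cdf G P u 1 - marginal_cdf G P u (1 + t)\<bar> \<le> e" and e: "e < \<tau>" and t: "t \<noteq> 0"
  shows "\<bar>t\<bar> \<le> e * sqrt \<kappa>"
proof -
  define F where "F = marginal_cdf G P u"
  have inf1: "\<tau> \<le> (INF t \<in> {t. \<alpha> \<le> \<bar>t\<bar>}. \<bar>F 1 - F (1 + t)\<bar>)"
    and inf2: "\<kappa> powr (- 1 / 2) \<le> (INF t \<in> {t. 0 < \<bar>t\<bar> \<and> \<bar>t\<bar> < \<alpha>}. \<bar>F 1 - F (1 + t)\<bar> / \<bar>t\<bar>)"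
    using mc u unfolding marginal_condition_def Let_def F_def by auto
  have near: "\<bar>t\<bar> < \<alpha>"
  proof (rule ccontr)
    assume "\<not> \<bar>t\<bar> < \<alpha>"
    then have "(INF t \<in> {t. \<alpha> \<le> \<bar>t\<bar>}. \<bar>F 1 - F (1 + t)\<bar>) \<le> \<bar>F 1 - F (1 + t)\<bar>"
      by (intro cINF_lower bdd_belowI2[of _ 0]) auto
    then show False using inf1 gap e by (simp add: F_def)
  qed
  have "(INF t \<in> {t. 0 < \<bar>t\<bar> \<and> \<bar>t\<bar> < \<alpha>}. \<bar>F 1 - F (1 + t)\<bar> / \<bar>t\<bar>) \<le> \<bar>F 1 - F (1 + t)\<bar> / \<bar>t\<bar>"
    using near t by (intro cINF_lower bdd_belowI2[of _ 0]) auto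
  then have "\<kappa> powr (- 1 / 2) \<le> \<bar>F 1 - F (1 + t)\<bar> / \<bar>t\<bar>" using inf2 by linarith
  also have "\<dots> \<le> e / \<bar>t\<bar>" using gap by (intro divide_right_mono) (auto simp: F_def)
  also have "\<kappa> powr (- 1 / 2) = 1 / sqrt \<kappa>"
    using k by (simp add: powr_minus_divide powr_half_sqrt)
  finally show ?thesis using k t by (simp add: field_simps)
qed

lemma marginal_cdf_eq_slab:
  assumes "space P = carrier_vec p" "0 < quad_form G u"
  shows "marginal_cdf G P u t = measure P (slab_le p u (t * quad_form G u))"
  unfolding marginal_cdf_def slab_le_def using assms by (simp add: divide_le_eq)

lemma depth_value_finite:
  "finite ((\<lambda>u. min (1 / real n * (\<Sum>i<n. of_bool (\<bar>u \<bullet> X i\<bar>\<^sup>2 \<le> quad_form G u)))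
         (1 / real n * (\<Sum>i<n. of_bool (\<bar>u \<bullet> X i\<bar>\<^sup>2 \<ge> quad_form G u)))) ` U)"
proof (rule finite_subset)
  have cnt: "(\<Sum>i<n. of_bool (Q i)) \<in> real ` {..n}" for Q
  proof -
    have "(\<Sum>i<n. of_bool (Q i)) = real (card {i\<in>{..<n}. Q i})"
      by (simp add: of_bool_def sum.If_cases Int_def)
    moreover have "card {i\<in>{..<n}. Q i} \<le> n"
      using card_mono[of "{..<n}" "{i\<in>{..<n}. Q i}"] by auto
    ultimately show ?thesis by auto
  qed
  show "(\<lambda>u. min (1 / real n * (\<Sum>i<n. of_bool (\<bar>u \<bullet> X i\<bar>\<^sup>2 \<le> quad_form G u)))
         (1 / real n * (\<Sum>i<n. of_bool (\<bar>u \<bullet> X i\<bar>\<^sup>2 \<ge> quad_form G u)))) ` U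
      \<subseteq> (\<lambda>a. 1 / real n * a) ` real ` {..n}"
    using cnt by (auto simp: min_def)
qed simp

lemma le_matrix_depth_iff:
  assumes "U \<noteq> {}"
  shows "c \<le> matrix_depth U n X G \<longleftrightarrow> (\<forall>u\<in>U.
     c \<le> 1 / real n * (\<Sum>i<n. of_bool (\<bar>u \<bullet> X i\<bar>\<^sup>2 \<le> quad_form G u)) \<and>
     c \<le> 1 / real n * (\<Sum>i<n. of_bool (\<bar>u \<bullet> X i\<bar>\<^sup>2 \<ge> quad_form G u)))"
  unfolding matrix_depth_def using assms depth_value_finite[of n X G U]
  by (subst Min_ge_iff) auto

text \<open>
  Write \<open>h = (1 + t) quad_form G u\<close>. For \<open>t < 0\<close> the first slab bounds \<open>G 1 - G (1 + t)\<close>. For \<open>t > 0\<close>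
  the second slab bounds the distribution function from above only strictly below \<open>1 + t\<close>, where it
  might jump; the bound is therefore obtained for all \<open>t' < t\<close> and then in the limit.
\<close>

lemma quad_form_deviation:
  assumes P: "prob_space P" "sets P = sets (borel_vec p)"
    and mc: "marginal_condition p \<tau> \<alpha> \<kappa> G P" and half: "marginal_cdf G P u 1 = 1 / 2"
    and u: "u \<in> unit_sphere p" and k: "0 < \<kappa>"
    and g: "0 < quad_form G u" "quad_form G u \<le> M" and e: "0 \<le> e" "e < \<tau>"
    and lo: "1 / 2 - e \<le> measure P (slab_le p u h)"
    and hi: "0 < h \<Longrightarrow> 1 / 2 - e \<le> measure P (slab_ge p u h)"
  shows "\<bar>h - quad_form G u\<bar> \<le> M * e * sqrt \<kappa>"
proof -
  interpret prob_space P by fact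
  have sp: "space P = carrier_vec p" using sets_eq_imp_space_eq[OF P(2)] by simp
  define q where "q = quad_form G u"
  define t where "t = h / q - 1"
  have q: "0 < q" "q \<le> M" using g by (auto simp: q_def)
  have h_eq: "h = (1 + t) * q" using q by (simp add: t_def)
  define F where "F = marginal_cdf G P u"
  have F: "F t = measure P (slab_le p u (t * q))" for t
    unfolding F_def q_def by (rule marginal_cdf_eq_slab[OF sp g(1)])
  have mono: "F a \<le> F b" if "a \<le> b" for a b
  proof -
    have "a * q \<le> b * q" using that q by simp
    then have "slab_le p u (a * q) \<subseteq> slab_le p u (b * q)" by (auto simp: slab_le_def)
    then show ?thesis unfolding F using sets_slab P(2) by (intro finite_measure_mono) auto
  qed
  have gap: "\<bar>t'\<bar> \<le> e * sqrt \<kappa>" if "t' \<noteq> 0" "\<bar>F 1 - F (1 + t')\<bar> \<le> e" for t'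
    using marginal_condition_gap[OF mc u k _ e(2), of t'] that unfolding F_def by simp
  have "\<bar>t\<bar> \<le> e * sqrt \<kappa>"
  proof (cases t "0 :: real" rule: linorder_cases)
    case less
    have "F (1 + t) \<le> F 1" using less by (intro mono) simp
    moreover have "1 / 2 - e \<le> F (1 + t)" using lo unfolding F h_eq .
    ultimately show ?thesis using less half by (intro gap) (auto simp: F_def)
  next
    case equal
    then show ?thesis using e k by simp
  next
    case greater
    have "t' \<le> e * sqrt \<kappa>" if t': "0 < t'" "t' < t" for t'
    proof -
      have lt: "(1 + t') * q < h" unfolding h_eq using t' q by simp
      have "0 < (1 + t') * q" using t' q by simp
      then have h0: "0 < h" using lt by linarith
      have dis: "slab_ge p u h \<inter> slab_le p u ((1 + t') * q) = {}"
        using lt by (auto simp: slab_ge_def slab_le_def)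
      have "measure P (slab_ge p u h) + measure P (slab_le p u ((1 + t') * q))
          = measure P (slab_ge p u h \<union> slab_le p u ((1 + t') * q))"
        using sets_slab P(2) dis by (intro finite_measure_Union[symmetric]) auto
      also have "\<dots> \<le> 1" by (rule prob_le_1)
      finally have "F (1 + t') \<le> 1 / 2 + e" using hi[OF h0] unfolding F by linarith
      moreover have "F 1 \<le> F (1 + t')" using t' by (intro mono) simp
      ultimately have "\<bar>t'\<bar> \<le> e * sqrt \<kappa>" using t' half by (intro gap) (auto simp: F_def)
      then show ?thesis by simp
    qed
    then have "t \<le> e * sqrt \<kappa>" using greater by (intro dense_le_bounded[of 0 t]) auto
    then show ?thesis using greater by simp
  qed
  then have "q * \<bar>t\<bar> \<le> M * (e * sqrt \<kappa>)"
    using q by (intro mult_mono) auto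
  moreover have "h - q = q * t" by (simp add: h_eq algebra_simps)
  ultimately show ?thesis using q unfolding q_def[symmetric] by (simp add: abs_mult mult.assoc)
qed

text \<open>
  The deterministic core. Contamination moves a probability from \<open>P A\<close> to at least \<open>(1 - \<epsilon>) P A\<close> and at
  most \<open>(1 - \<epsilon>) P A + \<epsilon>\<close>. The lower bound is applied at \<open>G\<close> and the upper bound at \<open>H\<close>, so that two
  sampling errors and one \<open>\<epsilon>\<close> accumulate before division by \<open>1 - \<epsilon>\<close>.
\<close>

lemma depth_maximiser_close:
  assumes p: "1 \<le> p" and k: "1 \<le> k" and kap: "0 < \<kappa>"
    and eps: "0 \<le> \<epsilon>" "\<epsilon> < 1" and Del: "0 \<le> \<Delta>" "(2 * \<Delta> + \<epsilon>) / (1 - \<epsilon>) < \<tau>"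
    and P: "prob_space P" "sets P = sets (borel_vec p)" and Q: "prob_space Q" "sets Q = sets (borel_vec p)"
    and G: "G \<in> banded_bounded p k M"
    and half: "\<And>u. u \<in> unit_sphere p \<Longrightarrow> marginal_cdf G P u 1 = 1 / 2"
    and mc: "marginal_condition p \<tau> \<alpha> \<kappa> G P"
    and best: "is_arg_max (matrix_depth (directions p k) n X) (\<lambda>\<Gamma>. \<Gamma> \<in> banded p k) H"
    and dev_le: "\<And>u T. u \<in> directions p k \<Longrightarrow> 0 \<le> T \<Longrightarrow>
        \<bar>1 / real n * (\<Sum>i<n. of_bool (\<bar>u \<bullet> X i\<bar>\<^sup>2 \<le> T)) - measure (contaminated \<epsilon> P Q) (slab_le p u T)\<bar> \<le> \<Delta>"
    and dev_ge: "\<And>u T. u \<in> directions p k \<Longrightarrow> 0 < T \<Longrightarrow>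
        \<bar>1 / real n * (\<Sum>i<n. of_bool (\<bar>u \<bullet> X i\<bar>\<^sup>2 \<ge> T)) - measure (contaminated \<epsilon> P Q) (slab_ge p u T)\<bar> \<le> \<Delta>"
  shows "(op_norm (H - G))\<^sup>2 \<le> 9 * M\<^sup>2 * \<kappa> * ((2 * \<Delta> + \<epsilon>) / (1 - \<epsilon>))\<^sup>2"
proof -
  interpret P: prob_space P by fact
  interpret Q: prob_space Q by fact
  let ?N = "contaminated \<epsilon> P Q"
  define e where "e = (2 * \<Delta> + \<epsilon>) / (1 - \<epsilon>)"
  have e: "0 \<le> e" "e < \<tau>" "e * (1 - \<epsilon>) = 2 * \<Delta> + \<epsilon>" using eps Del by (auto simp: e_def)
  have sp: "space P = carrier_vec p" using sets_eq_imp_space_eq[OF P(2)] by simp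
  have N: "measure ?N A = (1 - \<epsilon>) * measure P A + \<epsilon> * measure Q A" if "A \<in> sets (borel_vec p)" for A
    using contaminated_mixture(3)[OF P(1) Q(1), of \<epsilon> A] P(2) Q(2) eps that by simp
  have Nlow: "(1 - \<epsilon>) * measure P A \<le> measure ?N A" if "A \<in> sets (borel_vec p)" for A
    unfolding N[OF that] using eps by simp
  have Nup: "measure ?N A \<le> (1 - \<epsilon>) * measure P A + \<epsilon>" if "A \<in> sets (borel_vec p)" for A
    unfolding N[OF that] using eps Q.prob_le_1[of A] mult_left_mono[of "measure Q A" 1 \<epsilon>] by simp
  have dsub: "directions p k \<subseteq> unit_sphere p"
    unfolding directions_eq_blocks by (auto simp: block_directions_def)
  have dne: "directions p k \<noteq> {}"
  proof -
    have "unit_vec p 0 \<in> block_directions p 0 (2 * k)"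
      using p k by (auto simp: block_directions_def unit_sphere_iff)
    then show ?thesis unfolding directions_eq_blocks by auto
  qed
  have Gb: "G \<in> banded p k" "s_max G \<le> M" using G by (auto simp: banded_bounded_def)
  have Hb: "H \<in> banded p k" using best by (simp add: is_arg_max_def)
  have Gc: "G \<in> carrier_mat p p" "transpose_mat G = G" and Hc: "H \<in> carrier_mat p p" "transpose_mat H = H"
    using Gb Hb by (auto simp: banded_def psd_def)
  have gpos: "0 < quad_form G u" if u: "u \<in> unit_sphere p" for u
  proof (rule ccontr)
    assume "\<not> 0 < quad_form G u"
    moreover have "0 \<le> quad_form G u" using Gb(1) u by (auto simp: banded_def psd_def unit_sphere_iff)
    ultimately have "quad_form G u = 0" by simp
    then have "marginal_cdf G P u 1 = 1" by (simp add: marginal_cdf_def P.prob_space)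
    then show False using half[OF u] by simp
  qed
  have gle: "quad_form G u \<le> M" if u: "u \<in> unit_sphere p" for u
    using quad_form_le_s_max[OF Gc(1) u p] Gb(2) by linarith
  have slabP: "measure P (slab_le p u (quad_form G u)) = 1 / 2" if u: "u \<in> unit_sphere p" for u
    using half[OF u] marginal_cdf_eq_slab[OF sp gpos[OF u], of 1] by simp
  define c where "c = (1 - \<epsilon>) / 2 - \<Delta>"
  have depthG: "c \<le> matrix_depth (directions p k) n X G"
    unfolding le_matrix_depth_iff[OF dne]
  proof (intro ballI conjI)
    fix u assume u: "u \<in> directions p k"
    then have us: "u \<in> unit_sphere p" using dsub by auto
    let ?g = "quad_form G u"
    show "c \<le> 1 / real n * (\<Sum>i<n. of_bool (\<bar>u \<bullet> X i\<bar>\<^sup>2 \<le> ?g))"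
    proof -
      have "(1 - \<epsilon>) * (1 / 2) \<le> measure ?N (slab_le p u ?g)"
        using Nlow[OF sets_slab(1), of u ?g] unfolding slabP[OF us] .
      then show ?thesis
        using dev_le[OF u less_imp_le[OF gpos[OF us]]] unfolding c_def by linarith
    qed
    have "space P \<subseteq> slab_le p u ?g \<union> slab_ge p u ?g" unfolding sp by (auto simp: slab_le_def slab_ge_def)
    then have "1 \<le> measure P (slab_le p u ?g \<union> slab_ge p u ?g)"
      using P.finite_measure_mono[of "space P" "slab_le p u ?g \<union> slab_ge p u ?g"] sets_slab P(2) P.prob_space by auto
    also have "\<dots> \<le> measure P (slab_le p u ?g) + measure P (slab_ge p u ?g)"
      using sets_slab P(2) by (intro measure_Un_le) auto
    finally have "1 / 2 \<le> measure P (slab_ge p u ?g)" using slabP[OF us] by simp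
    then have "(1 - \<epsilon>) * (1 / 2) \<le> (1 - \<epsilon>) * measure P (slab_ge p u ?g)" using eps by (intro mult_left_mono) auto
    then show "c \<le> 1 / real n * (\<Sum>i<n. of_bool (\<bar>u \<bullet> X i\<bar>\<^sup>2 \<ge> ?g))"
      using dev_ge[OF u gpos[OF us]] Nlow[OF sets_slab(2), of u ?g] unfolding c_def by linarith
  qed
  have "matrix_depth (directions p k) n X G \<le> matrix_depth (directions p k) n X H"
    using best Gb(1) unfolding is_arg_max_def by (auto simp: not_less)
  then have "c \<le> matrix_depth (directions p k) n X H" using depthG by linarith
  then have depthH: "c \<le> 1 / real n * (\<Sum>i<n. of_bool (\<bar>u \<bullet> X i\<bar>\<^sup>2 \<le> quad_form H u))"
      "c \<le> 1 / real n * (\<Sum>i<n. of_bool (\<bar>u \<bullet> X i\<bar>\<^sup>2 \<ge> quad_form H u))" if "u \<in> directions p k" for u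
    unfolding le_matrix_depth_iff[OF dne] using that by auto
  have transfer: "1 / 2 - e \<le> measure P A"
    if "A \<in> sets (borel_vec p)" "c \<le> a" "\<bar>a - measure ?N A\<bar> \<le> \<Delta>" for A a
  proof -
    have "c - \<Delta> \<le> (1 - \<epsilon>) * measure P A + \<epsilon>" using Nup[OF that(1)] that(2,3) by linarith
    then have "(1 - \<epsilon>) * (1 / 2 - e) \<le> (1 - \<epsilon>) * measure P A"
      using e(3) by (simp add: c_def algebra_simps)
    then show ?thesis using eps by simp
  qed
  have quad: "\<bar>quad_form H u - quad_form G u\<bar> \<le> M * e * sqrt \<kappa>" if u: "u \<in> directions p k" for u
  proof -
    have us: "u \<in> unit_sphere p" using u dsub by auto
    have h0: "0 \<le> quad_form H u" using Hb us by (auto simp: banded_def psd_def unit_sphere_iff)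
    show ?thesis
    proof (rule quad_form_deviation[OF P mc half[OF us] us kap gpos[OF us] gle[OF us] e(1,2)])
      show "1 / 2 - e \<le> measure P (slab_le p u (quad_form H u))"
        by (rule transfer[OF sets_slab(1) depthH(1)[OF u] dev_le[OF u h0]])
      show "1 / 2 - e \<le> measure P (slab_ge p u (quad_form H u))" if "0 < quad_form H u"
        by (rule transfer[OF sets_slab(2) depthH(2)[OF u] dev_ge[OF u that]])
    qed
  qed
  define s where "s = M * e * sqrt \<kappa>"
  let ?E = "H - G"
  have E: "?E \<in> carrier_mat p p" "transpose_mat ?E = ?E"
    using Gc Hc by (auto simp: transpose_minus[of _ p p])
  have qE: "quad_form ?E w = quad_form H w - quad_form G w" if "w \<in> carrier_vec p" for w
    using that Gc(1) Hc(1) by (simp add: quad_form_def minus_mult_distrib_mat_vec[of _ p p] scalar_prod_minus_distrib[of _ p])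
  have "\<bar>quad_form ?E w\<bar> \<le> 3 * s * (w \<bullet> w)" if w: "w \<in> carrier_vec p" for w
  proof (rule banded_quad_form_le[OF E(1) k _ _ w])
    fix i j assume "i < p" "j < p" "int k < \<bar>int i - int j\<bar>"
    then show "?E $$ (i, j) = 0" using Gb Hb Gc Hc by (auto simp: banded_def)
  next
    fix l and w :: "real vec" assume l: "l \<le> p - 2 * k" and w: "w \<in> carrier_vec p"
      and supp: "\<And>i. i < p \<Longrightarrow> i \<notin> {l..<l + 2 * k} \<Longrightarrow> w $ i = 0"
    show "\<bar>quad_form ?E w\<bar> \<le> s * (w \<bullet> w)"
    proof (cases "w \<bullet> w = 0")
      case True
      then have "(\<Sum>i<p. (w $ i)\<^sup>2) = 0" using scalar_prod_self_eq_sum[OF w] by simp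
      then have "w $ i = 0" if "i < p" for i using that by (simp add: sum_nonneg_eq_0_iff)
      then have "quad_form ?E w = 0" unfolding quad_form_eq_sum[OF E(1) w] by simp
      then show ?thesis using True by simp
    next
      case False
      define r where "r = vec_norm2 w"
      have r: "r\<^sup>2 = w \<bullet> w" "r \<noteq> 0" using False vec_norm2_square[of w] by (auto simp: r_def)
      have "(1 / r) \<cdot>\<^sub>v w \<in> unit_sphere p"
        using w r(2) unfolding unit_sphere_iff by (simp add: r(1)[symmetric] power2_eq_square)
      then have "(1 / r) \<cdot>\<^sub>v w \<in> block_directions p l (2 * k)"
        using supp w by (auto simp: block_directions_def)
      then have dir: "(1 / r) \<cdot>\<^sub>v w \<in> directions p k"
        unfolding directions_eq_blocks using l by auto
      have "\<bar>quad_form ?E ((1 / r) \<cdot>\<^sub>v w)\<bar> \<le> s"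
        using quad[OF dir] qE[of "(1 / r) \<cdot>\<^sub>v w"] w by (simp add: s_def)
      then have "\<bar>quad_form ?E w\<bar> / r\<^sup>2 \<le> s"
        unfolding quad_form_smult[OF E(1) w] by (simp add: abs_mult power_divide)
      moreover have "0 < r\<^sup>2" using r(2) by simp
      ultimately show ?thesis by (simp add: divide_le_eq r(1)[symmetric])
    qed
  qed
  then have op: "op_norm ?E \<le> 3 * s" "0 \<le> op_norm ?E"
    using op_norm_le_of_quad_form[OF E p] by auto
  then have "(op_norm ?E)\<^sup>2 \<le> (3 * s)\<^sup>2" by (intro power_mono)
  also have "\<dots> = 9 * M\<^sup>2 * \<kappa> * e\<^sup>2"
    using kap by (simp add: s_def power_mult_distrib algebra_simps)
  finally show ?thesis unfolding e_def .
qed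

text \<open>
  There are \<open>p - 2k + 1 \<le> p\<close> blocks, and each fails with probability at most \<open>8 exp (- L) = 2 \<delta> / p\<close>
  for \<open>L = ln 4 + ln p + ln (1/\<delta>)\<close>.
\<close>

lemma block_union_good_event:
  assumes N: "prob_space N" "sets N = sets (borel_vec p)" and p: "1 \<le> p" and k: "1 \<le> k" and n: "1 \<le> n"
    and d: "0 < \<delta>" "\<delta> < 1 / 2"
    and S: "S = 32 * sqrt (2 * real n * (4 * real (2 * k + 1) + (ln 4 + ln (real p) + ln (1 / \<delta>))))"
  shows "\<exists>E \<in> sets (PiM {..<n} (\<lambda>_. N)). 1 - 2 * \<delta> \<le> measure (PiM {..<n} (\<lambda>_. N)) E \<and>
     (\<forall>X\<in>E. \<forall>l\<le>p - 2 * k. X \<notin> bad_sample n N (rational_halfspaces p l (2 * k)) S)"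
proof -
  let ?R = "PiM {..<n} (\<lambda>_. N)"
  interpret R: prob_space ?R by (rule prob_space_PiM[OF N(1)])
  define L where "L = ln 4 + ln (real p) + ln (1 / \<delta>)"
  have sp: "space N = carrier_vec p" using sets_eq_imp_space_eq[OF N(2)] by simp
  have L2: "ln 2 \<le> L"
  proof -
    have "ln 2 \<le> ln (4::real)" "0 \<le> ln (real p)" "0 \<le> ln (1 / \<delta>)" using p d by (auto simp: ln_ge_zero)
    then show ?thesis unfolding L_def by linarith
  qed
  have eL: "8 * exp (- L) * real p = 2 * \<delta>"
    using p d by (simp add: L_def exp_minus exp_add ln_div exp_diff)
  let ?bad = "\<lambda>l. bad_sample n N (rational_halfspaces p l (2 * k)) S"
  have H: "countable (rational_halfspaces p l (2 * k))" "rational_halfspaces p l (2 * k) \<subseteq> sets N" for l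
    using rational_halfspaces_countable_measurable N(2) by auto
  have mbad: "?bad l \<in> sets ?R" for l using H by (rule sets_bad_sample)
  have pbad: "measure ?R (?bad l) \<le> 8 * exp (- L)" for l
    unfolding S L_def[symmetric]
  proof (rule vc_uniform_deviation[OF N(1) H n _ L2])
    fix m :: nat and x assume "\<And>i. i < m \<Longrightarrow> x i \<in> space N"
    then show "vc_at_most (2 * k + 1) ((\<lambda>h. {i\<in>{..<m}. x i \<in> h}) ` rational_halfspaces p l (2 * k))"
      by (intro vc_rational_halfspaces) (simp add: sp)
  qed simp
  let ?I = "{0..p - 2 * k}"
  let ?B = "\<Union>l\<in>?I. ?bad l"
  have mB: "?B \<in> sets ?R" using mbad by (intro sets.finite_UN) auto
  have "measure ?R ?B \<le> (\<Sum>l\<in>?I. measure ?R (?bad l))"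
    using mbad by (intro R.finite_measure_subadditive_finite) auto
  also have "\<dots> \<le> (\<Sum>l\<in>?I. 8 * exp (- L))" by (rule sum_mono) (rule pbad)
  also have "\<dots> = real (card ?I) * (8 * exp (- L))" by simp
  also have "\<dots> \<le> real p * (8 * exp (- L))"
    using p k by (intro mult_right_mono) auto
  also have "\<dots> = 2 * \<delta>" using eL by (simp add: mult.commute)
  finally have "1 - 2 * \<delta> \<le> measure ?R (space ?R - ?B)"
    unfolding R.prob_compl[OF mB] by simp
  then show ?thesis using mB by (intro bexI[of _ "space ?R - ?B"]) auto
qed

text \<open>
  For \<open>k \<ge> 1\<close> the radicand \<open>8k + 4 + ln 4 + ln p + ln (1/\<delta>)\<close> is at most \<open>14\<close> times
  \<open>k + ln p + ln (1/\<delta>)\<close>, and \<open>114688 = 64\<^sup>2 * 2 * 14\<close>.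
\<close>

lemma deviation_radius_bound:
  fixes n p k :: nat
  assumes n: "1 \<le> n" and p: "1 \<le> p" and k: "1 \<le> k" and d: "0 < \<delta>" "\<delta> < 1 / 2"
  defines "\<Delta> \<equiv> 2 * (32 * sqrt (2 * real n * (4 * real (2 * k + 1) + (ln 4 + ln (real p) + ln (1 / \<delta>))))) / real n"
  shows "0 \<le> \<Delta>" "\<Delta>\<^sup>2 \<le> 114688 * ((real k + ln (real p) + ln (1 / \<delta>)) / real n)"
proof -
  have l: "0 \<le> ln (4::real)" "0 \<le> ln (real p)" "0 \<le> ln (1 / \<delta>)" using p d by (auto simp: ln_ge_zero)
  have l4: "ln (4::real) \<le> 2"
  proof -
    have "ln (4 :: real) = 2 * ln 2" using ln_realpow[of 2 2] by simp
    then show ?thesis using ln_le_minus_one[of "2::real"] by simp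
  qed
  define A where "A = 4 * real (2 * k + 1) + (ln 4 + ln (real p) + ln (1 / \<delta>))"
  have A0: "0 \<le> A" using l by (simp add: A_def)
  have "1 \<le> real k" using k by simp
  then have A: "A \<le> 14 * (real k + ln (real p) + ln (1 / \<delta>))" using l l4 unfolding A_def by simp
  show "0 \<le> \<Delta>" unfolding \<Delta>_def A_def[symmetric] using A0 by simp
  have "\<Delta>\<^sup>2 = 64\<^sup>2 * (2 * real n * A) / (real n)\<^sup>2"
    unfolding \<Delta>_def A_def[symmetric] using A0 by (simp add: power_mult_distrib power_divide)
  also have "\<dots> = 8192 * A / real n" using n by (simp add: power2_eq_square)
  also have "\<dots> \<le> 8192 * (14 * (real k + ln (real p) + ln (1 / \<delta>))) / real n"
    using A by (intro divide_right_mono mult_left_mono) auto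
  also have "\<dots> = 114688 * ((real k + ln (real p) + ln (1 / \<delta>)) / real n)" by simp
  finally show "\<Delta>\<^sup>2 \<le> 114688 * ((real k + ln (real p) + ln (1 / \<delta>)) / real n)" .
qed

theorem theorem4p2:
  fixes M \<tau> :: real
  assumes "M > 0" and "0 < \<tau>" and "\<tau> < 1 / 2"
  shows "\<exists>C>0. \<exists>C\<^sub>1>0.
    \<forall>(n::nat) (p::nat) (k::nat) (\<alpha>\<^sub>0::real) (\<kappa>::real) (\<epsilon>::real) \<Gamma>hat (\<delta>::real) Q \<Gamma> \<eta> P.
      n \<ge> 1 \<longrightarrow> p \<ge> 1 \<longrightarrow> k \<ge> 1 \<longrightarrow> \<alpha>\<^sub>0 > 0 \<longrightarrow> \<kappa> > 0 \<longrightarrow> 0 \<le> \<epsilon> \<longrightarrow> \<epsilon> < \<tau> / 3 \<longrightarrow>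
      depth_estimator n p k \<Gamma>hat \<longrightarrow>
      0 < \<delta> \<longrightarrow> \<delta> < 1 / 2 \<longrightarrow>
      C\<^sub>1 * ((real k + ln (real p) + ln (1 / \<delta>)) / real n) < 1 \<longrightarrow>
      prob_space Q \<longrightarrow> sets Q = sets (borel_vec p) \<longrightarrow>
      \<Gamma> \<in> banded_bounded p k M \<longrightarrow>
      canonical_elliptical p \<Gamma> \<eta> P \<longrightarrow>
      marginal_condition p \<tau> \<alpha>\<^sub>0 \<kappa> \<Gamma> P \<longrightarrow>
      holds_with_prob_at_least (sample_law n (contaminated \<epsilon> P Q)) (1 - 2 * \<delta>)
        (\<lambda>X. (op_norm (\<Gamma>hat X - \<Gamma>))\<^sup>2
          \<le> C * \<kappa> * (max ((real k + ln (real p)) / real n) (\<epsilon>\<^sup>2) + ln (1 / \<delta>) / real n))"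
proof -
  define K :: real where "K = 114688"
  have K: "0 < K" by (simp add: K_def)
  show ?thesis
  proof (rule exI[of _ "9 * M\<^sup>2 * (12 * K + 3)"], rule conjI, goal_cases)
    case 1
    show ?case using assms(1) K by simp
  next
    case 2
    show ?case
    proof (rule exI[of _ "16 * K / \<tau>\<^sup>2"], rule conjI, goal_cases)
      case 1
      show ?case using assms(2) K by simp
    next
      case 2
      show ?case
      proof (intro allI impI)
        fix n p k :: nat and \<alpha>\<^sub>0 \<kappa> \<epsilon> \<delta> :: real and \<Gamma>hat Q \<Gamma> \<eta> P
        assume n: "n \<ge> 1" and p: "p \<ge> 1" and k: "k \<ge> 1" and "\<alpha>\<^sub>0 > 0" and kap: "\<kappa> > 0"
          and eps: "0 \<le> \<epsilon>" "\<epsilon> < \<tau> / 3" and est: "depth_estimator n p k \<Gamma>hat"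
          and d: "0 < \<delta>" "\<delta> < 1 / 2"
          and C1: "16 * K / \<tau>\<^sup>2 * ((real k + ln (real p) + ln (1 / \<delta>)) / real n) < 1"
          and Q: "prob_space Q" "sets Q = sets (borel_vec p)"
          and G: "\<Gamma> \<in> banded_bounded p k M" and can: "canonical_elliptical p \<Gamma> \<eta> P"
          and mc: "marginal_condition p \<tau> \<alpha>\<^sub>0 \<kappa> \<Gamma> P"
        define S where "S = 32 * sqrt (2 * real n * (4 * real (2 * k + 1) + (ln 4 + ln (real p) + ln (1 / \<delta>))))"
        define \<Delta> where "\<Delta> = 2 * S / real n"
        define R where "R = (real k + ln (real p) + ln (1 / \<delta>)) / real n"
        have Del: "0 \<le> \<Delta>" "\<Delta>\<^sup>2 \<le> K * R"
          using deviation_radius_bound[OF n p k d] unfolding \<Delta>_def S_def K_def R_def by auto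
        \<comment> \<open>The sample size condition leaves \<open>2 \<Delta> < \<tau>/2\<close>; with \<open>\<epsilon> < \<tau>/3\<close> this makes
          \<open>2 \<Delta> + \<epsilon> < 5 \<tau>/6\<close>, and \<open>1 - \<epsilon> > 5/6\<close> since \<open>\<tau> < 1/2\<close>.\<close>
        have Del4: "\<Delta> < \<tau> / 4"
        proof (rule power2_less_imp_less)
          have "16 * K * R < \<tau>\<^sup>2" using C1 assms(2) unfolding R_def[symmetric] by (simp add: divide_less_eq)
          then show "\<Delta>\<^sup>2 < (\<tau> / 4)\<^sup>2" using Del(2) by (simp add: power_divide)
        qed (use assms in simp)
        have eps1: "5 / 6 < 1 - \<epsilon>" "\<epsilon> < 1" using eps assms by auto
        define e where "e = (2 * \<Delta> + \<epsilon>) / (1 - \<epsilon>)"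
        have e_tau: "e < \<tau>"
        proof -
          have "2 * \<Delta> + \<epsilon> < \<tau> * (5 / 6)" using Del4 eps by simp
          also have "\<dots> \<le> \<tau> * (1 - \<epsilon>)" using eps1 assms by (intro mult_left_mono) auto
          finally show ?thesis using eps1 by (simp add: e_def divide_less_eq)
        qed
        have e_sq: "e\<^sup>2 \<le> 12 * \<Delta>\<^sup>2 + 3 * \<epsilon>\<^sup>2"
        proof -
          have "e \<le> (2 * \<Delta> + \<epsilon>) / (5 / 6)"
            unfolding e_def using eps1 Del eps by (intro divide_left_mono) auto
          then have "e\<^sup>2 \<le> ((2 * \<Delta> + \<epsilon>) / (5 / 6))\<^sup>2"
            using Del eps eps1 by (intro power_mono) (auto simp: e_def)
          also have "\<dots> = 36 / 25 * (2 * \<Delta> + \<epsilon>)\<^sup>2"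
            unfolding power_divide by (simp add: power2_eq_square)
          also have "\<dots> \<le> 36 / 25 * (8 * \<Delta>\<^sup>2 + 2 * \<epsilon>\<^sup>2)"
          proof (intro mult_left_mono)
            have "0 \<le> (2 * \<Delta> - \<epsilon>)\<^sup>2" by simp
            then show "(2 * \<Delta> + \<epsilon>)\<^sup>2 \<le> 8 * \<Delta>\<^sup>2 + 2 * \<epsilon>\<^sup>2" by (simp add: power2_eq_square algebra_simps)
          qed simp
          also have "\<dots> \<le> 12 * \<Delta>\<^sup>2 + 3 * \<epsilon>\<^sup>2" by simp
          finally show ?thesis .
        qed
        define a where "a = (real k + ln (real p)) / real n"
        define b where "b = ln (1 / \<delta>) / real n"
        have b0: "0 \<le> b" using d by (simp add: b_def ln_ge_zero)
        have Rab: "R = a + b" by (simp add: R_def a_def b_def add_divide_distrib)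
        have rate: "e\<^sup>2 \<le> (12 * K + 3) * (max a (\<epsilon>\<^sup>2) + b)"
        proof -
          have "e\<^sup>2 \<le> 12 * (K * (a + b)) + 3 * \<epsilon>\<^sup>2" using e_sq Del(2) unfolding Rab by linarith
          also have "\<dots> \<le> 12 * (K * (max a (\<epsilon>\<^sup>2) + b)) + 3 * (max a (\<epsilon>\<^sup>2) + b)"
            using K b0 by (intro add_mono mult_left_mono) auto
          finally show ?thesis by (simp add: algebra_simps)
        qed
        note P = canonical_elliptical_prob_space[OF can p]
        let ?N = "contaminated \<epsilon> P Q"
        have N: "prob_space ?N" "sets ?N = sets (borel_vec p)"
          using contaminated_mixture(1,2)[OF P(1) Q(1), of \<epsilon>] P(2) Q(2) eps eps1 by auto
        obtain E where E: "E \<in> sets (PiM {..<n} (\<lambda>_. ?N))" "1 - 2 * \<delta> \<le> measure (PiM {..<n} (\<lambda>_. ?N)) E"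
          and good: "\<And>X l. X \<in> E \<Longrightarrow> l \<le> p - 2 * k \<Longrightarrow> X \<notin> bad_sample n ?N (rational_halfspaces p l (2 * k)) S"
          using block_union_good_event[OF N p k n d S_def] by blast
        have "(op_norm (\<Gamma>hat X - \<Gamma>))\<^sup>2 \<le> 9 * M\<^sup>2 * (12 * K + 3) * \<kappa> * (max a (\<epsilon>\<^sup>2) + b)" if X: "X \<in> E" for X
        proof -
          have Xsp: "X \<in> space (PiM {..<n} (\<lambda>_. ?N))" using X sets.sets_into_space[OF E(1)] by auto
          have "space ?N = space (borel_vec p)" using N(2) by (rule sets_eq_imp_space_eq)
          then have "X \<in> space (sample_law n (borel_vec p))"
            using Xsp by (simp add: sample_law_def space_PiM)
          then have best: "is_arg_max (matrix_depth (directions p k) n X) (\<lambda>\<Gamma>. \<Gamma> \<in> banded p k) (\<Gamma>hat X)"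
            using est unfolding depth_estimator_def by blast
          have block: "\<exists>l\<le>p - 2 * k. u \<in> block_vecs p l (2 * k)" if "u \<in> directions p k" for u
            using that unfolding directions_eq_blocks
            by (auto simp: block_directions_def block_vecs_def unit_sphere_iff)
          have "(op_norm (\<Gamma>hat X - \<Gamma>))\<^sup>2 \<le> 9 * M\<^sup>2 * \<kappa> * ((2 * \<Delta> + \<epsilon>) / (1 - \<epsilon>))\<^sup>2"
          proof (rule depth_maximiser_close[OF p k kap eps(1) eps1(2) Del(1) _ P Q G _ mc best])
            show "(2 * \<Delta> + \<epsilon>) / (1 - \<epsilon>) < \<tau>" using e_tau by (simp add: e_def)
            show "marginal_cdf \<Gamma> P u 1 = 1 / 2" if "u \<in> unit_sphere p" for u
              using can that unfolding canonical_elliptical_def by blast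
          next
            fix u T assume "u \<in> directions p k" "0 \<le> (T :: real)"
            then show "\<bar>1 / real n * (\<Sum>i<n. of_bool (\<bar>u \<bullet> X i\<bar>\<^sup>2 \<le> T)) - measure ?N (slab_le p u T)\<bar> \<le> \<Delta>"
              unfolding \<Delta>_def using block slab_deviation(1)[OF N n Xsp good[OF X]] by blast
          next
            fix u T assume "u \<in> directions p k" "0 < (T :: real)"
            then show "\<bar>1 / real n * (\<Sum>i<n. of_bool (\<bar>u \<bullet> X i\<bar>\<^sup>2 \<ge> T)) - measure ?N (slab_ge p u T)\<bar> \<le> \<Delta>"
              unfolding \<Delta>_def using block slab_deviation(2)[OF N n Xsp good[OF X]] by blast
          qed
          also have "\<dots> \<le> 9 * M\<^sup>2 * \<kappa> * ((12 * K + 3) * (max a (\<epsilon>\<^sup>2) + b))"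
            using rate kap unfolding e_def by (intro mult_left_mono) auto
          finally show ?thesis by (simp add: mult_ac)
        qed
        then show "holds_with_prob_at_least (sample_law n ?N) (1 - 2 * \<delta>)
          (\<lambda>X. (op_norm (\<Gamma>hat X - \<Gamma>))\<^sup>2
            \<le> 9 * M\<^sup>2 * (12 * K + 3) * \<kappa> * (max ((real k + ln (real p)) / real n) (\<epsilon>\<^sup>2) + ln (1 / \<delta>) / real n))"
          unfolding holds_with_prob_at_least_def sample_law_def a_def b_def using E by blast
      qed
    qed
  qed
qed

end
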